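(* Let $\lambda>0$, $\alpha>2$, $R_{\rm d}>1$, ${\rm SNR}>0$, and let $N_{\rm r},L$ be integers with $1\le L\le N_{\rm r}-1$. The achievable sum spectral efficiency per unit area with local CSIR on the $L$ dominant (nearest) interferers, $C_\Sigma^{\rm sic}=\lambda\,\mathbb{E}\left[\log_2(1+{\rm SINR}^{\rm sic})\right]$, is $$C_{\Sigma}^{\rm sic}=\frac{\lambda}{\ln 2}\int_{1}^{R_{\rm d}}\int_{0}^{\infty}\frac{\left[1-\frac{1}{(1+zx^{-\alpha})^{N_{\rm r}}}\right]\mathcal{L}_{\tilde I}(L;z)}{z\exp\left(\frac{z}{\rm SNR}\right)}\,{\rm d}z\;\frac{2x}{R_{\rm d}^2-1}\,{\rm d}x,$$ where $$\mathcal{L}_{\tilde I}(L;z)=\int_{0}^{\infty}\exp\left(-\pi\lambda\int_{r^2}^{\infty}\frac{1}{1+z^{-1}u^{\frac{\alpha}{2}}}\,{\rm d}u\right)\frac{2(\lambda\pi r^2)^{L}}{r\,\Gamma(L)}\,e^{-\lambda\pi r^2}\,{\rm d}r .$$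
   Context: Network model. Single-antenna transmitters form a homogeneous Poisson point process (PPP) of density $\lambda$ in $\mathbb{R}^2$. Each transmitter has its own receiver with $N_{\rm r}$ antennas, located uniformly (with respect to area) in the annulus centred at the transmitter with inner radius $1$ and outer radius $R_{\rm d}$. Quantities of the typical link (i.e. under the Palm distribution) are as follows: - The direct link distance $d_0$ has density $\frac{2r}{R_{\rm d}^2-1}$ on $[1,R_{\rm d}]$. - The interfering transmitters form a homogeneous PPP of density $\lambda$ on $\mathbb{R}^2$; $d_1<d_2<\cdots$ denote their distances to the typical receiver, in increasing order. - The direct fading vector ${\bf h}_0$ and the interfering fading vectors ${\bf h}_1,{\bf h}_2,\ldots$ in $\mathbb{C}^{N_{\rm r}}$ are independent, with IID $\mathcal{CN}(0,1)$ entries (circularly symmetric complex Gaussian, $\mathbb{E}|\cdot|^2=1$). - $d_0$, the interferer point process, and the fading vectors are mutually independent. ZF-SIC receiver with local CSIR. The receiver knows ${\bf h}_0$ and the channels ${\bf h}_1,\dots,{\bf h}_L$ of its $L$ nearest interferers. It forms ${\bf H}=[{\bf h}_0,{\bf h}_1,\dots,{\bf h}_L]\in\mathbb{C}^{N_{\rm r}\times(1+L)}$, takes the QR decomposition ${\bf H}={\bf Q}{\bf R}$ (${\bf Q}$ an $N_{\rm r}\times N_{\rm r}$ unitary matrix, ${\bf R}$ upper triangular), multiplies the received signal by ${\bf Q}^*$, assumes the $L$ nearest interferers' data are correctly decoded and subtracted, and decodes its own signal from the first coordinate. The resulting signal-to-interference-plus-noise ratio is $${\rm SINR}^{\rm sic}=\frac{\tilde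 H_0\,d_0^{-\alpha}}{\tilde I+\frac{1}{\rm SNR}},\qquad \tilde H_0=|{\bf R}(1,1)|^2=\|{\bf h}_0\|_2^2,\qquad \tilde I=\sum_{j\ge L+1}\tilde H_j\,d_j^{-\alpha},\qquad \tilde H_j=\left|({\bf Q}^*{\bf h}_j)(1)\right|^2 .$$ Here $\alpha$ is the path-loss exponent and ${\rm SNR}=P/\sigma^2$. *)

theory Defs
  imports "HOL-Probability.Probability" "Jordan_Normal_Form.Schur_Decomposition"
begin

section \<open>Homogeneous Poisson point processes\<close>

definition locally_finite_sets :: "'a::euclidean_space set set" where
  "locally_finite_sets = {S. \<forall>B. bounded B \<longrightarrow> finite (S \<inter> B)}"

text \<open>The usual \<open>\<sigma>\<close>-algebra on point configurations, generated by the counts of points in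
  bounded Borel sets. Only its measurable sets matter; \<open>sigma\<close> carries the zero measure.\<close>

definition config_algebra :: "'a::euclidean_space set measure" where
  "config_algebra = sigma locally_finite_sets
     {{S \<in> locally_finite_sets. card (S \<inter> B) = k} | B k. B \<in> sets borel \<and> bounded B}"

text \<open>In the last clause, finite families of disjoint sets are covered by padding with \<open>{}\<close>.\<close>

definition homogeneous_ppp :: "'w measure \<Rightarrow> real \<Rightarrow> ('w \<Rightarrow> 'a::euclidean_space set) \<Rightarrow> bool" where
  "homogeneous_ppp M lam \<Phi> \<longleftrightarrow>
     \<Phi> \<in> M \<rightarrow>\<^sub>M config_algebra \<and>
     (\<forall>B k. B \<in> sets borel \<and> bounded B \<longrightarrow>
        measure M {\<omega> \<in> space M. card (\<Phi> \<omega> \<inter> B) = k} =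
          (lam * measure lborel B) ^ k / fact k * exp (- (lam * measure lborel B))) \<and>
     (\<forall>B :: nat \<Rightarrow> 'a set. (\<forall>i. B i \<in> sets borel \<and> bounded (B i)) \<and> disjoint_family B \<longrightarrow>
        prob_space.indep_vars M (\<lambda>_. count_space UNIV) (\<lambda>i \<omega>. card (\<Phi> \<omega> \<inter> B i)) UNIV)"

text \<open>The distance from \<open>p\<close> to its \<open>j\<close>-th nearest point of \<open>S\<close>, for \<open>j \<ge> 1\<close>. The lemma below
  confirms that these are the distances to \<open>p\<close> listed in increasing order.\<close>

definition nth_dist :: "'a::euclidean_space \<Rightarrow> 'a set \<Rightarrow> nat \<Rightarrow> real" where
  "nth_dist p S j = Inf {r. 0 \<le> r \<and> j \<le> card (S \<inter> cball p r)}"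

lemma nth_dist_eq:
  fixes p :: "'a::euclidean_space" and x :: "nat \<Rightarrow> 'a"
  assumes S: "S \<in> locally_finite_sets" "S = x ` {1..}"
    and mono: "strict_mono_on {1..} (\<lambda>i. dist p (x i))"
    and j: "1 \<le> j"
  shows "nth_dist p S j = dist p (x j)"
  unfolding nth_dist_def
proof (rule cInf_eq_minimum)
  have inj: "inj_on x {1..}"
    by (rule inj_onI) (metis mono strict_mono_on_eqD)
  have "x ` {1..j} \<subseteq> S \<inter> cball p (dist p (x j))"
    using S(2) strict_mono_on_leD[OF mono] j by auto
  moreover have "finite (S \<inter> cball p (dist p (x j)))"
    using S(1) by (auto simp: locally_finite_sets_def)
  moreover have "card (x ` {1..j}) = j"
    using inj by (subst card_image) (auto intro: inj_on_subset)
  ultimately have "j \<le> card (S \<inter> cball p (dist p (x j)))"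
    by (metis card_mono)
  then show "dist p (x j) \<in> {r. 0 \<le> r \<and> j \<le> card (S \<inter> cball p r)}"
    by simp
next
  fix r assume r: "r \<in> {r. 0 \<le> r \<and> j \<le> card (S \<inter> cball p r)}"
  show "dist p (x j) \<le> r"
  proof (rule ccontr)
    assume "\<not> dist p (x j) \<le> r"
    then have "i < j" if "1 \<le> i" "dist p (x i) \<le> r" for i
      using strict_mono_on_leD[OF mono, of j i] j that by fastforce
    then have "S \<inter> cball p r \<subseteq> x ` {1..<j}"
      using S(2) by auto
    then have "card (S \<inter> cball p r) \<le> card {1..<j}"
      by (meson card_image_le card_mono finite_atLeastLessThan finite_imageI le_trans)
    with r j show False by auto
  qed
qed


section \<open>Fading\<close>

text \<open>Density of \<open>CN(0,1)\<close> with respect to Lebesgue measure on \<open>\<complex>\<close>: real and imaginary part are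
  independent centred normals of variance \<open>1/2\<close>.\<close>

definition cn01_density :: "complex \<Rightarrow> real" where
  "cn01_density z = exp (- (cmod z)\<^sup>2) / pi"


section \<open>QR decomposition\<close>

definition unitary_mat :: "nat \<Rightarrow> complex mat \<Rightarrow> bool" where
  "unitary_mat n U \<longleftrightarrow> U \<in> carrier_mat n n \<and> mat_adjoint U * U = 1\<^sub>m n \<and> U * mat_adjoint U = 1\<^sub>m n"

text \<open>The constant \<^const>\<open>upper_triangular\<close> is not usable for \<open>R\<close>: for a matrix with more rows than
  columns it refers to entries outside the matrix.\<close>

definition is_QR :: "complex mat \<Rightarrow> complex mat \<Rightarrow> complex mat \<Rightarrow> bool" where
  "is_QR A Q R \<longleftrightarrow>
     unitary_mat (dim_row A) Q \<and>
     R \<in> carrier_mat (dim_row A) (dim_col A) \<and>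
     (\<forall>i < dim_row R. \<forall>j < dim_col R. j < i \<longrightarrow> R $$ (i, j) = 0) \<and>
     A = Q * R"


section \<open>The ZF-SIC receiver\<close>

definition channel_matrix :: "nat \<Rightarrow> nat \<Rightarrow> (nat \<Rightarrow> complex vec) \<Rightarrow> complex mat" where
  "channel_matrix Nr L h = mat_of_cols Nr (map h [0..<Suc L])"

definition effective_gain :: "complex mat \<Rightarrow> complex vec \<Rightarrow> real" where
  "effective_gain Q v = (cmod ((mat_adjoint Q *\<^sub>v v) $ 0))\<^sup>2"

text \<open>The sum ranges over the interferers with index \<open>j = L + 1 + k\<close>.\<close>

definition sic_interference ::
  "real \<Rightarrow> nat \<Rightarrow> complex mat \<Rightarrow> (nat \<Rightarrow> complex vec) \<Rightarrow> (nat \<Rightarrow> real) \<Rightarrow> real" where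
  "sic_interference \<alpha> L Q h d =
     (\<Sum>k. effective_gain Q (h (L + 1 + k)) * d (L + 1 + k) powr (- \<alpha>))"

definition sinr_sic ::
  "real \<Rightarrow> real \<Rightarrow> nat \<Rightarrow> complex mat \<Rightarrow> complex mat \<Rightarrow> real \<Rightarrow> (nat \<Rightarrow> complex vec) \<Rightarrow>
    (nat \<Rightarrow> real) \<Rightarrow> real" where
  "sinr_sic \<alpha> SNR L Q R d0 h d =
     (cmod (R $$ (0, 0)))\<^sup>2 * d0 powr (- \<alpha>) / (sic_interference \<alpha> L Q h d + 1 / SNR)"

definition sum_spectral_efficiency :: "real \<Rightarrow> 'w measure \<Rightarrow> ('w \<Rightarrow> real) \<Rightarrow> real" where
  "sum_spectral_efficiency lam M sinr = lam * (LINT \<omega>|M. log 2 (1 + sinr \<omega>))"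

definition laplace_interference :: "real \<Rightarrow> real \<Rightarrow> nat \<Rightarrow> real \<Rightarrow> real" where
  "laplace_interference lam \<alpha> L z =
     (LINT r:{0<..}|lborel.
        exp (- pi * lam * (LINT u:{r\<^sup>2<..}|lborel. 1 / (1 + inverse z * u powr (\<alpha> / 2)))) *
        (2 * (lam * pi * r\<^sup>2) ^ L / (r * Gamma (real L))) * exp (- lam * pi * r\<^sup>2))"

text \<open>The mutually independent sources of randomness; \<open>Fading j i\<close> is the \<open>i\<close>-th entry of the
  fading vector \<open>h j\<close>, where \<open>j = 0\<close> is the direct link.\<close>

datatype source = Direct_Distance | Interferers | Fading nat nat

definition source_events ::
  "'w measure \<Rightarrow> ('w \<Rightarrow> real) \<Rightarrow> ('w \<Rightarrow> 'a::euclidean_space set) \<Rightarrow> (nat \<Rightarrow> 'w \<Rightarrow> complex vec) \<Rightarrow>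
    source \<Rightarrow> 'w set set" where
  "source_events M d0 \<Phi> h s = (case s of
       Direct_Distance \<Rightarrow> sets (vimage_algebra (space M) d0 borel)
     | Interferers \<Rightarrow> sets (vimage_algebra (space M) \<Phi> config_algebra)
     | Fading j i \<Rightarrow> sets (vimage_algebra (space M) (\<lambda>\<omega>. h j \<omega> $ i) borel))"

end

theory Submission
  imports Defs
begin

text \<open>For \<open>x \<ge> 0\<close> and \<open>y > 0\<close> one has the Frullani-type formula
  \<open>ln (1 + x / y) = \<integral>\<^sub>0\<^sup>\<infinity> (1 - exp (- z x)) exp (- z y) / z dz\<close>, so the expected logarithm reduces to
  the Laplace transforms of the signal and of the interference. The first column of the unitary factor
  of a QR decomposition is \<open>h\<^sub>0 / \<parallel>h\<^sub>0\<parallel>\<close> up to a phase; given \<open>h\<^sub>0\<close>, rotational invariance makes the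
  effective gains of the interferers independent standard exponentials, which yields
  \<open>\<Prod>\<^sub>j\<^sub>>\<^sub>L 1 / (1 + z d\<^sub>j powr - \<alpha>)\<close> given the distances. Only the squared distances \<open>T\<^sub>j = d\<^sub>j\<^sup>2\<close> matter.
  They are the arrival times of a Poisson process of rate \<open>\<lambda> \<pi>\<close> on the half-line, and the expectation of
  the product is computed by rounding \<open>T\<^sub>L\<close> and the later arrivals up to a grid of mesh \<open>1 / n\<close>: the
  increments after the rounded \<open>T\<^sub>L\<close> are independent of the past, and \<open>n \<rightarrow> \<infinity>\<close> gives
  \<open>E exp (- \<lambda> \<pi> \<integral>\<^sub>u\<^sub>>\<^sub>T\<^sub>L (1 - g u) du)\<close>, where \<open>g u = 1 / (1 + z u powr - \<alpha>/2)\<close> and \<open>T\<^sub>L\<close> has an Erlang distribution.\<close>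

section \<open>Laplace transforms of complex Gaussian vectors\<close>

text \<open>Rounding goes up because the event that the rounded \<open>T L\<close> equals
  \<open>(i + 1) / n\<close> is decided by the counts at \<open>i / n\<close> and
  \<open>(i + 1) / n\<close> alone. Its indicator is a difference of two indicators
  \<open>L \<le> N t\<close>, so independence of increments at fixed times is enough, and neither
  conditioning on \<open>T L\<close> nor a strong Markov property enters. Rounding
  \<open>T L\<close> up might swallow arrival \<open>L + 1\<close>; almost sure strictness of
  \<open>T L < T (Suc L)\<close> excludes this in the limit.

  A second obstacle is that the interference is a \<open>suminf\<close>, unspecified where the
  series diverges. Its transform is therefore computed through partial sums, with limit
  \<open>0\<close> on divergence, and convergence is deduced afterwards wherever the signal is
  nonzero. Where the signal is zero, the SINR is zero whatever the interference is. The joint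
  transform carries separate parameters for signal and interference for the sake of this argument.

  Orders of integration are exchanged for nonnegative integrands; finiteness comes last, from
  positive noise and from link distances of at least 1.\<close>

lemma nn_integral_exp_Icc:
  fixes z x :: real
  assumes "0 < z" "0 \<le> x"
  shows "(\<integral>\<^sup>+s. ennreal (exp (- z * s)) * indicator {0..x} s \<partial>lborel) = ennreal ((1 - exp (- z * x)) / z)"
proof -
  have "(\<integral>\<^sup>+s. ennreal (exp (- z * s)) * indicator {0..x} s \<partial>lborel)
      = ennreal (- exp (- z * x) / z - (- exp (- z * 0) / z))"
  proof (rule nn_integral_FTC_Icc[where F = "\<lambda>s. - exp (- z * s) / z"])
    fix s :: real
    show "((\<lambda>s. - exp (- z * s) / z) has_real_derivative exp (- z * s)) (at s)"
      using assms by (auto intro!: derivative_eq_intros simp: field_simps)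
  qed (use assms in auto)
  then show ?thesis
    using assms by (simp add: diff_divide_distrib)
qed

lemma nn_integral_exp_Ioi:
  fixes y :: real
  assumes "0 < y"
  shows "(\<integral>\<^sup>+z. ennreal (exp (- z * y)) * indicator {0<..} z \<partial>lborel) = ennreal (1 / y)"
proof -
  have "(\<integral>\<^sup>+z. ennreal (exp (- z * y)) * indicator {0<..} z \<partial>lborel)
      = (\<integral>\<^sup>+z. ennreal (exp (- z * y)) * indicator {0..} z \<partial>lborel)"
  proof (rule nn_integral_cong_AE)
    show "AE z in lborel. ennreal (exp (- z * y)) * indicator {0<..} z
        = ennreal (exp (- z * y)) * indicator {0..} z"
      using AE_lborel_singleton[of "0::real"] by eventually_elim (auto simp: indicator_def)
  qed
  also have "\<dots> = ennreal (0 - (- exp (- 0 * y) / y))"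
  proof (rule nn_integral_FTC_atLeast[where F = "\<lambda>z. - exp (- z * y) / y"])
    fix z :: real
    show "((\<lambda>z. - exp (- z * y) / y) has_real_derivative exp (- z * y)) (at z)"
      using assms by (auto intro!: derivative_eq_intros simp: field_simps)
    show "((\<lambda>z. - exp (- z * y) / y) \<longlongrightarrow> 0) at_top"
      using assms by real_asymp
  qed auto
  finally show ?thesis by simp
qed

text \<open>The factor \<open>(1 - exp (- z * x)) / z\<close> is the integral of
  \<open>exp (- z * s)\<close> over \<open>s\<close> in \<open>{0..x}\<close>. After exchanging the
  integrals, the one over \<open>z\<close> gives \<open>1 / (y + s)\<close>, whose antiderivative is
  the logarithm.\<close>

lemma nn_integral_frullani:
  fixes x y :: real
  assumes x: "0 \<le> x" and y: "0 < y"
  shows "(\<integral>\<^sup>+z. ennreal ((1 - exp (- z * x)) * exp (- z * y) / z) * indicator {0<..} z \<partial>lborel)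
    = ennreal (ln (1 + x / y))"
proof -
  have "(\<integral>\<^sup>+z. ennreal ((1 - exp (- z * x)) * exp (- z * y) / z) * indicator {0<..} z \<partial>lborel)
     = (\<integral>\<^sup>+z. (\<integral>\<^sup>+s. ennreal (exp (- z * (y + s))) * indicator {0<..} z * indicator {0..x} s \<partial>lborel) \<partial>lborel)"
  proof (rule nn_integral_cong)
    fix z :: real
    show "ennreal ((1 - exp (- z * x)) * exp (- z * y) / z) * indicator {0<..} z
      = (\<integral>\<^sup>+s. ennreal (exp (- z * (y + s))) * indicator {0<..} z * indicator {0..x} s \<partial>lborel)"
    proof (cases "z > 0")
      case True
      have "ennreal ((1 - exp (- z * x)) * exp (- z * y) / z)
         = ennreal (exp (- z * y)) * (\<integral>\<^sup>+s. ennreal (exp (- z * s)) * indicator {0..x} s \<partial>lborel)"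
        using True x by (subst nn_integral_exp_Icc) (auto simp: ennreal_mult[symmetric] mult_ac)
      also have "\<dots> = (\<integral>\<^sup>+s. ennreal (exp (- z * y)) * (ennreal (exp (- z * s)) * indicator {0..x} s) \<partial>lborel)"
        by (rule nn_integral_cmult[symmetric]) measurable
      also have "\<dots> = (\<integral>\<^sup>+s. ennreal (exp (- z * (y + s))) * indicator {0..x} s \<partial>lborel)"
      proof (rule nn_integral_cong)
        fix s
        have "exp (- z * (y + s)) = exp (- z * y) * exp (- z * s)"
          by (simp add: exp_add[symmetric] algebra_simps)
        then show "ennreal (exp (- z * y)) * (ennreal (exp (- z * s)) * indicator {0..x} s)
            = ennreal (exp (- z * (y + s))) * indicator {0..x} s"
          by (simp add: ennreal_mult mult.assoc)
      qed
      finally show ?thesis using True by simp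
    qed auto
  qed
  also have "\<dots> = (\<integral>\<^sup>+s. (\<integral>\<^sup>+z. ennreal (exp (- z * (y + s))) * indicator {0<..} z * indicator {0..x} s \<partial>lborel) \<partial>lborel)"
    by (rule lborel_pair.Fubini') measurable
  also have "\<dots> = (\<integral>\<^sup>+s. ennreal (1 / (y + s)) * indicator {0..x} s \<partial>lborel)"
  proof (rule nn_integral_cong)
    fix s :: real
    show "(\<integral>\<^sup>+z. ennreal (exp (- z * (y + s))) * indicator {0<..} z * indicator {0..x} s \<partial>lborel)
       = ennreal (1 / (y + s)) * indicator {0..x} s"
      using y nn_integral_exp_Ioi[of "y + s"] by (cases "s \<in> {0..x}") (auto simp: add_pos_nonneg)
  qed
  also have "\<dots> = ennreal (ln (y + x) - ln (y + 0))"
  proof (rule nn_integral_FTC_Icc[where F = "\<lambda>s. ln (y + s)"])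
    fix s :: real assume "s \<in> {0..x}"
    then show "((\<lambda>s. ln (y + s)) has_real_derivative 1 / (y + s)) (at s)"
      using y by (auto intro!: derivative_eq_intros)
    from \<open>s \<in> {0..x}\<close> show "0 \<le> 1 / (y + s)" using y by auto
  qed (use x y in auto)
  also have "ln (y + x) - ln (y + 0) = ln (1 + x / y)"
    using x y ln_div[of "y + x" y] by (simp add: add_pos_nonneg add_divide_distrib)
  finally show ?thesis .
qed

text \<open>Up to the factor \<open>sqrt (pi / q)\<close>, the integrand is the normal density with
  mean \<open>- m\<close> and variance \<open>1 / (2 * q)\<close>.\<close>

lemma nn_integral_exp_square:
  fixes q m :: real
  assumes "0 < q"
  shows "(\<integral>\<^sup>+x. ennreal (exp (- q * (x + m)\<^sup>2)) \<partial>lborel) = ennreal (sqrt (pi / q))"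
proof -
  define \<sigma> where "\<sigma> = 1 / sqrt (2 * q)"
  have \<sigma>: "0 < \<sigma>" "\<sigma>\<^sup>2 = 1 / (2 * q)"
    using assms by (auto simp: \<sigma>_def power_divide)
  interpret prob_space "density lborel (normal_density (- m) \<sigma>)"
    using \<sigma> by (intro prob_space_normal_density)
  have "exp (- q * (x + m)\<^sup>2) = sqrt (pi / q) * normal_density (- m) \<sigma> x" for x
    using assms unfolding normal_density_def \<sigma>(2) by (simp add: field_simps real_sqrt_divide)
  then have "(\<integral>\<^sup>+x. ennreal (exp (- q * (x + m)\<^sup>2)) \<partial>lborel)
      = ennreal (sqrt (pi / q)) * (\<integral>\<^sup>+x. normal_density (- m) \<sigma> x \<partial>lborel)"
    using assms by (subst nn_integral_cmult[symmetric]) (auto simp: ennreal_mult)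
  also have "(\<integral>\<^sup>+x. normal_density (- m) \<sigma> x \<partial>lborel) = 1"
    using emeasure_space_1 by (simp add: emeasure_density)
  finally show ?thesis by simp
qed

lemma cn01_density_nonneg [simp]: "0 \<le> cn01_density w"
  by (simp add: cn01_density_def)

lemma cn01_density_measurable [measurable]: "cn01_density \<in> borel_measurable borel"
  unfolding cn01_density_def by measurable

lemma nn_integral_complex_exp_square:
  fixes m :: complex
  assumes "0 < q"
  shows "(\<integral>\<^sup>+w. ennreal (exp (- q * (cmod (w + m))\<^sup>2)) \<partial>lborel) = ennreal (pi / q)"
proof -
  have "(\<integral>\<^sup>+w. ennreal (exp (- q * (cmod (w + m))\<^sup>2)) \<partial>lborel)
    = (\<integral>\<^sup>+w. (\<Prod>b\<in>Basis. ennreal (exp (- q * (w \<bullet> b + m \<bullet> b)\<^sup>2))) \<partial>lborel)"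
    by (intro nn_integral_cong)
      (auto simp: Basis_complex_def inner_complex_def cmod_power2 ennreal_mult[symmetric]
         exp_add[symmetric] algebra_simps)
  also have "\<dots> = (\<Prod>b\<in>(Basis::complex set). (\<integral>\<^sup>+x. ennreal (exp (- q * (x + m \<bullet> b)\<^sup>2)) \<partial>lborel))"
    by (rule nn_integral_lborel_prod) auto
  also have "\<dots> = ennreal (pi / q)"
    using assms by (simp only: nn_integral_exp_square) (simp add: Basis_complex_def ennreal_mult[symmetric])
  finally show ?thesis .
qed

text \<open>Completing the square in \<open>w\<close>: \<open>q\<close> is the total coefficient of
  the square of \<open>cmod w\<close>, and the remainder free of \<open>w\<close> is what survives
  when one Gaussian entry is integrated out.\<close>

lemma cn01_complete_square:
  fixes c a w :: complex and s :: real
  assumes "0 \<le> s"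
  defines "q \<equiv> 1 + s * (cmod a)\<^sup>2"
  shows "s * (cmod (c + a * w))\<^sup>2 + (cmod w)\<^sup>2
    = q * (cmod (w + of_real (s / q) * (cnj a * c)))\<^sup>2 + s * (cmod c)\<^sup>2 / q"
proof -
  have q: "q > 0" using assms by (auto intro: add_pos_nonneg)
  obtain c1 c2 where c: "c = Complex c1 c2" by (cases c)
  obtain a1 a2 where a: "a = Complex a1 a2" by (cases a)
  obtain w1 w2 where w: "w = Complex w1 w2" by (cases w)
  define A where "A = a1\<^sup>2 + a2\<^sup>2"
  define C where "C = c1\<^sup>2 + c2\<^sup>2"
  define B1 where "B1 = a1 * c1 + a2 * c2"
  define B2 where "B2 = a1 * c2 - a2 * c1"
  have qA: "q = 1 + s * A" unfolding q_def a A_def by (simp add: cmod_power2)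
  \<comment> \<open>\<open>B1\<close> and \<open>B2\<close> are the real and imaginary part of
    \<open>cnj a * c\<close>, so this is multiplicativity of the squared modulus.\<close>
  have B: "B1\<^sup>2 + B2\<^sup>2 = A * C"
    unfolding B1_def B2_def A_def C_def by (simp add: algebra_simps power2_eq_square)
  define t where "t = s / q"
  have re: "Re (w + of_real t * (cnj a * c)) = w1 + t * B1"
    by (simp add: c a w B1_def)
  have im: "Im (w + of_real t * (cnj a * c)) = w2 + t * B2"
    by (simp add: c a w B2_def)
  have tq: "q * t = s" using q by (simp add: t_def)
  have "q * (cmod (w + of_real (s / q) * (cnj a * c)))\<^sup>2 = q * ((w1 + t * B1)\<^sup>2 + (w2 + t * B2)\<^sup>2)"
    unfolding t_def[symmetric] cmod_power2 re im ..
  also have "\<dots> = q * (w1\<^sup>2 + w2\<^sup>2) + 2 * (q * t) * (w1 * B1 + w2 * B2) + (q * t) * t * (B1\<^sup>2 + B2\<^sup>2)"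
    by (simp add: power2_eq_square algebra_simps)
  also have "\<dots> = q * (w1\<^sup>2 + w2\<^sup>2) + 2 * s * (w1 * B1 + w2 * B2) + s\<^sup>2 / q * (B1\<^sup>2 + B2\<^sup>2)"
    unfolding tq by (simp add: t_def power2_eq_square)
  also have "\<dots> = q * (w1\<^sup>2 + w2\<^sup>2) + 2 * s * (w1 * B1 + w2 * B2) + s\<^sup>2 / q * (A * C)"
    by (simp add: B)
  also have "s\<^sup>2 / q * (A * C) = s * C * (s * A / q)"
    by (simp add: power2_eq_square)
  also have "s * A / q = 1 - 1 / q"
    using q qA by (simp add: diff_divide_eq_iff)
  also have "s * C * (1 - 1 / q) = s * C - s * C / q"
    by (simp add: right_diff_distrib)
  finally have "q * (cmod (w + of_real (s / q) * (cnj a * c)))\<^sup>2 + s * C / q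
     = q * (w1\<^sup>2 + w2\<^sup>2) + 2 * s * (w1 * B1 + w2 * B2) + s * C" by simp
  also have "\<dots> = s * (cmod (c + a * w))\<^sup>2 + (cmod w)\<^sup>2"
    unfolding qA c a w A_def B1_def B2_def C_def cmod_power2
    by (simp add: algebra_simps power2_eq_square)
  finally show ?thesis by (simp add: C_def c cmod_power2)
qed

text \<open>The result has again the shape of a constant times
  \<open>exp (- s' * (cmod c)\<^sup>2)\<close>, now with \<open>s' = s / q\<close>; this is what
  allows iteration over the entries of a vector.\<close>

lemma nn_integral_cn01_affine:
  fixes c a :: complex and s :: real
  assumes s: "0 \<le> s"
  shows "(\<integral>\<^sup>+w. ennreal (cn01_density w) * ennreal (exp (- s * (cmod (c + a * w))\<^sup>2)) \<partial>lborel)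
    = ennreal (exp (- s * (cmod c)\<^sup>2 / (1 + s * (cmod a)\<^sup>2)) / (1 + s * (cmod a)\<^sup>2))"
proof -
  define q where "q = 1 + s * (cmod a)\<^sup>2"
  have q: "q > 0" using s by (auto simp: q_def intro: add_pos_nonneg)
  have "cn01_density w * exp (- s * (cmod (c + a * w))\<^sup>2)
      = exp (- s * (cmod c)\<^sup>2 / q) / pi * exp (- q * (cmod (w + of_real (s / q) * (cnj a * c)))\<^sup>2)" for w
    using cn01_complete_square[OF s, of c a w] unfolding cn01_density_def q_def[symmetric]
    by (simp add: exp_add[symmetric] minus_add_distrib[symmetric] add.commute del: minus_add_distrib)
  then have "(\<integral>\<^sup>+w. ennreal (cn01_density w) * ennreal (exp (- s * (cmod (c + a * w))\<^sup>2)) \<partial>lborel)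
     = ennreal (exp (- s * (cmod c)\<^sup>2 / q) / pi)
       * (\<integral>\<^sup>+w. ennreal (exp (- q * (cmod (w + of_real (s / q) * (cnj a * c)))\<^sup>2)) \<partial>lborel)"
    by (subst nn_integral_cmult[symmetric]) (auto simp: ennreal_mult[symmetric])
  also have "\<dots> = ennreal (exp (- s * (cmod c)\<^sup>2 / q) / q)"
    using q by (subst nn_integral_complex_exp_square) (auto simp: ennreal_mult[symmetric])
  finally show ?thesis by (simp add: q_def)
qed

lemma distributed_cn01_nn_integral:
  assumes "distributed N lborel e (\<lambda>z. ennreal (cn01_density z))" "0 \<le> s"
  shows "(\<integral>\<^sup>+x. ennreal (exp (- s * (cmod (c + a * e x))\<^sup>2)) \<partial>N)
    = ennreal (exp (- s * (cmod c)\<^sup>2 / (1 + s * (cmod a)\<^sup>2)) / (1 + s * (cmod a)\<^sup>2))"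
  using distributed_nn_integral[OF assms(1), of "\<lambda>w. ennreal (exp (- s * (cmod (c + a * w))\<^sup>2))"]
    nn_integral_cn01_affine[OF assms(2)] by simp

text \<open>Integrating out the entry \<open>i\<close> first treats the rest of the sum as part of
  the offset and replaces \<open>s\<close> by \<open>s / q\<close>. Hence \<open>s\<close> is
  generalised in the induction while \<open>c\<close> stays fixed. The denominators combine by
  \<open>q * (1 + s / q * A) = q + s * A\<close>.\<close>

lemma nn_integral_PiM_cn01_row:
  fixes N :: "'i \<Rightarrow> 'v measure" and e :: "'v \<Rightarrow> complex" and a :: "'i \<Rightarrow> complex"
  assumes N: "\<And>i. prob_space (N i)" and I: "finite I"
    and e: "\<And>i. i \<in> I \<Longrightarrow> distributed (N i) lborel e (\<lambda>z. ennreal (cn01_density z))"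
    and s: "0 \<le> s"
  shows "(\<integral>\<^sup>+x. ennreal (exp (- s * (cmod (c + (\<Sum>i\<in>I. a i * e (x i))))\<^sup>2)) \<partial>PiM I N)
    = ennreal (exp (- s * (cmod c)\<^sup>2 / (1 + s * (\<Sum>i\<in>I. (cmod (a i))\<^sup>2)))
        / (1 + s * (\<Sum>i\<in>I. (cmod (a i))\<^sup>2)))"
  using I e s
proof (induction I arbitrary: s rule: finite_induct)
  case empty
  interpret product_prob_space N by (intro product_prob_spaceI N)
  show ?case
    by (simp add: PiM_empty nn_integral_count_space_finite)
next
  case (insert i I)
  interpret product_prob_space N by (intro product_prob_spaceI N)
  have [measurable]: "e \<in> borel_measurable (N j)" if "j \<in> insert i I" for j
    using distributed_measurable[OF insert.prems(1)[OF that]] by simp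
  define A where "A = (\<Sum>i\<in>I. (cmod (a i))\<^sup>2)"
  define q where "q = 1 + s * (cmod (a i))\<^sup>2"
  have q: "q > 0" using insert.prems by (auto simp: q_def intro: add_pos_nonneg)
  have A: "A \<ge> 0" unfolding A_def by (intro sum_nonneg) auto
  have meas: "(\<lambda>x. ennreal (exp (- s * (cmod (c + (\<Sum>j\<in>J. a j * e (x j))))\<^sup>2))) \<in> borel_measurable (PiM J N)"
    if "J \<subseteq> insert i I" for J s
  proof -
    have [measurable]: "(\<lambda>x. e (x j)) \<in> borel_measurable (PiM J N)" if "j \<in> J" for j
      using that \<open>J \<subseteq> insert i I\<close> by (intro measurable_compose[OF measurable_component_singleton]) auto
    show ?thesis by measurable
  qed
  have "(\<integral>\<^sup>+x. ennreal (exp (- s * (cmod (c + (\<Sum>j\<in>insert i I. a j * e (x j))))\<^sup>2)) \<partial>PiM (insert i I) N)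
    = (\<integral>\<^sup>+x. (\<integral>\<^sup>+y. ennreal (exp (- s * (cmod (c + (\<Sum>j\<in>insert i I. a j * e ((x(i := y)) j))))\<^sup>2)) \<partial>N i) \<partial>PiM I N)"
    using insert.hyps by (intro product_nn_integral_insert meas) auto
  also have "\<dots> = (\<integral>\<^sup>+x. (\<integral>\<^sup>+y. ennreal (exp (- s * (cmod ((c + (\<Sum>j\<in>I. a j * e (x j))) + a i * e y))\<^sup>2)) \<partial>N i) \<partial>PiM I N)"
  proof (intro nn_integral_cong)
    fix x y
    have "(\<Sum>j\<in>I. a j * e ((x(i := y)) j)) = (\<Sum>j\<in>I. a j * e (x j))"
      using insert.hyps by (intro sum.cong) auto
    then have "c + (\<Sum>j\<in>insert i I. a j * e ((x(i := y)) j)) = (c + (\<Sum>j\<in>I. a j * e (x j))) + a i * e y"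
      using insert.hyps by (simp add: add_ac)
    then show "ennreal (exp (- s * (cmod (c + (\<Sum>j\<in>insert i I. a j * e ((x(i := y)) j))))\<^sup>2))
      = ennreal (exp (- s * (cmod ((c + (\<Sum>j\<in>I. a j * e (x j))) + a i * e y))\<^sup>2))" by (simp only:)
  qed
  also have "\<dots> = (\<integral>\<^sup>+x. ennreal (1 / q) * ennreal (exp (- (s / q) * (cmod (c + (\<Sum>j\<in>I. a j * e (x j))))\<^sup>2)) \<partial>PiM I N)"
    using insert.prems q by (subst distributed_cn01_nn_integral)
      (auto simp: ennreal_mult[symmetric] q_def[symmetric])
  also have "\<dots> = ennreal (1 / q) * ennreal (exp (- (s / q) * (cmod c)\<^sup>2 / (1 + s / q * A)) / (1 + s / q * A))"
    unfolding A_def using insert.prems q by (subst nn_integral_cmult[OF meas], blast, subst insert.IH) auto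
  also have "\<dots> = ennreal (exp (- s * (cmod c)\<^sup>2 / (q + s * A)) / (q + s * A))"
  proof -
    have "0 \<le> s * A" using A insert.prems by simp
    then have "q + s * A > 0" using q by linarith
    moreover have "1 + s / q * A = (q + s * A) / q" using q by (simp add: field_simps)
    ultimately show ?thesis using q by (simp add: ennreal_mult[symmetric] field_simps)
  qed
  also have "q + s * A = 1 + s * (\<Sum>i\<in>insert i I. (cmod (a i))\<^sup>2)"
    using insert.hyps by (simp add: q_def A_def algebra_simps)
  finally show ?case .
qed

lemma measurable_PiM_component:
  assumes "g \<in> N i \<rightarrow>\<^sub>M L" "i \<in> J"
  shows "(\<lambda>x. g (x i)) \<in> PiM J N \<rightarrow>\<^sub>M L"
  using measurable_compose[where f="\<lambda>x. x i" and g=g and N="N i", OF measurable_component_singleton[OF assms(2), where M=N] assms(1)] .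

text \<open>Distinct interferers occupy disjoint coordinates, so the integral factors. A projection
  onto a unit vector turns each row into a standard complex Gaussian, whose squared modulus is a
  standard exponential with transform \<open>1 / (1 + s)\<close>.\<close>

lemma nn_integral_PiM_cn01_rows:
  fixes N :: "source \<Rightarrow> 'v measure" and e :: "'v \<Rightarrow> complex" and a :: "nat \<Rightarrow> complex" and s :: "nat \<Rightarrow> real"
  assumes N: "\<And>i. prob_space (N i)" and K: "finite K"
    and e: "\<And>k i. k \<in> K \<Longrightarrow> i < n \<Longrightarrow> distributed (N (Fading k i)) lborel e (\<lambda>z. ennreal (cn01_density z))"
    and s: "\<And>k. k \<in> K \<Longrightarrow> 0 \<le> s k" and a: "(\<Sum>i<n. (cmod (a i))\<^sup>2) = 1"
  shows "(\<integral>\<^sup>+x. (\<Prod>k\<in>K. ennreal (exp (- s k * (cmod (\<Sum>i<n. a i * e (x (Fading k i))))\<^sup>2)))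
      \<partial>PiM (\<Union>k\<in>K. Fading k ` {..<n}) N) = (\<Prod>k\<in>K. ennreal (1 / (1 + s k)))"
  using K e s
proof (induction K rule: finite_induct)
  case empty
  show ?case by (simp add: PiM_empty nn_integral_count_space_finite)
next
  case (insert k K)
  interpret product_prob_space N by (intro product_prob_spaceI N)
  let ?U = "\<Union>k\<in>K. Fading k ` {..<n}" and ?R = "Fading k ` {..<n}"
  let ?f = "\<lambda>k x. ennreal (exp (- s k * (cmod (\<Sum>i<n. a i * e (x (Fading k i))))\<^sup>2))"
  have meas: "(\<lambda>x. ?f j x) \<in> borel_measurable (PiM J N)"
    if "Fading j ` {..<n} \<subseteq> J" "j \<in> insert k K" for J j
  proof -
    have [measurable]: "(\<lambda>x. e (x (Fading j i))) \<in> borel_measurable (PiM J N)" if "i < n" for i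
      using that \<open>Fading j ` {..<n} \<subseteq> J\<close> distributed_measurable[OF insert.prems(1)[OF \<open>j \<in> insert k K\<close> that]]
      by (intro measurable_PiM_component[where g=e]) auto
    have [measurable]: "(\<lambda>x. \<Sum>i<n. a i * e (x (Fading j i))) \<in> borel_measurable (PiM J N)"
      by (intro borel_measurable_sum borel_measurable_times) auto
    show ?thesis by measurable
  qed
  have "(\<integral>\<^sup>+x. (\<Prod>j\<in>insert k K. ?f j x) \<partial>PiM (?U \<union> ?R) N)
     = (\<integral>\<^sup>+x. (\<integral>\<^sup>+y. (\<Prod>j\<in>insert k K. ?f j (merge ?U ?R (x, y))) \<partial>PiM ?R N) \<partial>PiM ?U N)"
  proof (rule product_nn_integral_fold)
    show "(\<lambda>x. \<Prod>j\<in>insert k K. ?f j x) \<in> borel_measurable (PiM (?U \<union> ?R) N)"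
      by (intro borel_measurable_prod_ennreal meas) auto
  qed (use insert.hyps in auto)
  also have "\<dots> = (\<integral>\<^sup>+x. (\<integral>\<^sup>+y. (\<Prod>j\<in>K. ?f j x) * ?f k y \<partial>PiM ?R N) \<partial>PiM ?U N)"
  proof (intro nn_integral_cong)
    fix x y
    have "?f j (merge ?U ?R (x, y)) = ?f j x" if "j \<in> K" for j
      using that by (intro arg_cong[where f="\<lambda>u. ennreal (exp (- s j * (cmod u)\<^sup>2))"] sum.cong)
        (auto simp: merge_def)
    moreover have "?f k (merge ?U ?R (x, y)) = ?f k y"
      using insert.hyps by (intro arg_cong[where f="\<lambda>u. ennreal (exp (- s k * (cmod u)\<^sup>2))"] sum.cong)
        (auto simp: merge_def)
    ultimately show "(\<Prod>j\<in>insert k K. ?f j (merge ?U ?R (x, y))) = (\<Prod>j\<in>K. ?f j x) * ?f k y"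
      unfolding prod.insert[OF insert.hyps] by (subst mult.commute) (simp only: cong: prod.cong)
  qed
  also have "\<dots> = (\<integral>\<^sup>+x. (\<Prod>j\<in>K. ?f j x) * ennreal (1 / (1 + s k)) \<partial>PiM ?U N)"
  proof (intro nn_integral_cong)
    fix x
    \<comment> \<open>The lemma on one row indexes coefficients by the coordinates of the product,
      here sources, so \<open>a\<close> is extended to all sources, by \<open>0\<close> outside the
      fading.\<close>
    let ?a = "\<lambda>t. case t of Fading _ i \<Rightarrow> a i | _ \<Rightarrow> 0"
    have inj: "inj_on (Fading k) {..<n}" by (auto simp: inj_on_def)
    have "(\<integral>\<^sup>+y. ?f k y \<partial>PiM ?R N)
        = (\<integral>\<^sup>+y. ennreal (exp (- s k * (cmod (0 + (\<Sum>i\<in>?R. ?a i * e (y i))))\<^sup>2)) \<partial>PiM ?R N)"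
      by (simp add: sum.reindex[OF inj])
    also have "\<dots> = ennreal (1 / (1 + s k))"
      using insert.prems a by (subst nn_integral_PiM_cn01_row[OF N]) (auto simp: sum.reindex[OF inj])
    finally have row: "(\<integral>\<^sup>+y. ?f k y \<partial>PiM ?R N) = ennreal (1 / (1 + s k))" .
    have "(\<integral>\<^sup>+y. (\<Prod>j\<in>K. ?f j x) * ?f k y \<partial>PiM ?R N) = (\<Prod>j\<in>K. ?f j x) * (\<integral>\<^sup>+y. ?f k y \<partial>PiM ?R N)"
      by (rule nn_integral_cmult) (rule meas; simp)
    then show "(\<integral>\<^sup>+y. (\<Prod>j\<in>K. ?f j x) * ?f k y \<partial>PiM ?R N) = (\<Prod>j\<in>K. ?f j x) * ennreal (1 / (1 + s k))"
      by (simp only: row)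
  qed
  also have "\<dots> = (\<integral>\<^sup>+x. (\<Prod>j\<in>K. ?f j x) \<partial>PiM ?U N) * ennreal (1 / (1 + s k))"
    by (intro nn_integral_multc borel_measurable_prod_ennreal meas) auto
  also have "(\<integral>\<^sup>+x. (\<Prod>j\<in>K. ?f j x) \<partial>PiM ?U N) = (\<Prod>k\<in>K. ennreal (1 / (1 + s k)))"
    using insert by blast
  finally show ?case
    using insert.hyps by (simp add: Un_commute mult.commute)
qed

text \<open>The squared norm is a sum of \<open>n\<close> independent standard exponentials, so its
  transform is the \<open>n\<close>-th power of \<open>1 / (1 + t)\<close>, and the complement is
  taken in total mass 1.\<close>

lemma nn_integral_PiM_cn01_gain:
  fixes N :: "source \<Rightarrow> 'v measure" and e :: "'v \<Rightarrow> complex"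
  assumes N: "\<And>i. prob_space (N i)" and t: "0 \<le> t"
    and e: "\<And>i. i < n \<Longrightarrow> distributed (N (Fading 0 i)) lborel e (\<lambda>z. ennreal (cn01_density z))"
  shows "(\<integral>\<^sup>+x. ennreal (1 - exp (- (\<Sum>i<n. (cmod (e (x (Fading 0 i))))\<^sup>2) * t)) \<partial>PiM (Fading 0 ` {..<n}) N)
      = ennreal (1 - 1 / (1 + t) ^ n)"
proof -
  let ?R = "Fading 0 ` {..<n}"
  interpret product_prob_space N by (intro product_prob_spaceI N)
  interpret Q: prob_space "PiM ?R N" by (intro prob_space_PiM N)
  have inj: "inj_on (Fading 0) {..<n}" by (auto simp: inj_on_def)
  let ?f = "\<lambda>v. ennreal (exp (- t * (cmod (e v))\<^sup>2))"
  have mf: "?f \<in> borel_measurable (N i)" if "i \<in> ?R" for i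
  proof -
    have [measurable]: "e \<in> borel_measurable (N i)"
      using that distributed_measurable[OF e] by auto
    show ?thesis by measurable
  qed
  have meas: "(\<lambda>x. \<Prod>i\<in>?R. ?f (x i)) \<in> borel_measurable (PiM ?R N)"
  proof (rule borel_measurable_prod_ennreal)
    fix i assume i: "i \<in> ?R"
    show "(\<lambda>x. ?f (x i)) \<in> borel_measurable (PiM ?R N)"
      by (rule measurable_PiM_component[where g="?f" and N=N, OF mf[OF i] i])
  qed
  have "(\<integral>\<^sup>+x. (\<Prod>i\<in>?R. ?f (x i)) \<partial>PiM ?R N) = (\<Prod>i\<in>?R. \<integral>\<^sup>+v. ?f v \<partial>N i)"
    by (rule product_nn_integral_prod) (simp, rule mf)
  also have "\<dots> = (\<Prod>i\<in>?R. ennreal (1 / (1 + t)))"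
  proof (intro prod.cong refl)
    fix i assume "i \<in> ?R"
    then have "distributed (N i) lborel e (\<lambda>z. ennreal (cn01_density z))" using e by auto
    from distributed_cn01_nn_integral[OF this t, of 0 1] show "(\<integral>\<^sup>+v. ?f v \<partial>N i) = ennreal (1 / (1 + t))"
      by simp
  qed
  also have "\<dots> = ennreal (1 / (1 + t) ^ n)"
    using t by (simp add: card_image[OF inj] ennreal_power power_divide)
  finally have prod: "(\<integral>\<^sup>+x. (\<Prod>i\<in>?R. ?f (x i)) \<partial>PiM ?R N) = ennreal (1 / (1 + t) ^ n)" .
  have prod_le: "(\<Prod>i\<in>?R. ?f (x i)) \<le> 1" for x
    using t by (intro prod_le_1) (auto simp: mult_nonneg_nonneg)
  have "(\<integral>\<^sup>+x. ennreal (1 - exp (- (\<Sum>i<n. (cmod (e (x (Fading 0 i))))\<^sup>2) * t)) \<partial>PiM ?R N)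
     = (\<integral>\<^sup>+x. 1 - (\<Prod>i\<in>?R. ?f (x i)) \<partial>PiM ?R N)"
  proof (intro nn_integral_cong)
    fix x
    have "(\<Prod>i\<in>?R. ?f (x i)) = ennreal (exp (- (\<Sum>i<n. (cmod (e (x (Fading 0 i))))\<^sup>2) * t))"
      by (simp add: prod.reindex[OF inj] prod_ennreal exp_sum[symmetric] sum_distrib_left sum_negf mult.commute)
    then show "ennreal (1 - exp (- (\<Sum>i<n. (cmod (e (x (Fading 0 i))))\<^sup>2) * t)) = 1 - (\<Prod>i\<in>?R. ?f (x i))"
      by (simp only: ennreal_1[symmetric] ennreal_minus[OF exp_ge_zero])
  qed
  also have "\<dots> = (\<integral>\<^sup>+x. 1 \<partial>PiM ?R N) - (\<integral>\<^sup>+x. (\<Prod>i\<in>?R. ?f (x i)) \<partial>PiM ?R N)"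
    using prod prod_le by (intro nn_integral_diff meas) auto
  also have "\<dots> = ennreal (1 - 1 / (1 + t) ^ n)"
    using t ennreal_minus[of "1 / (1 + t) ^ n" 1] unfolding prod by (simp add: Q.emeasure_space_1)
  finally show ?thesis .
qed

text \<open>Given the direct channel \<open>h\<^sub>0\<close>, the vector \<open>h\<^sub>0 / \<parallel>h\<^sub>0\<parallel>\<close> is a fixed unit vector, so the gains
  of the interferers are independent standard exponentials; if \<open>h\<^sub>0 = 0\<close>, the first factor vanishes.\<close>

lemma nn_integral_PiM_sources:
  fixes N :: "source \<Rightarrow> 'v measure" and e :: "'v \<Rightarrow> complex" and g :: "'v \<Rightarrow> real" and c :: "nat \<Rightarrow> 'v \<Rightarrow> real"
  assumes N: "\<And>i. prob_space (N i)" and K: "finite K" "0 \<notin> K"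
    and e: "\<And>k i. i < n \<Longrightarrow> distributed (N (Fading k i)) lborel e (\<lambda>z. ennreal (cn01_density z))"
    and g [measurable]: "g \<in> borel_measurable (N Direct_Distance)" and g0: "\<And>v. 0 \<le> g v"
    and c [measurable]: "\<And>k. k \<in> K \<Longrightarrow> c k \<in> borel_measurable (N Interferers)" and c0: "\<And>k v. k \<in> K \<Longrightarrow> 0 \<le> c k v"
  defines "H \<equiv> \<lambda>x. \<Sum>i<n. (cmod (e (x (Fading 0 i))))\<^sup>2"
  defines "J \<equiv> insert Direct_Distance (insert Interferers (Fading 0 ` {..<n})) \<union> (\<Union>k\<in>K. Fading k ` {..<n})"
  shows "(\<integral>\<^sup>+x. ennreal (1 - exp (- H x * g (x Direct_Distance))) *
        (\<Prod>k\<in>K. ennreal (exp (- c k (x Interferers) *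
          ((cmod (\<Sum>i<n. cnj (e (x (Fading 0 i))) * e (x (Fading k i))))\<^sup>2 / H x)))) \<partial>PiM J N)
    = (\<integral>\<^sup>+v. ennreal (1 - 1 / (1 + g v) ^ n) \<partial>N Direct_Distance)
      * (\<integral>\<^sup>+v. (\<Prod>k\<in>K. ennreal (1 / (1 + c k v))) \<partial>N Interferers)"
proof -
  interpret product_prob_space N by (intro product_prob_spaceI N)
  let ?R = "Fading 0 ` {..<n}" and ?U = "\<Union>k\<in>K. Fading k ` {..<n}"
  let ?J0 = "insert Direct_Distance (insert Interferers ?R)"
  let ?A = "\<lambda>x. ennreal (1 - exp (- H x * g (x Direct_Distance)))"
  let ?B = "\<lambda>v. (\<Prod>k\<in>K. ennreal (1 / (1 + c k v)))"
  have me [measurable]: "(\<lambda>x. e (x (Fading j i))) \<in> borel_measurable (PiM J N)"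
    if "i < n" "Fading j i \<in> J" for J i j
    using that distributed_measurable[OF e]
    by (intro measurable_PiM_component[where g=e]) auto
  have mH [measurable]: "H \<in> borel_measurable (PiM J N)" if "?R \<subseteq> J" for J
    unfolding H_def using that by (intro borel_measurable_sum borel_measurable_power borel_measurable_norm me) auto
  have mA: "?A \<in> borel_measurable (PiM J N)" if "insert Direct_Distance ?R \<subseteq> J" for J
  proof -
    have [measurable]: "(\<lambda>x. g (x Direct_Distance)) \<in> borel_measurable (PiM J N)"
      using that by (intro measurable_PiM_component[where g=g] g) auto
    have [measurable]: "H \<in> borel_measurable (PiM J N)" using that by (intro mH) auto
    show ?thesis by measurable
  qed
  let ?F = "\<lambda>x. ?A x * (\<Prod>k\<in>K. ennreal (exp (- c k (x Interferers) *
          ((cmod (\<Sum>i<n. cnj (e (x (Fading 0 i))) * e (x (Fading k i))))\<^sup>2 / H x))))"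
  have mF: "?F \<in> borel_measurable (PiM J N)"
  proof -
    have [measurable]: "(\<lambda>x. c k (x Interferers)) \<in> borel_measurable (PiM J N)" if "k \<in> K" for k
      using that by (intro measurable_PiM_component[where g="c k"] c) (auto simp: J_def)
    have [measurable]: "(\<lambda>x. \<Sum>i<n. cnj (e (x (Fading 0 i))) * e (x (Fading k i))) \<in> borel_measurable (PiM J N)"
      if "k \<in> K" for k
    proof (rule borel_measurable_sum)
      fix i assume "i \<in> {..<n}"
      with that have m0: "(\<lambda>x. e (x (Fading 0 i))) \<in> borel_measurable (PiM J N)"
        and mk: "(\<lambda>x. e (x (Fading k i))) \<in> borel_measurable (PiM J N)"
        by (auto intro!: me simp: J_def)
      have cnj: "cnj \<in> borel_measurable borel"
        by (intro borel_measurable_continuous_onI continuous_intros)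
      show "(\<lambda>x. cnj (e (x (Fading 0 i))) * e (x (Fading k i))) \<in> borel_measurable (PiM J N)"
        by (intro borel_measurable_times measurable_compose[OF m0 cnj] mk)
    qed
    have [measurable]: "H \<in> borel_measurable (PiM J N)" by (rule mH) (auto simp: J_def)
    have [measurable]: "?A \<in> borel_measurable (PiM J N)" by (rule mA) (auto simp: J_def)
    show ?thesis by measurable
  qed
  \<comment> \<open>The interferers' fading is integrated first, with the direct channel, the link
    distance and the point process held fixed; \<open>?J0\<close> and \<open>?U\<close> are disjoint
    because \<open>0 \<notin> K\<close>.\<close>
  have "(\<integral>\<^sup>+x. ?F x \<partial>PiM J N) = (\<integral>\<^sup>+x. (\<integral>\<^sup>+y. ?F (merge ?J0 ?U (x, y)) \<partial>PiM ?U N) \<partial>PiM ?J0 N)"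
    using mF K unfolding J_def by (intro product_nn_integral_fold) auto
  also have "\<dots> = (\<integral>\<^sup>+x. ?A x * ?B (x Interferers) \<partial>PiM ?J0 N)"
  proof (intro nn_integral_cong)
    fix x
    have H0: "0 \<le> H x" unfolding H_def by (intro sum_nonneg) auto
    have HM: "H (merge ?J0 ?U (x, y)) = H x" for y
      unfolding H_def by (intro sum.cong) (auto simp: merge_def)
    have DM: "merge ?J0 ?U (x, y) Direct_Distance = x Direct_Distance" for y
      by (simp add: merge_def)
    show "(\<integral>\<^sup>+y. ?F (merge ?J0 ?U (x, y)) \<partial>PiM ?U N) = ?A x * ?B (x Interferers)"
    proof (cases "H x = 0")
      case True
      then show ?thesis by (simp add: HM)
    next
      case False
      with H0 have Hp: "H x > 0" by simp
      \<comment> \<open>The conjugated unit vector along the direct channel, constant with respect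
        to the inner integral.\<close>
      define a where "a i = cnj (e (x (Fading 0 i))) / of_real (sqrt (H x))" for i
      have "(\<Sum>i<n. (cmod (a i))\<^sup>2) = (\<Sum>i<n. (cmod (e (x (Fading 0 i))))\<^sup>2 / H x)"
        using Hp by (intro sum.cong) (auto simp: a_def norm_divide power_divide)
      also have "\<dots> = 1"
        using Hp unfolding sum_divide_distrib[symmetric] H_def by simp
      finally have a1: "(\<Sum>i<n. (cmod (a i))\<^sup>2) = 1" .
      let ?G = "\<lambda>y. \<Prod>k\<in>K. ennreal (exp (- c k (x Interferers) * (cmod (\<Sum>i<n. a i * e (y (Fading k i))))\<^sup>2))"
      have "?F (merge ?J0 ?U (x, y)) = ?A x * ?G y" for y
      proof -
        have "ennreal (exp (- c k (merge ?J0 ?U (x, y) Interferers) *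
          ((cmod (\<Sum>i<n. cnj (e (merge ?J0 ?U (x, y) (Fading 0 i))) * e (merge ?J0 ?U (x, y) (Fading k i))))\<^sup>2 / H x)))
          = ennreal (exp (- c k (x Interferers) * (cmod (\<Sum>i<n. a i * e (y (Fading k i))))\<^sup>2))" if k: "k \<in> K" for k
        proof -
          have "(\<Sum>i<n. cnj (e (merge ?J0 ?U (x, y) (Fading 0 i))) * e (merge ?J0 ?U (x, y) (Fading k i)))
            = of_real (sqrt (H x)) * (\<Sum>i<n. a i * e (y (Fading k i)))"
            unfolding sum_distrib_left
          proof (rule sum.cong)
            fix i assume "i \<in> {..<n}"
            moreover have "k \<noteq> 0" using k K by metis
            ultimately show "cnj (e (merge ?J0 ?U (x, y) (Fading 0 i))) * e (merge ?J0 ?U (x, y) (Fading k i))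
              = of_real (sqrt (H x)) * (a i * e (y (Fading k i)))"
              using k Hp by (auto simp: merge_def a_def)
          qed simp
          then have "(cmod (\<Sum>i<n. cnj (e (merge ?J0 ?U (x, y) (Fading 0 i))) * e (merge ?J0 ?U (x, y) (Fading k i))))\<^sup>2
            = H x * (cmod (\<Sum>i<n. a i * e (y (Fading k i))))\<^sup>2"
            using Hp by (simp add: norm_mult power_mult_distrib)
          then have "(cmod (\<Sum>i<n. cnj (e (merge ?J0 ?U (x, y) (Fading 0 i))) * e (merge ?J0 ?U (x, y) (Fading k i))))\<^sup>2 / H x
            = (cmod (\<Sum>i<n. a i * e (y (Fading k i))))\<^sup>2"
            using Hp by (simp only:) simp
          moreover have "merge ?J0 ?U (x, y) Interferers = x Interferers" by (simp add: merge_def)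
          ultimately show ?thesis by (simp only:)
        qed
        then show ?thesis by (simp only: HM DM cong: prod.cong)
      qed
      then have "(\<integral>\<^sup>+y. ?F (merge ?J0 ?U (x, y)) \<partial>PiM ?U N) = (\<integral>\<^sup>+y. ?A x * ?G y \<partial>PiM ?U N)"
        by (simp only:)
      also have "\<dots> = ?A x * (\<integral>\<^sup>+y. ?G y \<partial>PiM ?U N)"
      proof (rule nn_integral_cmult)
        have [measurable]: "(\<lambda>y. \<Sum>i<n. a i * e (y (Fading k i))) \<in> borel_measurable (PiM ?U N)" if "k \<in> K" for k
          using that by (intro borel_measurable_sum borel_measurable_times me) auto
        show "?G \<in> borel_measurable (PiM ?U N)" by measurable
      qed
      also have "(\<integral>\<^sup>+y. ?G y \<partial>PiM ?U N) = ?B (x Interferers)"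
        using K e c0 a1 by (intro nn_integral_PiM_cn01_rows N) auto
      finally show ?thesis .
    qed
  qed
  \<comment> \<open>The remaining integrand is a product of a function of the direct link and a
    function of the point process. Bringing \<open>Interferers\<close> to the head allows its
    coordinate to be split off.\<close>
  also have "\<dots> = (\<integral>\<^sup>+x. ?A x * ?B (x Interferers) \<partial>PiM (insert Interferers (insert Direct_Distance ?R)) N)"
    by (simp add: insert_commute)
  also have "\<dots> = (\<integral>\<^sup>+x. (\<integral>\<^sup>+v. ?A (x(Interferers := v)) * ?B ((x(Interferers := v)) Interferers) \<partial>N Interferers)
      \<partial>PiM (insert Direct_Distance ?R) N)"
  proof (rule product_nn_integral_insert)
    have [measurable]: "(\<lambda>x. ?B (x Interferers)) \<in> borel_measurable (PiM (insert Interferers (insert Direct_Distance ?R)) N)"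
    proof -
      have [measurable]: "?B \<in> borel_measurable (N Interferers)" by measurable
      show ?thesis by (rule measurable_PiM_component[where g="?B"]) auto
    qed
    have [measurable]: "?A \<in> borel_measurable (PiM (insert Interferers (insert Direct_Distance ?R)) N)"
      by (rule mA) auto
    show "(\<lambda>x. ?A x * ?B (x Interferers)) \<in> borel_measurable (PiM (insert Interferers (insert Direct_Distance ?R)) N)"
      by measurable
  qed auto
  also have "\<dots> = (\<integral>\<^sup>+x. ?A x * (\<integral>\<^sup>+v. ?B v \<partial>N Interferers) \<partial>PiM (insert Direct_Distance ?R) N)"
    by (simp add: H_def nn_integral_cmult)
  also have "\<dots> = (\<integral>\<^sup>+x. ?A x \<partial>PiM (insert Direct_Distance ?R) N) * (\<integral>\<^sup>+v. ?B v \<partial>N Interferers)"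
    by (intro nn_integral_multc mA) auto
  also have "(\<integral>\<^sup>+x. ?A x \<partial>PiM (insert Direct_Distance ?R) N)
      = (\<integral>\<^sup>+v. (\<integral>\<^sup>+x. ?A (x(Direct_Distance := v)) \<partial>PiM ?R N) \<partial>N Direct_Distance)"
    by (intro product_nn_integral_insert_rev mA) auto
  also have "\<dots> = (\<integral>\<^sup>+v. ennreal (1 - 1 / (1 + g v) ^ n) \<partial>N Direct_Distance)"
    using nn_integral_PiM_cn01_gain[where N=N and e=e and n=n, OF N g0 e] by (simp add: H_def)
  finally show ?thesis .
qed

section \<open>Arrival times of a Poisson process\<close>

lemma nn_integral_nat_valued:
  fixes X :: "'w \<Rightarrow> nat" and f :: "nat \<Rightarrow> ennreal"
  assumes [measurable]: "X \<in> M \<rightarrow>\<^sub>M count_space UNIV"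
  shows "(\<integral>\<^sup>+\<omega>. f (X \<omega>) \<partial>M) = (\<Sum>k. f k * emeasure M {\<omega> \<in> space M. X \<omega> = k})"
proof -
  have "(\<integral>\<^sup>+\<omega>. f (X \<omega>) \<partial>M) = (\<integral>\<^sup>+\<omega>. (\<Sum>k. f k * indicator {\<omega> \<in> space M. X \<omega> = k} \<omega>) \<partial>M)"
  proof (rule nn_integral_cong)
    fix \<omega> assume "\<omega> \<in> space M"
    then have "(\<Sum>k. f k * indicator {\<omega> \<in> space M. X \<omega> = k} \<omega>) = (\<Sum>k\<in>{X \<omega>}. f k * indicator {\<omega> \<in> space M. X \<omega> = k} \<omega>)"
      by (intro suminf_finite) auto
    then show "f (X \<omega>) = (\<Sum>k. f k * indicator {\<omega> \<in> space M. X \<omega> = k} \<omega>)"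
      using \<open>\<omega> \<in> space M\<close> by simp
  qed
  also have "\<dots> = (\<Sum>k. f k * emeasure M {\<omega> \<in> space M. X \<omega> = k})"
    by (subst nn_integral_suminf) (auto simp: nn_integral_cmult_indicator)
  finally show ?thesis .
qed

text \<open>The generating function is an exponential series at \<open>m * c\<close>. With
  \<open>c\<close> the value of the attenuation on a grid cell, it supplies one factor of the
  exponential functional of the process.\<close>

lemma (in prob_space) poisson_pgf:
  fixes X :: "'a \<Rightarrow> nat" and m c :: real
  assumes [measurable]: "X \<in> M \<rightarrow>\<^sub>M count_space UNIV"
    and X: "\<And>k. prob {\<omega> \<in> space M. X \<omega> = k} = m ^ k / fact k * exp (- m)"
    and m: "0 \<le> m" and c: "0 \<le> c" "c \<le> 1"
  shows "expectation (\<lambda>\<omega>. c ^ X \<omega>) = exp (- m * (1 - c))"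
proof -
  have "(\<integral>\<^sup>+\<omega>. ennreal (c ^ X \<omega>) \<partial>M) = (\<Sum>k. ennreal (c ^ k) * emeasure M {\<omega> \<in> space M. X \<omega> = k})"
    by (rule nn_integral_nat_valued) measurable
  also have "\<dots> = (\<Sum>k. ennreal ((m * c) ^ k / fact k * exp (- m)))"
  proof -
    have "ennreal (c ^ k) * emeasure M {\<omega> \<in> space M. X \<omega> = k} = ennreal ((m * c) ^ k / fact k * exp (- m))" for k
      using m c unfolding emeasure_eq_measure X
      by (subst ennreal_mult[symmetric]) (auto simp: power_mult_distrib mult_ac)
    then show ?thesis by simp
  qed
  also have "\<dots> = ennreal (exp (m * c) * exp (- m))"
  proof (rule suminf_ennreal_eq)
    show "(\<lambda>k. (m * c) ^ k / fact k * exp (- m)) sums (exp (m * c) * exp (- m))"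
      using exp_converges[of "m * c"] by (intro sums_mult2) (simp add: divide_inverse mult.commute)
  qed (use m c in auto)
  also have "exp (m * c) * exp (- m) = exp (- m * (1 - c))"
    by (simp add: exp_add[symmetric] algebra_simps)
  finally show ?thesis
    using c by (subst integral_eq_nn_integral) auto
qed

text \<open>The link \<open>T_N\<close> between arrival times and counts holds only almost
  everywhere: on the null event of fewer than \<open>j\<close> points in all,
  \<open>nth_dist\<close> is the infimum of the empty set. Increments are differences of naturals,
  exact by \<open>N_mono\<close>.\<close>

locale poisson_arrivals = prob_space M for M :: "'w measure" +
  fixes \<mu> :: real and N :: "real \<Rightarrow> 'w \<Rightarrow> nat" and T :: "nat \<Rightarrow> 'w \<Rightarrow> real"
  assumes rate: "0 < \<mu>"
    and N_meas: "\<And>t. 0 \<le> t \<Longrightarrow> N t \<in> M \<rightarrow>\<^sub>M count_space UNIV"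
    and T_meas [measurable]: "\<And>j. T j \<in> borel_measurable M"
    and N_mono: "\<And>s t \<omega>. \<omega> \<in> space M \<Longrightarrow> 0 \<le> s \<Longrightarrow> s \<le> t \<Longrightarrow> N s \<omega> \<le> N t \<omega>"
    and T_N: "AE \<omega> in M. \<forall>j\<ge>1. \<forall>t\<ge>0. T j \<omega> \<le> t \<longleftrightarrow> j \<le> N t \<omega>"
    and N_prob: "\<And>t k. 0 \<le> t \<Longrightarrow> prob {\<omega> \<in> space M. N t \<omega> = k} = (\<mu> * t) ^ k / fact k * exp (- (\<mu> * t))"
    and inc_prob: "\<And>s t k. 0 \<le> s \<Longrightarrow> s \<le> t \<Longrightarrow>
      prob {\<omega> \<in> space M. N t \<omega> - N s \<omega> = k} = (\<mu> * (t - s)) ^ k / fact k * exp (- (\<mu> * (t - s)))"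
    and inc_indep: "\<And>u :: nat \<Rightarrow> real. mono u \<Longrightarrow> 0 \<le> u 0 \<Longrightarrow>
      indep_vars (\<lambda>_. count_space UNIV) (\<lambda>i \<omega>. case i of 0 \<Rightarrow> N (u 0) \<omega> | Suc k \<Rightarrow> N (u (Suc k)) \<omega> - N (u k) \<omega>) UNIV"
begin

text \<open>The count at time 0 is Poisson with mean 0. Positivity keeps arrivals inside the region
  where the attenuation is continuous, and keeps their grid index away from 0.\<close>

lemma T_pos: "AE \<omega> in M. \<forall>j\<ge>1. 0 < T j \<omega>"
proof -
  have [measurable]: "N 0 \<in> M \<rightarrow>\<^sub>M count_space UNIV" by (rule N_meas) simp
  have "prob {\<omega> \<in> space M. N 0 \<omega> = 0} = 1"
    using N_prob[of 0 0] by simp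
  then have "AE \<omega> in M. N 0 \<omega> = 0"
    by (subst (asm) prob_Collect_eq_1) auto
  with T_N show ?thesis
  proof eventually_elim
    case (elim \<omega>)
    show ?case
    proof (intro allI impI)
      fix j :: nat assume "1 \<le> j"
      with elim have "\<not> T j \<omega> \<le> 0" by simp
      then show "0 < T j \<omega>" by simp
    qed
  qed
qed

text \<open>The indicator is a function of the zeroth increment \<open>N (u 0)\<close> and each
  power a function of one later increment, so independence factors the expectation and each later
  factor is a Poisson generating function.\<close>

lemma increments_product:
  fixes c :: "nat \<Rightarrow> real"
  assumes u: "mono u" "0 \<le> u 0" and c: "\<And>i. 0 \<le> c i" "\<And>i. c i \<le> 1"
  shows "expectation (\<lambda>\<omega>. of_bool (L \<le> N (u 0) \<omega>) * (\<Prod>i<n. c i ^ (N (u (Suc i)) \<omega> - N (u i) \<omega>)))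
    = prob {\<omega> \<in> space M. L \<le> N (u 0) \<omega>} * (\<Prod>i<n. exp (- (\<mu> * (u (Suc i) - u i)) * (1 - c i)))"
proof -
  define K where "K i \<omega> = (case i of 0 \<Rightarrow> N (u 0) \<omega> | Suc k \<Rightarrow> N (u (Suc k)) \<omega> - N (u k) \<omega>)" for i \<omega>
  define f where "f i k = (case i of 0 \<Rightarrow> of_bool (L \<le> k) | Suc j \<Rightarrow> c j ^ k)" for i k :: nat
  have u0: "0 \<le> u i" for i using u monoD[OF u(1), of 0 i] by simp
  have indep: "indep_vars (\<lambda>_. borel) (\<lambda>i \<omega>. f i (K i \<omega>)) {..<Suc n}"
  proof (rule indep_vars_compose2[where Y=f])
    have "indep_vars (\<lambda>_. count_space UNIV) K UNIV"
      using inc_indep[OF u] by (simp add: K_def[abs_def])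
    then show "indep_vars (\<lambda>_. count_space UNIV) K {..<Suc n}"
      by (rule indep_vars_subset) simp
  qed simp
  have int: "integrable M (\<lambda>\<omega>. f i (K i \<omega>))" if "i \<in> {..<Suc n}" for i
  proof (rule integrable_const_bound[where B=1])
    show "AE \<omega> in M. norm (f i (K i \<omega>)) \<le> 1"
      using c by (auto simp: f_def power_le_one split: nat.split)
    show "(\<lambda>\<omega>. f i (K i \<omega>)) \<in> borel_measurable M"
      using indep that unfolding indep_vars_def by auto
  qed
  have "expectation (\<lambda>\<omega>. \<Prod>i\<in>{..<Suc n}. f i (K i \<omega>)) = (\<Prod>i\<in>{..<Suc n}. expectation (\<lambda>\<omega>. f i (K i \<omega>)))"
    by (rule indep_vars_lebesgue_integral[OF _ indep int]) auto
  also have "(\<lambda>\<omega>. \<Prod>i\<in>{..<Suc n}. f i (K i \<omega>))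
      = (\<lambda>\<omega>. of_bool (L \<le> N (u 0) \<omega>) * (\<Prod>i<n. c i ^ (N (u (Suc i)) \<omega> - N (u i) \<omega>)))"
    unfolding prod.lessThan_Suc_shift by (simp add: f_def K_def)
  also have "(\<Prod>i\<in>{..<Suc n}. expectation (\<lambda>\<omega>. f i (K i \<omega>)))
      = prob {\<omega> \<in> space M. L \<le> N (u 0) \<omega>} * (\<Prod>i<n. exp (- (\<mu> * (u (Suc i) - u i)) * (1 - c i)))"
  proof -
    have "expectation (\<lambda>\<omega>. f 0 (K 0 \<omega>)) = prob {\<omega> \<in> space M. L \<le> N (u 0) \<omega>}"
    proof -
      have [measurable]: "N (u 0) \<in> M \<rightarrow>\<^sub>M count_space UNIV" by (rule N_meas) fact
      have "expectation (\<lambda>\<omega>. f 0 (K 0 \<omega>)) = expectation (indicator {\<omega> \<in> space M. L \<le> N (u 0) \<omega>})"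
        by (intro Bochner_Integration.integral_cong) (auto simp: f_def K_def indicator_def)
      then show ?thesis by simp
    qed
    moreover have "expectation (\<lambda>\<omega>. f (Suc i) (K (Suc i) \<omega>)) = exp (- (\<mu> * (u (Suc i) - u i)) * (1 - c i))" for i
    proof -
      have [measurable]: "N (u i) \<in> M \<rightarrow>\<^sub>M count_space UNIV" for i by (rule N_meas) fact
      have le: "u i \<le> u (Suc i)" using monoD[OF u(1)] by simp
      show ?thesis
        unfolding f_def K_def nat.case
        using rate le u0 by (intro poisson_pgf inc_prob c) auto
    qed
    ultimately show ?thesis
      unfolding prod.lessThan_Suc_shift by simp
  qed
  finally show ?thesis .
qed

text \<open>The event is tested at cell \<open>j\<close> but the product starts at cell
  \<open>i\<close>. The cells in between are filled with weight 1, which makes their increments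
  invisible on both sides.\<close>

lemma grid_product:
  fixes c :: "nat \<Rightarrow> real" and n :: nat
  assumes n: "0 < n" and ji: "j \<le> i" "i \<le> m" and c: "\<And>i. 0 \<le> c i" "\<And>i. c i \<le> 1"
  shows "expectation (\<lambda>\<omega>. of_bool (L \<le> N (real j / n) \<omega>) *
      (\<Prod>k=i..<m. c (Suc k) ^ (N (real (Suc k) / n) \<omega> - N (real k / n) \<omega>)))
    = prob {\<omega> \<in> space M. L \<le> N (real j / n) \<omega>} * (\<Prod>k=i..<m. exp (- (\<mu> / n) * (1 - c (Suc k))))"
proof -
  define u where "u k = real (j + k) / n" for k
  define c' where "c' k = (if j + k < i then 1 else c (Suc (j + k)))" for k
  have u: "mono u" "0 \<le> u 0" by (auto simp: u_def mono_def divide_right_mono)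
  have shift: "(\<Prod>k<m-j. if j + k < i then 1 else f (j + k)) = (\<Prod>k=i..<m. f k)" for f :: "nat \<Rightarrow> real"
  proof -
    have "(\<Prod>k<m-j. if j + k < i then 1 else f (j + k)) = (\<Prod>k=0..<m-j. if k + j < i then 1 else f (k + j))"
      unfolding lessThan_atLeast0 by (intro prod.cong refl) (metis add.commute)
    also have "\<dots> = (\<Prod>k=0+j..<(m-j)+j. if k < i then 1 else f k)"
      by (rule prod.shift_bounds_nat_ivl[symmetric])
    also have "\<dots> = (\<Prod>k=i..<m. f k)"
      using ji by (intro prod.mono_neutral_cong_right) auto
    finally show ?thesis .
  qed
  have "expectation (\<lambda>\<omega>. of_bool (L \<le> N (u 0) \<omega>) * (\<Prod>k<m-j. c' k ^ (N (u (Suc k)) \<omega> - N (u k) \<omega>)))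
    = prob {\<omega> \<in> space M. L \<le> N (u 0) \<omega>} * (\<Prod>k<m-j. exp (- (\<mu> * (u (Suc k) - u k)) * (1 - c' k)))"
    using c by (intro increments_product u) (auto simp: c'_def)
  moreover have "(\<Prod>k<m-j. c' k ^ (N (u (Suc k)) \<omega> - N (u k) \<omega>))
      = (\<Prod>k=i..<m. c (Suc k) ^ (N (real (Suc k) / n) \<omega> - N (real k / n) \<omega>))" for \<omega>
    unfolding shift[symmetric] by (intro prod.cong) (auto simp: c'_def u_def)
  moreover have "(\<Prod>k<m-j. exp (- (\<mu> * (u (Suc k) - u k)) * (1 - c' k)))
      = (\<Prod>k=i..<m. exp (- (\<mu> / n) * (1 - c (Suc k))))"
    unfolding shift[symmetric] using n by (intro prod.cong) (auto simp: c'_def u_def field_simps)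
  ultimately show ?thesis by (simp add: u_def)
qed

end

section \<open>Rounding up to the grid of mesh \<open>1 / n\<close>\<close>

lemma grid_index_le_iff:
  assumes "0 < n"
  shows "nat \<lceil>real n * x\<rceil> \<le> i \<longleftrightarrow> x \<le> real i / real n"
proof -
  have "nat \<lceil>real n * x\<rceil> \<le> i \<longleftrightarrow> real n * x \<le> real i"
    by (simp add: nat_le_iff ceiling_le_iff)
  then show ?thesis using assms by (simp add: field_simps)
qed

lemma grid_index_eq_Suc_iff:
  assumes n: "0 < n"
  shows "nat \<lceil>real n * x\<rceil> = Suc k \<longleftrightarrow> real k / real n < x \<and> x \<le> real (Suc k) / real n"
proof -
  define D where "D = nat \<lceil>real n * x\<rceil>"
  have "D = Suc k \<longleftrightarrow> \<not> D \<le> k \<and> D \<le> Suc k" by auto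
  then show ?thesis
    unfolding D_def grid_index_le_iff[OF n] by (simp only: not_le)
qed

lemma grid_index_ge: "0 < n \<Longrightarrow> x \<le> real (nat \<lceil>real n * x\<rceil>) / real n"
  using grid_index_le_iff[of n x "nat \<lceil>real n * x\<rceil>"] by simp

lemma grid_index_less:
  assumes "0 < n" "0 \<le> x"
  shows "real (nat \<lceil>real n * x\<rceil>) / real n < x + 1 / real n"
proof -
  have "real (nat \<lceil>real n * x\<rceil>) < real n * x + 1"
    using assms by (simp add: ceiling_correct) linarith
  then show ?thesis using assms by (simp add: field_simps)
qed

lemma grid_index_tendsto:
  assumes "0 \<le> x"
  shows "(\<lambda>n. real (nat \<lceil>real n * x\<rceil>) / real n) \<longlonglongrightarrow> x"
proof (rule real_tendsto_sandwich)
  show "\<forall>\<^sub>F n in sequentially. x \<le> real (nat \<lceil>real n * x\<rceil>) / real n"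
    using eventually_gt_at_top[of "0::nat"] by eventually_elim (rule grid_index_ge)
  show "\<forall>\<^sub>F n in sequentially. real (nat \<lceil>real n * x\<rceil>) / real n \<le> x + 1 / real n"
    using eventually_gt_at_top[of "0::nat"] by eventually_elim (rule less_imp_le, rule grid_index_less[OF _ assms])
  show "(\<lambda>n. x + 1 / real n) \<longlonglongrightarrow> x" by real_asymp
qed simp

text \<open>A Riemann sum is the integral of a step function that is constant on the cells;
  dominated convergence can then replace a theory of Riemann sums. Integrability is carried along
  because the induction adds integrals.\<close>

lemma sum_grid_eq_integral:
  fixes f :: "real \<Rightarrow> real"
  assumes n: "0 < n" and im: "i \<le> m"
  shows "integrable lborel (\<lambda>x. if real i / n < x \<and> x \<le> real m / n then f (real (nat \<lceil>real n * x\<rceil>) / n) else 0) \<and>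
    (\<Sum>k=i..<m. f (real (Suc k) / n) / n)
    = (LINT x|lborel. (if real i / n < x \<and> x \<le> real m / n then f (real (nat \<lceil>real n * x\<rceil>) / n) else 0))"
  using im
proof (induction m rule: dec_induct)
  case base
  have "\<not> (real i / n < x \<and> x \<le> real i / n)" for x by simp
  then show ?case by (simp only: if_False) simp
next
  case (step m)
  let ?F = "\<lambda>m x. if real i / n < x \<and> x \<le> real m / n then f (real (nat \<lceil>real n * x\<rceil>) / n) else 0"
  let ?I = "{real m / n<..real (Suc m) / n}"
  have im: "real i / n \<le> real m / n" "real m / n \<le> real (Suc m) / n"
    using step.hyps n by (auto simp: divide_right_mono)
  have eq: "?F (Suc m) x = ?F m x + indicator ?I x * f (real (Suc m) / n)" for x
  proof (cases "x \<in> ?I")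
    case True
    then have "nat \<lceil>real n * x\<rceil> = Suc m"
      unfolding grid_index_eq_Suc_iff[OF n] by auto
    with True im show ?thesis by simp
  next
    case False
    then have "x \<le> real (Suc m) / n \<longleftrightarrow> x \<le> real m / n"
      using im by (meson greaterThanAtMost_iff linorder_not_le order_trans)
    with False show ?thesis by simp
  qed
  have int: "integrable lborel (\<lambda>x. indicator ?I x * f (real (Suc m) / n))"
  proof (intro integrable_mult_left integrable_real_indicator)
    show "emeasure lborel ?I < \<infinity>" using im by (subst emeasure_lborel_Ioc) auto
  qed simp
  have val: "(LINT x|lborel. indicator ?I x * f (real (Suc m) / n)) = f (real (Suc m) / n) / n"
    using im n by (simp add: field_simps)
  have "(\<Sum>k=i..<Suc m. f (real (Suc k) / n) / n) = (\<Sum>k=i..<m. f (real (Suc k) / n) / n) + f (real (Suc m) / n) / n"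
    using step.hyps(1) by (rule sum.atLeastLessThan_Suc)
  then show ?case
    unfolding eq using step.IH int val
    by (simp only: Bochner_Integration.integral_add Bochner_Integration.integrable_add simp_thms)
qed

section \<open>Distinctness of consecutive arrivals, and products over grid cells\<close>

context poisson_arrivals
begin

text \<open>With \<open>m\<close> the mean, the probability is
  \<open>1 - (1 + m) * exp (- m)\<close>, and \<open>exp (- m) \<ge> 1 - m\<close> bounds it by the
  square of \<open>m\<close>. The quadratic order is what beats the number of cells in the next
  lemma.\<close>

lemma prob_increment_ge_2:
  assumes "0 \<le> s" "s \<le> t"
  shows "prob {\<omega> \<in> space M. 2 \<le> N t \<omega> - N s \<omega>} \<le> (\<mu> * (t - s))\<^sup>2"
proof -
  have [measurable]: "N t \<in> M \<rightarrow>\<^sub>M count_space UNIV" "N s \<in> M \<rightarrow>\<^sub>M count_space UNIV"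
    using assms by (auto intro: N_meas)
  let ?m = "\<mu> * (t - s)"
  let ?X = "\<lambda>\<omega>. N t \<omega> - N s \<omega>"
  have m: "0 \<le> ?m" using rate assms by simp
  have "{\<omega> \<in> space M. 2 \<le> ?X \<omega>} = space M - ({\<omega> \<in> space M. ?X \<omega> = 0} \<union> {\<omega> \<in> space M. ?X \<omega> = 1})"
    by auto
  also have "prob \<dots> = 1 - prob ({\<omega> \<in> space M. ?X \<omega> = 0} \<union> {\<omega> \<in> space M. ?X \<omega> = 1})"
    by (rule prob_compl) measurable
  also have "prob ({\<omega> \<in> space M. ?X \<omega> = 0} \<union> {\<omega> \<in> space M. ?X \<omega> = 1})
      = prob {\<omega> \<in> space M. ?X \<omega> = 0} + prob {\<omega> \<in> space M. ?X \<omega> = 1}"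
    by (rule finite_measure_Union) (measurable, auto)
  also have "\<dots> = (1 + ?m) * exp (- ?m)"
    using inc_prob[OF assms, of 0] inc_prob[OF assms, of 1] by (simp add: algebra_simps)
  finally have "prob {\<omega> \<in> space M. 2 \<le> ?X \<omega>} = 1 - (1 + ?m) * exp (- ?m)" .
  moreover have "(1 + ?m) * (1 - ?m) \<le> (1 + ?m) * exp (- ?m)"
    using m exp_ge_add_one_self[of "- ?m"] by (intro mult_left_mono) auto
  ultimately show ?thesis by (simp add: power2_eq_square algebra_simps)
qed

text \<open>A coincidence before time \<open>t\<close> puts two arrivals into one cell of every
  grid. There are \<open>n * t\<close> cells, each with probability at most
  \<open>(\<mu> / n)\<^sup>2\<close>, and the total tends to 0 as \<open>n\<close> grows.\<close>

lemma T_less_Suc: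
  assumes L: "1 \<le> L"
  shows "AE \<omega> in M. T L \<omega> < T (Suc L) \<omega>"
proof -
  define B where "B t = {\<omega> \<in> space M. T (Suc L) \<omega> \<le> T L \<omega> \<and> T L \<omega> \<le> real t}" for t :: nat
  have B [measurable]: "B t \<in> events" for t unfolding B_def by measurable
  have le: "prob (B t) \<le> \<mu>\<^sup>2 * real t / real n" if n: "0 < n" for n t
  proof -
    define C where "C k = {\<omega> \<in> space M. 2 \<le> N (real (Suc k) / n) \<omega> - N (real k / n) \<omega>}" for k
    have [measurable]: "N (real k / n) \<in> M \<rightarrow>\<^sub>M count_space UNIV" for k
      by (intro N_meas) simp
    have C [measurable]: "C k \<in> events" for k unfolding C_def by measurable
    have "AE \<omega> in M. \<omega> \<in> B t \<longrightarrow> \<omega> \<in> (\<Union>k<n * t. C k)"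
      using T_N T_pos
    proof eventually_elim
      case (elim \<omega>)
      show ?case
      proof
        assume \<omega>: "\<omega> \<in> B t"
        define D where "D = nat \<lceil>real n * T L \<omega>\<rceil>"
        have Tp: "0 < T L \<omega>" using elim L by simp
        have "\<not> D \<le> 0" using grid_index_le_iff[OF n, of "T L \<omega>" 0] Tp by (simp add: D_def)
        then obtain k where k: "D = Suc k" by (cases D) auto
        have k1: "real k / n < T L \<omega>" and k2: "T L \<omega> \<le> real (Suc k) / n"
          using k unfolding D_def grid_index_eq_Suc_iff[OF n] by auto
        have "T (Suc L) \<omega> \<le> real (Suc k) / n"
          using \<omega> k2 by (auto simp: B_def)
        \<comment> \<open>The cell of \<open>T L\<close> contains arrivals \<open>L\<close> and
          \<open>L + 1\<close>, so the count rises from below \<open>L\<close> to at least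
          \<open>L + 1\<close> across it.\<close>
        then have "Suc L \<le> N (real (Suc k) / n) \<omega>"
          using elim(1)[rule_format, of "Suc L" "real (Suc k) / n"] by simp
        moreover have "\<not> L \<le> N (real k / n) \<omega>"
          using k1 elim(1)[rule_format, of L "real k / n"] L by simp
        ultimately have "\<omega> \<in> C k" using \<omega> by (auto simp: C_def B_def)
        moreover have "k < n * t"
        proof -
          have "D \<le> n * t"
            unfolding D_def grid_index_le_iff[OF n] using \<omega> n by (simp add: B_def)
          then show ?thesis using k by simp
        qed
        ultimately show "\<omega> \<in> (\<Union>k<n * t. C k)" by auto
      qed
    qed
    then have "prob (B t) \<le> prob (\<Union>k<n * t. C k)"
      by (rule finite_measure_mono_AE) measurable
    also have "\<dots> \<le> (\<Sum>k<n * t. prob (C k))"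
      by (rule finite_measure_subadditive_finite) auto
    also have "\<dots> \<le> (\<Sum>k<n * t. (\<mu> / n)\<^sup>2)"
    proof (rule sum_mono)
      fix k
      have "prob (C k) \<le> (\<mu> * (real (Suc k) / n - real k / n))\<^sup>2"
        unfolding C_def by (rule prob_increment_ge_2) (auto simp: divide_right_mono)
      also have "real (Suc k) / n - real k / n = 1 / n" by (simp add: diff_divide_distrib[symmetric])
      finally show "prob (C k) \<le> (\<mu> / n)\<^sup>2" by simp
    qed
    also have "\<dots> = \<mu>\<^sup>2 * real t / real n"
      using n by (simp add: power2_eq_square)
    finally show ?thesis .
  qed
  have "prob (B t) = 0" for t
  proof -
    have "prob (B t) \<le> 0"
    proof (rule LIMSEQ_le_const)
      show "(\<lambda>n. \<mu>\<^sup>2 * real t / real n) \<longlonglongrightarrow> 0" by real_asymp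
      show "\<exists>K. \<forall>n\<ge>K. prob (B t) \<le> \<mu>\<^sup>2 * real t / real n"
        using le by (intro exI[of _ 1]) auto
    qed
    then show ?thesis by (simp add: measure_le_0_iff)
  qed
  then have "B t \<in> null_sets M" for t
    using B by (simp add: null_sets_def emeasure_eq_measure)
  then have "AE \<omega> in M. \<forall>t. \<omega> \<notin> B t"
    by (subst AE_all_countable) (auto intro: AE_not_in)
  with AE_space show ?thesis
  proof eventually_elim
    case (elim \<omega>)
    obtain t :: nat where t: "T L \<omega> \<le> real t" using real_arch_simple by blast
    have "\<omega> \<notin> B t" using elim by simp
    with elim(1) t show ?case by (auto simp: B_def)
  qed
qed

text \<open>The increment over a cell counts exactly the arrivals whose rounded time is the right
  end of that cell, so a power of \<open>c\<close> is a product over these arrivals.\<close>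

lemma grid_product_eq:
  fixes c :: "nat \<Rightarrow> real"
  assumes \<omega>: "\<omega> \<in> space M" and TN: "\<forall>j\<ge>1. \<forall>t\<ge>0. T j \<omega> \<le> t \<longleftrightarrow> j \<le> N t \<omega>"
    and n: "0 < n" and im: "i \<le> m"
  shows "(\<Prod>k=i..<m. c (Suc k) ^ (N (real (Suc k) / n) \<omega> - N (real k / n) \<omega>))
    = (\<Prod>j\<in>{N (real i / n) \<omega><..N (real m / n) \<omega>}. c (nat \<lceil>real n * T j \<omega>\<rceil>))"
  using im
proof (induction m rule: dec_induct)
  case base
  show ?case by simp
next
  case (step m)
  let ?N = "\<lambda>k. N (real k / n) \<omega>"
  have le: "?N i \<le> ?N m" "?N m \<le> ?N (Suc m)"
    using step.hyps n by (intro N_mono[OF \<omega>]; simp add: divide_right_mono)+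
  have "(\<Prod>j\<in>{?N m<..?N (Suc m)}. c (nat \<lceil>real n * T j \<omega>\<rceil>)) = (\<Prod>j\<in>{?N m<..?N (Suc m)}. c (Suc m))"
  proof (rule prod.cong)
    fix j assume j: "j \<in> {?N m<..?N (Suc m)}"
    then have "\<not> T j \<omega> \<le> real m / n" "T j \<omega> \<le> real (Suc m) / n"
      using TN by auto
    then have "nat \<lceil>real n * T j \<omega>\<rceil> = Suc m"
      unfolding grid_index_eq_Suc_iff[OF n] by simp
    then show "c (nat \<lceil>real n * T j \<omega>\<rceil>) = c (Suc m)" by simp
  qed simp
  moreover have "{?N i<..?N (Suc m)} = {?N i<..?N m} \<union> {?N m<..?N (Suc m)}"
    using le by auto
  ultimately show ?case
    using step by (simp add: prod.union_disjoint)
qed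

end

text \<open>The difference of truth values is 1 exactly at \<open>D = Suc i\<close>. For
  \<open>D = 0\<close> the jump would fall before the range of summation, hence
  \<open>0 < D\<close>.\<close>

lemma sum_jump:
  fixes q :: "nat \<Rightarrow> real"
  assumes "0 < D"
  shows "(\<Sum>i<m. (of_bool (D \<le> Suc i) - of_bool (D \<le> i)) * q (Suc i)) = of_bool (D \<le> m) * q D"
proof -
  have "(of_bool (D \<le> Suc i) - of_bool (D \<le> i)) * q (Suc i) = (if i = D - 1 then q D else 0)" for i
    using assms by (cases "Suc i = D") auto
  then have "(\<Sum>i<m. (of_bool (D \<le> Suc i) - of_bool (D \<le> i)) * q (Suc i)) = (\<Sum>i<m. if i = D - 1 then q D else 0)"
    by simp
  also have "\<dots> = of_bool (D \<le> m) * q D"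
    using assms by (simp add: sum.delta) linarith
  finally show ?thesis .
qed

section \<open>The expectation of the product over the arrivals after \<open>T L\<close>\<close>

context poisson_arrivals
begin

text \<open>Each summand selects the cell of \<open>T L\<close> and multiplies by increments
  strictly after that cell. Splitting \<open>A (Suc i) - A i\<close> leaves two events tested at
  fixed times, to both of which \<open>grid_product\<close> applies with the same later
  product.\<close>

lemma grid_renewal:
  fixes c :: "nat \<Rightarrow> real" and L n :: nat
  assumes n: "0 < n" and c: "\<And>i. 0 \<le> c i" "\<And>i. c i \<le> 1"
  defines "A \<equiv> \<lambda>i \<omega>. of_bool (L \<le> N (real i / n) \<omega>) :: real"
  shows "expectation (\<lambda>\<omega>. \<Sum>i<m. (A (Suc i) \<omega> - A i \<omega>) *
      (\<Prod>k=Suc i..<m. c (Suc k) ^ (N (real (Suc k) / n) \<omega> - N (real k / n) \<omega>)))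
    = expectation (\<lambda>\<omega>. \<Sum>i<m. (A (Suc i) \<omega> - A i \<omega>) * (\<Prod>k=Suc i..<m. exp (- (\<mu> / n) * (1 - c (Suc k)))))"
proof -
  have Nm [measurable]: "N (real i / n) \<in> M \<rightarrow>\<^sub>M count_space UNIV" for i
    by (intro N_meas) simp
  define Q where "Q i \<omega> = (\<Prod>k=i..<m. c (Suc k) ^ (N (real (Suc k) / n) \<omega> - N (real k / n) \<omega>))" for i \<omega>
  define R where "R i = (\<Prod>k=i..<m. exp (- (\<mu> / n) * (1 - c (Suc k))))" for i
  have Q01: "0 \<le> Q i \<omega>" "Q i \<omega> \<le> 1" for i \<omega>
    unfolding Q_def using c by (auto intro!: prod_nonneg prod_le_1 power_le_one)
  have intA: "integrable M (A i)" for i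
    unfolding A_def by (rule integrable_const_bound[where B=1]) auto
  have int: "integrable M (\<lambda>\<omega>. A j \<omega> * Q i \<omega>)" for i j
  proof (rule integrable_const_bound[where B=1])
    show "(\<lambda>\<omega>. A j \<omega> * Q i \<omega>) \<in> borel_measurable M"
      unfolding A_def Q_def by measurable
  qed (use Q01 in \<open>auto simp: A_def\<close>)
  have eq: "expectation (\<lambda>\<omega>. A j \<omega> * Q i \<omega>) = expectation (A j) * R i" if "j \<le> i" "i \<le> m" for i j
  proof -
    have "expectation (A j) = expectation (indicator {\<omega> \<in> space M. L \<le> N (real j / n) \<omega>})"
      by (intro Bochner_Integration.integral_cong) (auto simp: A_def indicator_def)
    also have "\<dots> = prob {\<omega> \<in> space M. L \<le> N (real j / n) \<omega>}"
      by (auto intro!: arg_cong[where f=prob])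
    finally show ?thesis
      using grid_product[OF n that c, of L] by (simp add: A_def Q_def R_def)
  qed
  have "expectation (\<lambda>\<omega>. \<Sum>i<m. (A (Suc i) \<omega> - A i \<omega>) * Q (Suc i) \<omega>)
    = (\<Sum>i<m. expectation (\<lambda>\<omega>. A (Suc i) \<omega> * Q (Suc i) \<omega>) - expectation (\<lambda>\<omega>. A i \<omega> * Q (Suc i) \<omega>))"
    unfolding left_diff_distrib by (simp add: int Bochner_Integration.integral_sum Bochner_Integration.integral_diff)
  also have "\<dots> = (\<Sum>i<m. (expectation (A (Suc i)) - expectation (A i)) * R (Suc i))"
    by (intro sum.cong) (auto simp: eq left_diff_distrib)
  also have "\<dots> = expectation (\<lambda>\<omega>. \<Sum>i<m. (A (Suc i) \<omega> - A i \<omega>) * R (Suc i))"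
    by (simp add: intA Bochner_Integration.integral_sum Bochner_Integration.integral_diff)
  finally show ?thesis by (simp only: Q_def R_def)
qed

text \<open>The sum evaluates \<open>q\<close> at the rounded \<open>T L\<close>. The quantifier
  over \<open>q\<close> stands inside \<open>AE\<close> because one of its uses has a
  \<open>q\<close> that depends on \<omega>.\<close>

lemma grid_renewal_AE:
  assumes n: "0 < n" and L: "1 \<le> L"
  shows "AE \<omega> in M. \<forall>q :: nat \<Rightarrow> real. (\<Sum>i<n * t. (of_bool (L \<le> N (real (Suc i) / n) \<omega>) - of_bool (L \<le> N (real i / n) \<omega>)) * q (Suc i))
    = of_bool (T L \<omega> \<le> real t) * q (nat \<lceil>real n * T L \<omega>\<rceil>)"
  using T_N T_pos
proof eventually_elim
  case (elim \<omega>)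
  define D where "D = nat \<lceil>real n * T L \<omega>\<rceil>"
  have D: "L \<le> N (real i / n) \<omega> \<longleftrightarrow> D \<le> i" for i
    unfolding D_def grid_index_le_iff[OF n] using elim(1)[rule_format, of L "real i / n"] L by simp
  have "0 < T L \<omega>" using elim L by simp
  then have "0 < D" using n by (simp add: D_def)
  moreover have "D \<le> n * t \<longleftrightarrow> T L \<omega> \<le> real t"
    unfolding D_def grid_index_le_iff[OF n] using n by simp
  ultimately show ?case
    unfolding D D_def[symmetric] by (simp add: sum_jump)
qed

text \<open>Up to a finite horizon \<open>t\<close>, \<open>W n\<close> and \<open>V n\<close> have
  equal expectations for every mesh, and they converge almost everywhere to the two integrands of
  the claim; both are bounded by 1.\<close>

lemma renewal_finite:
  fixes g :: "real \<Rightarrow> real"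
  assumes L: "1 \<le> L" and g: "continuous_on {0<..} g" "g \<in> borel_measurable borel" "\<And>x. 0 \<le> g x" "\<And>x. g x \<le> 1"
  shows "expectation (\<lambda>\<omega>. of_bool (T L \<omega> \<le> real t) * (\<Prod>j\<in>{L<..N (real t) \<omega>}. g (T j \<omega>)))
    = expectation (\<lambda>\<omega>. of_bool (T L \<omega> \<le> real t) *
        exp (- \<mu> * (LINT x|lborel. (if T L \<omega> < x \<and> x \<le> real t then 1 - g x else 0))))"
proof -
  have [measurable]: "g \<in> borel_measurable borel" by fact
  define A where "A n i \<omega> = (of_bool (L \<le> N (real i / n) \<omega>) :: real)" for n i :: nat and \<omega>
  define W where "W n \<omega> = (\<Sum>i<n * t. (A n (Suc i) \<omega> - A n i \<omega>) *
      (\<Prod>k=Suc i..<n * t. g (real (Suc k) / n) ^ (N (real (Suc k) / n) \<omega> - N (real k / n) \<omega>)))" for n :: nat and \<omega>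
  define V where "V n \<omega> = (\<Sum>i<n * t. (A n (Suc i) \<omega> - A n i \<omega>) *
      (\<Prod>k=Suc i..<n * t. exp (- (\<mu> / n) * (1 - g (real (Suc k) / n)))))" for n :: nat and \<omega>
  define I where "I s = (LINT x|lborel. (if s < x \<and> x \<le> real t then 1 - g x else 0))" for s
  have Nm [measurable]: "N (real i / n) \<in> M \<rightarrow>\<^sub>M count_space UNIV" for i n :: nat
    by (intro N_meas) simp
  have Nt [measurable]: "N (real t) \<in> M \<rightarrow>\<^sub>M count_space UNIV"
    by (intro N_meas) simp
  have EW: "expectation (W n) = expectation (V n)" if "0 < n" for n
    using grid_renewal[OF that, of "\<lambda>k. g (real k / n)" L "n * t"] g by (simp add: W_def[abs_def] V_def[abs_def] A_def)
  have W_eq: "AE \<omega> in M. \<forall>n>0. W n \<omega> = of_bool (T L \<omega> \<le> real t) *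
      (\<Prod>j\<in>{N (real (nat \<lceil>real n * T L \<omega>\<rceil>) / n) \<omega><..N (real t) \<omega>}. g (real (nat \<lceil>real n * T j \<omega>\<rceil>) / n))"
  proof (subst AE_all_countable, rule allI)
    fix n :: nat
    show "AE \<omega> in M. 0 < n \<longrightarrow> W n \<omega> = of_bool (T L \<omega> \<le> real t) *
      (\<Prod>j\<in>{N (real (nat \<lceil>real n * T L \<omega>\<rceil>) / n) \<omega><..N (real t) \<omega>}. g (real (nat \<lceil>real n * T j \<omega>\<rceil>) / n))"
    proof (cases "0 < n")
      case n: True
      show ?thesis
        using grid_renewal_AE[OF n L, of t] T_N AE_space
      proof eventually_elim
        case (elim \<omega>)
        define D where "D = nat \<lceil>real n * T L \<omega>\<rceil>"
        have "W n \<omega> = of_bool (T L \<omega> \<le> real t) *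
          (\<Prod>k=D..<n * t. g (real (Suc k) / n) ^ (N (real (Suc k) / n) \<omega> - N (real k / n) \<omega>))"
          unfolding W_def A_def D_def
          by (rule elim(1)[rule_format, of "\<lambda>i. \<Prod>k=i..<n * t. g (real (Suc k) / n) ^ (N (real (Suc k) / n) \<omega> - N (real k / n) \<omega>)"])
        also have "\<dots> = of_bool (T L \<omega> \<le> real t) *
          (\<Prod>j\<in>{N (real D / n) \<omega><..N (real t) \<omega>}. g (real (nat \<lceil>real n * T j \<omega>\<rceil>) / n))"
        proof (cases "T L \<omega> \<le> real t")
          case True
          then have "D \<le> n * t"
            unfolding D_def grid_index_le_iff[OF n] using n by simp
          from grid_product_eq[OF elim(3,2) n this, of "\<lambda>k. g (real k / n)"] show ?thesis
            using n by simp
        qed simp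
        finally show ?case by (simp add: D_def)
      qed
    qed simp
  qed
  have V_eq: "AE \<omega> in M. \<forall>n>0. V n \<omega> = of_bool (T L \<omega> \<le> real t) *
      exp (- \<mu> * (LINT x|lborel. (if real (nat \<lceil>real n * T L \<omega>\<rceil>) / n < x \<and> x \<le> real t
        then 1 - g (real (nat \<lceil>real n * x\<rceil>) / n) else 0)))"
  proof (subst AE_all_countable, rule allI)
    fix n :: nat
    show "AE \<omega> in M. 0 < n \<longrightarrow> V n \<omega> = of_bool (T L \<omega> \<le> real t) *
      exp (- \<mu> * (LINT x|lborel. (if real (nat \<lceil>real n * T L \<omega>\<rceil>) / n < x \<and> x \<le> real t
        then 1 - g (real (nat \<lceil>real n * x\<rceil>) / n) else 0)))"
    proof (cases "0 < n")
      case n: True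
      show ?thesis
        using grid_renewal_AE[OF n L, of t]
      proof eventually_elim
        case (elim \<omega>)
        define D where "D = nat \<lceil>real n * T L \<omega>\<rceil>"
        have "V n \<omega> = of_bool (T L \<omega> \<le> real t) *
          (\<Prod>k=D..<n * t. exp (- (\<mu> / n) * (1 - g (real (Suc k) / n))))"
          unfolding V_def A_def D_def
          by (rule elim[rule_format, of "\<lambda>i. \<Prod>k=i..<n * t. exp (- (\<mu> / n) * (1 - g (real (Suc k) / n)))"])
        also have "\<dots> = of_bool (T L \<omega> \<le> real t) *
          exp (- \<mu> * (LINT x|lborel. (if real D / n < x \<and> x \<le> real t then 1 - g (real (nat \<lceil>real n * x\<rceil>) / n) else 0)))"
        proof (cases "T L \<omega> \<le> real t")
          case True
          then have "D \<le> n * t"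
            unfolding D_def grid_index_le_iff[OF n] using n by simp
          from sum_grid_eq_integral[OF n this, of "\<lambda>x. 1 - g x", THEN conjunct2]
          have "(\<Sum>k=D..<n * t. (1 - g (real (Suc k) / n)) / n)
            = (LINT x|lborel. (if real D / n < x \<and> x \<le> real t then 1 - g (real (nat \<lceil>real n * x\<rceil>) / n) else 0))"
            using n by simp
          moreover have "(\<Prod>k=D..<n * t. exp (- (\<mu> / n) * (1 - g (real (Suc k) / n))))
            = exp (- \<mu> * (\<Sum>k=D..<n * t. (1 - g (real (Suc k) / n)) / n))"
            by (simp add: exp_sum[symmetric] sum_distrib_left sum_negf)
          ultimately show ?thesis by simp
        qed simp
        finally show ?case by (simp add: D_def)
      qed
    qed simp
  qed
  have g_lim: "(\<lambda>n. g (real (nat \<lceil>real n * x\<rceil>) / n)) \<longlonglongrightarrow> g x" if "0 < x" for x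
  proof -
    have "isCont g x"
      using g(1) that by (simp add: continuous_on_eq_continuous_at)
    from isCont_tendsto_compose[OF this grid_index_tendsto[of x]] that show ?thesis
      by simp
  qed
  \<comment> \<open>Once the mesh is fine enough, the rounded \<open>T L\<close> lies before
    \<open>T (Suc L)\<close>, so the count there is exactly \<open>L\<close> and the product starts
    at \<open>L + 1\<close>.\<close>
  have W_lim: "AE \<omega> in M. (\<lambda>n. W n \<omega>) \<longlonglongrightarrow> of_bool (T L \<omega> \<le> real t) * (\<Prod>j\<in>{L<..N (real t) \<omega>}. g (T j \<omega>))"
    using W_eq T_N T_pos T_less_Suc[OF L]
  proof eventually_elim
    case (elim \<omega>)
    have TL: "0 < T L \<omega>" using elim L by simp
    have "\<forall>\<^sub>F n in sequentially. real (nat \<lceil>real n * T L \<omega>\<rceil>) / real n < T (Suc L) \<omega>"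
      using order_tendstoD(2)[OF grid_index_tendsto elim(4)] TL by simp
    then have "\<forall>\<^sub>F n in sequentially. of_bool (T L \<omega> \<le> real t) *
      (\<Prod>j\<in>{L<..N (real t) \<omega>}. g (real (nat \<lceil>real n * T j \<omega>\<rceil>) / n)) = W n \<omega>"
      using eventually_gt_at_top[of 0]
    proof eventually_elim
      case (elim n)
      let ?x = "real (nat \<lceil>real n * T L \<omega>\<rceil>) / real n"
      have "\<not> Suc L \<le> N ?x \<omega>"
        using elim(1) \<open>\<forall>j\<ge>1. \<forall>t\<ge>0. _\<close>[rule_format, of "Suc L" ?x] by simp
      moreover have "L \<le> N ?x \<omega>"
        using grid_index_ge[OF elim(2), of "T L \<omega>"] \<open>\<forall>j\<ge>1. \<forall>t\<ge>0. _\<close>[rule_format, of L ?x] L by simp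
      ultimately have "N ?x \<omega> = L" by simp
      then show ?case
        using \<open>\<forall>n>0. W n \<omega> = _\<close> elim(2) by simp
    qed
    moreover have "(\<lambda>n. of_bool (T L \<omega> \<le> real t) *
      (\<Prod>j\<in>{L<..N (real t) \<omega>}. g (real (nat \<lceil>real n * T j \<omega>\<rceil>) / n)))
      \<longlonglongrightarrow> of_bool (T L \<omega> \<le> real t) * (\<Prod>j\<in>{L<..N (real t) \<omega>}. g (T j \<omega>))"
      using elim(3) by (intro tendsto_mult tendsto_const tendsto_prod g_lim) auto
    ultimately show ?case by (rule Lim_transform_eventually[rotated])
  qed
  have V_lim: "AE \<omega> in M. (\<lambda>n. V n \<omega>) \<longlonglongrightarrow> of_bool (T L \<omega> \<le> real t) * exp (- \<mu> * I (T L \<omega>))"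
    using V_eq T_pos
  proof eventually_elim
    case (elim \<omega>)
    have TL: "0 < T L \<omega>" using elim L by simp
    let ?h = "\<lambda>n x. if real (nat \<lceil>real n * T L \<omega>\<rceil>) / n < x \<and> x \<le> real t
        then 1 - g (real (nat \<lceil>real n * x\<rceil>) / n) else 0"
    have "(\<lambda>n. LINT x|lborel. ?h n x) \<longlonglongrightarrow> I (T L \<omega>)"
      unfolding I_def
    proof (rule integral_dominated_convergence[where w="indicator {0..real t}"])
      show "integrable lborel (indicator {0..real t} :: real \<Rightarrow> real)"
        by (intro integrable_real_indicator) auto
      show "AE x in lborel. (\<lambda>n. ?h n x) \<longlonglongrightarrow> (if T L \<omega> < x \<and> x \<le> real t then 1 - g x else 0)"
      proof (rule AE_I2)
        fix x :: real
        show "(\<lambda>n. ?h n x) \<longlonglongrightarrow> (if T L \<omega> < x \<and> x \<le> real t then 1 - g x else 0)"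
        proof (cases "T L \<omega> < x \<and> x \<le> real t")
          case True
          have "\<forall>\<^sub>F n in sequentially. real (nat \<lceil>real n * T L \<omega>\<rceil>) / real n < x"
            using order_tendstoD(2)[OF grid_index_tendsto, of "T L \<omega>" x] TL True by simp
          then have "\<forall>\<^sub>F n in sequentially. 1 - g (real (nat \<lceil>real n * x\<rceil>) / n) = ?h n x"
            by eventually_elim (use True in simp)
          moreover have "(\<lambda>n. 1 - g (real (nat \<lceil>real n * x\<rceil>) / n)) \<longlonglongrightarrow> 1 - g x"
            using TL True by (intro tendsto_diff tendsto_const g_lim) auto
          ultimately show ?thesis
            using True by (simp add: Lim_transform_eventually)
        next
          case False
          \<comment> \<open>Rounding up matters here: a point \<open>x \<le> T L \<omega>\<close>
            also lies at or below the rounded \<open>T L \<omega>\<close>.\<close>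
          have "\<forall>\<^sub>F n in sequentially. 0 = ?h n x"
            using eventually_gt_at_top[of 0]
          proof eventually_elim
            case (elim n)
            with grid_index_ge[OF elim, of "T L \<omega>"] False show ?case by auto
          qed
          then show ?thesis
            using False by (auto intro: Lim_transform_eventually[OF tendsto_const])
        qed
      qed
      show "AE x in lborel. norm (?h n x) \<le> indicator {0..real t} x" for n
      proof (rule AE_I2)
        fix x :: real
        define s where "s = real (nat \<lceil>real n * T L \<omega>\<rceil>) / real n"
        define y where "y = g (real (nat \<lceil>real n * x\<rceil>) / real n)"
        have "0 \<le> s" "0 \<le> y" "y \<le> 1" using g(3,4) by (simp_all add: s_def y_def)
        then show "norm (?h n x) \<le> indicator {0..real t} x"
          unfolding s_def[symmetric] y_def[symmetric] by (auto simp: indicator_def)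
      qed
    qed measurable
    then have "(\<lambda>n. of_bool (T L \<omega> \<le> real t) * exp (- \<mu> * (LINT x|lborel. ?h n x)))
        \<longlonglongrightarrow> of_bool (T L \<omega> \<le> real t) * exp (- \<mu> * I (T L \<omega>))"
      by (intro tendsto_intros)
    moreover have "\<forall>\<^sub>F n in sequentially. of_bool (T L \<omega> \<le> real t) * exp (- \<mu> * (LINT x|lborel. ?h n x)) = V n \<omega>"
      using eventually_gt_at_top[of 0] by eventually_elim (use elim in simp)
    ultimately show ?case by (rule Lim_transform_eventually)
  qed
  \<comment> \<open>The shift to \<open>Suc n\<close> avoids the degenerate grid
    \<open>n = 0\<close>, for which the two expectations have not been compared.\<close>
  have limW: "(\<lambda>n. expectation (W (Suc n))) \<longlonglongrightarrow> expectation (\<lambda>\<omega>. of_bool (T L \<omega> \<le> real t) * (\<Prod>j\<in>{L<..N (real t) \<omega>}. g (T j \<omega>)))"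
  proof (rule integral_dominated_convergence[where w="\<lambda>_. 1"])
    show "(\<lambda>\<omega>. of_bool (T L \<omega> \<le> real t) * (\<Prod>j\<in>{L<..N (real t) \<omega>}. g (T j \<omega>))) \<in> borel_measurable M"
    proof -
      have "(\<lambda>\<omega>. \<Prod>j\<in>{L<..k}. g (T j \<omega>)) \<in> borel_measurable M" for k by measurable
      then have [measurable]: "(\<lambda>\<omega>. \<Prod>j\<in>{L<..N (real t) \<omega>}. g (T j \<omega>)) \<in> borel_measurable M"
        by (rule measurable_compose_countable[OF _ Nt])
      show ?thesis by measurable
    qed
    show "W (Suc n) \<in> borel_measurable M" for n
      unfolding W_def[abs_def] A_def by measurable
    show "AE \<omega> in M. (\<lambda>n. W (Suc n) \<omega>) \<longlonglongrightarrow> of_bool (T L \<omega> \<le> real t) * (\<Prod>j\<in>{L<..N (real t) \<omega>}. g (T j \<omega>))"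
      using W_lim by eventually_elim (rule LIMSEQ_Suc)
    show "AE \<omega> in M. norm (W (Suc n) \<omega>) \<le> 1" for n
      using W_eq
    proof eventually_elim
      case (elim \<omega>)
      have "0 \<le> W (Suc n) \<omega>" "W (Suc n) \<omega> \<le> 1"
        using elim g by (auto intro!: prod_nonneg prod_le_1 simp del: of_nat_Suc)
      then show ?case by simp
    qed
  qed auto
  have limV: "(\<lambda>n. expectation (V (Suc n))) \<longlonglongrightarrow> expectation (\<lambda>\<omega>. of_bool (T L \<omega> \<le> real t) * exp (- \<mu> * I (T L \<omega>)))"
  proof (rule integral_dominated_convergence[where w="\<lambda>_. 1"])
    show "(\<lambda>\<omega>. of_bool (T L \<omega> \<le> real t) * exp (- \<mu> * I (T L \<omega>))) \<in> borel_measurable M"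
      unfolding I_def by measurable
    show "V (Suc n) \<in> borel_measurable M" for n
      unfolding V_def[abs_def] A_def by measurable
    show "AE \<omega> in M. (\<lambda>n. V (Suc n) \<omega>) \<longlonglongrightarrow> of_bool (T L \<omega> \<le> real t) * exp (- \<mu> * I (T L \<omega>))"
      using V_lim by eventually_elim (rule LIMSEQ_Suc)
    show "AE \<omega> in M. norm (V (Suc n) \<omega>) \<le> 1" for n
      using V_eq
    proof eventually_elim
      case (elim \<omega>)
      have "0 \<le> (LINT x|lborel. (if real (nat \<lceil>real (Suc n) * T L \<omega>\<rceil>) / real (Suc n) < x \<and> x \<le> real t
        then 1 - g (real (nat \<lceil>real (Suc n) * x\<rceil>) / real (Suc n)) else 0))"
        using g by (intro Bochner_Integration.integral_nonneg) auto
      then show ?case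
        using elim rate by (simp del: of_nat_Suc)
    qed
  qed auto
  show ?thesis
    using LIMSEQ_unique[OF limW] limV EW unfolding I_def by simp
qed

text \<open>The finite-horizon formula has a random number of factors, whereas here their number is
  fixed. Both versions have the same limit, since the products decrease in \<open>n\<close> and the
  count \<open>N t\<close> tends to infinity.\<close>

lemma renewal_limit:
  fixes g :: "real \<Rightarrow> real"
  assumes L: "1 \<le> L" and g: "continuous_on {0<..} g" "g \<in> borel_measurable borel" "\<And>x. 0 \<le> g x" "\<And>x. g x \<le> 1"
    and int: "integrable lborel (\<lambda>x. if 0 < x then 1 - g x else 0)"
  shows "(\<lambda>n. expectation (\<lambda>\<omega>. \<Prod>j\<in>{L<..L + n}. g (T j \<omega>)))
    \<longlonglongrightarrow> expectation (\<lambda>\<omega>. exp (- \<mu> * (LINT x|lborel. (if T L \<omega> < x then 1 - g x else 0))))"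
proof -
  have [measurable]: "g \<in> borel_measurable borel" by fact
  have Nt [measurable]: "N (real t) \<in> M \<rightarrow>\<^sub>M count_space UNIV" for t
    by (intro N_meas) simp
  define P where "P n \<omega> = (\<Prod>j\<in>{L<..L + n}. g (T j \<omega>))" for n \<omega>
  have P01: "0 \<le> P n \<omega>" "P n \<omega> \<le> 1" for n \<omega>
    unfolding P_def using g by (auto intro!: prod_nonneg prod_le_1)
  have Pm [measurable]: "P n \<in> borel_measurable M" for n
    unfolding P_def[abs_def] by measurable
  have "decseq (\<lambda>n. P n \<omega>)" for \<omega>
  proof (rule decseq_SucI)
    fix n
    have "{L<..L + Suc n} = insert (L + Suc n) {L<..L + n}" by auto
    then have "P (Suc n) \<omega> = g (T (L + Suc n) \<omega>) * P n \<omega>" by (simp add: P_def)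
    also have "\<dots> \<le> P n \<omega>" using g(3,4) P01 by (intro mult_left_le_one_le) auto
    finally show "P (Suc n) \<omega> \<le> P n \<omega>" .
  qed
  then have P_lim: "(\<lambda>n. P n \<omega>) \<longlonglongrightarrow> lim (\<lambda>n. P n \<omega>)" for \<omega>
    using decseq_convergent[of "\<lambda>n. P n \<omega>" 0] P01 by (metis convergentI convergent_LIMSEQ_iff)
  have lim_m [measurable]: "(\<lambda>\<omega>. lim (\<lambda>n. P n \<omega>)) \<in> borel_measurable M"
    by measurable
  have 1: "(\<lambda>n. expectation (P n)) \<longlonglongrightarrow> expectation (\<lambda>\<omega>. lim (\<lambda>n. P n \<omega>))"
    by (rule integral_dominated_convergence[where w="\<lambda>_. 1"]) (use P_lim P01 in auto)
  \<comment> \<open>The product up to horizon \<open>t\<close>, read as the sequence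
    \<open>P\<close> at the random index \<open>N t - L\<close>.\<close>
  define F where "F t \<omega> = of_bool (T L \<omega> \<le> real t) * P (N (real t) \<omega> - L) \<omega>" for t \<omega>
  have F_eq: "F t \<omega> = of_bool (T L \<omega> \<le> real t) * (\<Prod>j\<in>{L<..N (real t) \<omega>}. g (T j \<omega>))" for t \<omega>
  proof -
    have "{L<..L + (N (real t) \<omega> - L)} = {L<..N (real t) \<omega>}" by auto
    then show ?thesis by (simp add: F_def P_def)
  qed
  have 2: "(\<lambda>t. expectation (F t)) \<longlonglongrightarrow> expectation (\<lambda>\<omega>. lim (\<lambda>n. P n \<omega>))"
  proof (rule integral_dominated_convergence[where w="\<lambda>_. 1"])
    show "F t \<in> borel_measurable M" for t
    proof -
      have [measurable]: "(\<lambda>\<omega>. P (N (real t) \<omega> - L) \<omega>) \<in> borel_measurable M"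
        by (rule measurable_compose_countable[where f="\<lambda>k. P k" and g="\<lambda>\<omega>. N (real t) \<omega> - L"]) measurable
      show ?thesis unfolding F_def[abs_def] by measurable
    qed
    show "AE \<omega> in M. (\<lambda>t. F t \<omega>) \<longlonglongrightarrow> lim (\<lambda>n. P n \<omega>)"
      using T_N
    proof eventually_elim
      case (elim \<omega>)
      have ev: "\<forall>\<^sub>F t in sequentially. T j \<omega> \<le> real t" for j
        using filterlim_real_sequentially by (auto simp: filterlim_at_top)
      have "filterlim (\<lambda>t. N (real t) \<omega> - L) sequentially sequentially"
        unfolding filterlim_at_top
      proof
        fix Z
        show "\<forall>\<^sub>F t in sequentially. Z \<le> N (real t) \<omega> - L"
          using ev[of "Suc (Z + L)"]
        proof eventually_elim
          case (elim t)
          then show ?case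
            using \<open>\<forall>j\<ge>1. \<forall>t\<ge>0. _\<close>[rule_format, of "Suc (Z + L)" "real t"] by simp
        qed
      qed
      then have "(\<lambda>t. P (N (real t) \<omega> - L) \<omega>) \<longlonglongrightarrow> lim (\<lambda>n. P n \<omega>)"
        by (rule filterlim_compose[OF P_lim])
      moreover have "\<forall>\<^sub>F t in sequentially. P (N (real t) \<omega> - L) \<omega> = F t \<omega>"
        using ev[of L] by eventually_elim (simp add: F_def)
      ultimately show ?case by (rule Lim_transform_eventually)
    qed
    show "AE \<omega> in M. norm (F t \<omega>) \<le> 1" for t
      using P01 by (auto simp: F_def)
  qed auto
  define I where "I s = (LINT x|lborel. (if s < x then 1 - g x else 0))" for s
  define J where "J t s = (LINT x|lborel. (if s < x \<and> x \<le> real t then 1 - g x else 0))" for t s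
  have EF: "expectation (F t) = expectation (\<lambda>\<omega>. of_bool (T L \<omega> \<le> real t) * exp (- \<mu> * J t (T L \<omega>)))" for t
    unfolding F_eq J_def by (rule renewal_finite[OF L g])
  have 3: "(\<lambda>t. expectation (\<lambda>\<omega>. of_bool (T L \<omega> \<le> real t) * exp (- \<mu> * J t (T L \<omega>))))
      \<longlonglongrightarrow> expectation (\<lambda>\<omega>. exp (- \<mu> * I (T L \<omega>)))"
  proof (rule integral_dominated_convergence[where w="\<lambda>_. 1"])
    show "(\<lambda>\<omega>. exp (- \<mu> * I (T L \<omega>))) \<in> borel_measurable M"
      unfolding I_def by measurable
    show "(\<lambda>\<omega>. of_bool (T L \<omega> \<le> real t) * exp (- \<mu> * J t (T L \<omega>))) \<in> borel_measurable M" for t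
      unfolding J_def by measurable
    show "AE \<omega> in M. norm (of_bool (T L \<omega> \<le> real t) * exp (- \<mu> * J t (T L \<omega>))) \<le> 1" for t
    proof (rule AE_I2)
      fix \<omega>
      have "0 \<le> J t (T L \<omega>)"
        unfolding J_def using g by (intro Bochner_Integration.integral_nonneg) auto
      then show "norm (of_bool (T L \<omega> \<le> real t) * exp (- \<mu> * J t (T L \<omega>))) \<le> 1"
        using rate by simp
    qed
    show "AE \<omega> in M. (\<lambda>t. of_bool (T L \<omega> \<le> real t) * exp (- \<mu> * J t (T L \<omega>))) \<longlonglongrightarrow> exp (- \<mu> * I (T L \<omega>))"
      using T_pos
    proof eventually_elim
      case (elim \<omega>)
      have TL: "0 < T L \<omega>" using elim L by simp
      have ev: "\<forall>\<^sub>F t in sequentially. x \<le> real t" for x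
        using filterlim_real_sequentially by (auto simp: filterlim_at_top)
      \<comment> \<open>The horizon is removed by dominated convergence, with the integrand over all
        positive \<open>x\<close> as the bound.\<close>
      have "(\<lambda>t. J t (T L \<omega>)) \<longlonglongrightarrow> I (T L \<omega>)"
        unfolding J_def I_def
      proof (rule integral_dominated_convergence[OF _ _ int])
        show "AE x in lborel. (\<lambda>t. if T L \<omega> < x \<and> x \<le> real t then 1 - g x else 0)
            \<longlonglongrightarrow> (if T L \<omega> < x then 1 - g x else 0)"
        proof (rule AE_I2)
          fix x :: real
          have "\<forall>\<^sub>F t in sequentially. (if T L \<omega> < x then 1 - g x else 0)
              = (if T L \<omega> < x \<and> x \<le> real t then 1 - g x else 0)"
            using ev[of x] by eventually_elim simp
          then show "(\<lambda>t. if T L \<omega> < x \<and> x \<le> real t then 1 - g x else 0)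
            \<longlonglongrightarrow> (if T L \<omega> < x then 1 - g x else 0)"
            by (rule Lim_transform_eventually[OF tendsto_const])
        qed
        show "AE x in lborel. norm (if T L \<omega> < x \<and> x \<le> real t then 1 - g x else 0) \<le> (if 0 < x then 1 - g x else 0)" for t
          using TL g(4) by (auto simp: abs_of_nonneg)
      qed measurable
      then have "(\<lambda>t. exp (- \<mu> * J t (T L \<omega>))) \<longlonglongrightarrow> exp (- \<mu> * I (T L \<omega>))"
        by (intro tendsto_intros)
      moreover have "\<forall>\<^sub>F t in sequentially. exp (- \<mu> * J t (T L \<omega>)) = of_bool (T L \<omega> \<le> real t) * exp (- \<mu> * J t (T L \<omega>))"
        using ev[of "T L \<omega>"] by eventually_elim simp
      ultimately show ?case by (rule Lim_transform_eventually)
    qed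
  qed auto
  have "expectation (\<lambda>\<omega>. lim (\<lambda>n. P n \<omega>)) = expectation (\<lambda>\<omega>. exp (- \<mu> * I (T L \<omega>)))"
    using LIMSEQ_unique[OF 2] 3 unfolding EF by simp
  with 1 show ?thesis by (simp add: P_def[abs_def] I_def)
qed

text \<open>The complement is a partial sum of Poisson weights, which is the Erlang tail. The first
  argument of \<open>erlang_CDF\<close> is the shape minus one, hence \<open>L - 1\<close>.\<close>

lemma prob_count_ge:
  assumes L: "1 \<le> L" and t: "0 \<le> t"
  shows "prob {\<omega> \<in> space M. L \<le> N t \<omega>} = erlang_CDF (L - 1) \<mu> t"
proof -
  have [measurable]: "N t \<in> M \<rightarrow>\<^sub>M count_space UNIV" using t by (rule N_meas)
  have "{\<omega> \<in> space M. L \<le> N t \<omega>} = space M - (\<Union>k\<le>L - 1. {\<omega> \<in> space M. N t \<omega> = k})"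
    using L by auto
  also have "prob \<dots> = 1 - prob (\<Union>k\<le>L - 1. {\<omega> \<in> space M. N t \<omega> = k})"
    by (rule prob_compl) measurable
  also have "prob (\<Union>k\<le>L - 1. {\<omega> \<in> space M. N t \<omega> = k}) = (\<Sum>k\<le>L - 1. prob {\<omega> \<in> space M. N t \<omega> = k})"
    by (rule finite_measure_finite_Union) (auto simp: disjoint_family_on_def)
  finally show ?thesis
    using t by (simp add: erlang_CDF_def N_prob[OF t] mult.commute)
qed

text \<open>The distribution function at \<open>a\<close> is the Erlang one at the square of
  \<open>a\<close>; the substitution \<open>x = r\<^sup>2\<close> contributes the Jacobian
  \<open>2 * r\<close>. With \<open>Gamma (real L)\<close> as the factorial of \<open>L - 1\<close>,
  this is the weight that occurs in \<open>laplace_interference\<close>.\<close>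

lemma distributed_sqrt_arrival:
  assumes L: "1 \<le> L"
  shows "distributed M lborel (\<lambda>\<omega>. sqrt (T L \<omega>))
    (\<lambda>r. if 0 < r then 2 * (\<mu> * r\<^sup>2) ^ L / (r * Gamma (real L)) * exp (- \<mu> * r\<^sup>2) else 0)"
proof -
  define f where "f r = (if 0 < r then 2 * (\<mu> * r\<^sup>2) ^ L / (r * Gamma (real L)) * exp (- \<mu> * r\<^sup>2) else 0)" for r :: real
  obtain k where k: "L = Suc k" using L by (cases L) auto
  have G: "Gamma (1 + real k) = fact k" using Gamma_fact[of k, where 'a=real] by simp
  have dens: "f r = erlang_density (L - 1) \<mu> (r\<^sup>2) * (2 * r)" if "0 \<le> r" for r
    using that by (simp add: f_def erlang_density_def G k power_mult_distrib power2_eq_square field_simps)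
  have "distributed M lborel (\<lambda>\<omega>. sqrt (T L \<omega>)) (\<lambda>r. ennreal (f r))"
  proof (rule distributedI_borel_atMost[where g="\<lambda>a. if a < 0 then 0 else erlang_CDF (L - 1) \<mu> (a\<^sup>2)"])
    show "(\<lambda>\<omega>. sqrt (T L \<omega>)) \<in> borel_measurable M" by measurable
    show "f \<in> borel_measurable borel" unfolding f_def[abs_def] by measurable
    show "AE r in lborel. 0 \<le> f r"
      using rate L unfolding f_def by (intro AE_I2) (auto intro!: mult_nonneg_nonneg divide_nonneg_nonneg Gamma_real_nonneg)
    fix a :: real
    have cdf: "(\<integral>\<^sup>+r. ennreal (f r) * indicator {..a} r \<partial>lborel) = ennreal (if a < 0 then 0 else erlang_CDF (L - 1) \<mu> (a\<^sup>2))"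
    proof (cases "a < 0")
      case True
      then have "(\<lambda>r. ennreal (f r) * indicator {..a} r) = (\<lambda>_. 0)"
        by (auto simp: indicator_def f_def fun_eq_iff)
      then show ?thesis using True by (simp only: nn_integral_0_iff_AE) simp
    next
      case False
      then have a: "0 \<le> a" by simp
      have "(\<integral>\<^sup>+r. ennreal (f r) * indicator {..a} r \<partial>lborel)
        = (\<integral>\<^sup>+r. ennreal (erlang_density (L - 1) \<mu> (r\<^sup>2) * (2 * r)) * indicator {0..a} r \<partial>lborel)"
      proof (rule nn_integral_cong)
        fix r :: real
        show "ennreal (f r) * indicator {..a} r = ennreal (erlang_density (L - 1) \<mu> (r\<^sup>2) * (2 * r)) * indicator {0..a} r"
        proof (cases "0 \<le> r")
          case True
          then show ?thesis by (simp add: dens indicator_def)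
        qed (simp add: f_def)
      qed
      also have "\<dots> = (\<integral>\<^sup>+x. ennreal (erlang_density (L - 1) \<mu> x) * indicator {0\<^sup>2..a\<^sup>2} x \<partial>lborel)"
      proof -
        have "(\<integral>\<^sup>+x. ennreal (erlang_density (L - 1) \<mu> x * indicator {0\<^sup>2..a\<^sup>2} x) \<partial>lborel)
          = (\<integral>\<^sup>+r. ennreal (erlang_density (L - 1) \<mu> (r\<^sup>2) * (2 * r) * indicator {0..a} r) \<partial>lborel)"
          by (rule nn_integral_substitution[where g="\<lambda>r. r\<^sup>2" and g'="\<lambda>r. 2 * r"])
            (auto intro!: derivative_eq_intros continuous_intros a simp: set_borel_measurable_def)
        moreover have "ennreal (c * indicator S x) = ennreal c * indicator S x" for c x :: real and S
          by (simp add: indicator_def)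
        ultimately show ?thesis by (simp only:)
      qed
      also have "\<dots> = (\<integral>\<^sup>+x. ennreal (erlang_density (L - 1) \<mu> x) * indicator {..a\<^sup>2} x \<partial>lborel)"
        by (intro nn_integral_cong) (simp add: erlang_density_def indicator_def)
      also have "\<dots> = erlang_CDF (L - 1) \<mu> (a\<^sup>2)"
        using rate by (rule nn_integral_erlang_density)
      finally show ?thesis using a by simp
    qed
    have "ennreal (f r) * indicator {..a} r = ennreal (f r * indicator {..a} r)" for r
      by (simp add: indicator_def)
    with cdf show "(\<integral>\<^sup>+r. ennreal (f r * indicator {..a} r) \<partial>lborel) = ennreal (if a < 0 then 0 else erlang_CDF (L - 1) \<mu> (a\<^sup>2))"
      by simp
    show "emeasure M {\<omega> \<in> space M. sqrt (T L \<omega>) \<le> a} = ennreal (if a < 0 then 0 else erlang_CDF (L - 1) \<mu> (a\<^sup>2))"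
    proof (cases "a < 0")
      case True
      have "AE \<omega> in M. \<not> sqrt (T L \<omega>) \<le> a"
        using T_pos
      proof eventually_elim
        case (elim \<omega>)
        then have "0 < sqrt (T L \<omega>)" using L by simp
        with True show ?case by linarith
      qed
      then have "emeasure M {\<omega> \<in> space M. sqrt (T L \<omega>) \<le> a} = 0"
        by (subst (asm) AE_iff_measurable[OF _ refl]) auto
      then show ?thesis using True by simp
    next
      case False
      have [measurable]: "N (a\<^sup>2) \<in> M \<rightarrow>\<^sub>M count_space UNIV" by (rule N_meas) simp
      have "emeasure M {\<omega> \<in> space M. sqrt (T L \<omega>) \<le> a} = emeasure M {\<omega> \<in> space M. L \<le> N (a\<^sup>2) \<omega>}"
      proof (rule emeasure_eq_AE)
        show "AE \<omega> in M. \<omega> \<in> {\<omega> \<in> space M. sqrt (T L \<omega>) \<le> a} \<longleftrightarrow> \<omega> \<in> {\<omega> \<in> space M. L \<le> N (a\<^sup>2) \<omega>}"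
          using T_N
        proof eventually_elim
          case (elim \<omega>)
          have "sqrt (T L \<omega>) \<le> a \<longleftrightarrow> T L \<omega> \<le> a\<^sup>2"
            using False real_sqrt_le_iff[of "T L \<omega>" "a\<^sup>2"] by simp
          then show ?case using elim[rule_format, OF L, of "a\<^sup>2"] by simp
        qed
      qed measurable
      then show ?thesis
        using False by (simp add: emeasure_eq_measure prob_count_ge[OF L])
    qed
  qed
  then show ?thesis by (simp only: f_def)
qed

end

section \<open>Distances in a Poisson point process\<close>

lemma locally_finite_setsD: "S \<in> locally_finite_sets \<Longrightarrow> bounded B \<Longrightarrow> finite (S \<inter> B)"
  by (simp add: locally_finite_sets_def)

text \<open>The infimum is attained: by local finiteness no point lies at a distance slightly above
  \<open>r\<close>, so a count reached at radii arbitrarily close to \<open>r\<close> is reached at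
  \<open>r\<close>. The radius \<open>r0\<close> guarantees that the infimum is over a nonempty
  set.\<close>

lemma nth_dist_le_iff:
  fixes p :: "'a::euclidean_space"
  assumes S: "S \<in> locally_finite_sets" and ex: "0 \<le> r0" "j \<le> card (S \<inter> cball p r0)" and r: "0 \<le> r"
  shows "nth_dist p S j \<le> r \<longleftrightarrow> j \<le> card (S \<inter> cball p r)"
proof
  define A where "A = {r. 0 \<le> r \<and> j \<le> card (S \<inter> cball p r)}"
  have bdd: "bdd_below A" by (auto simp: A_def intro!: bdd_belowI[of _ 0])
  have ne: "A \<noteq> {}" using ex by (auto simp: A_def)
  {
    assume "j \<le> card (S \<inter> cball p r)"
    then have "Inf A \<le> r" using r bdd by (intro cInf_lower) (auto simp: A_def)
    then show "nth_dist p S j \<le> r" by (simp add: nth_dist_def A_def)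
  next
    assume "nth_dist p S j \<le> r"
    then have le: "Inf A \<le> r" by (simp add: nth_dist_def A_def)
    show "j \<le> card (S \<inter> cball p r)"
    proof (rule ccontr)
      assume neg: "\<not> j \<le> card (S \<inter> cball p r)"
      define D where "D = dist p ` (S \<inter> cball p (r + 1) - cball p r)"
      have fin: "finite D" using locally_finite_setsD[OF S bounded_cball] by (simp add: D_def)
      \<comment> \<open>A radius beyond \<open>r\<close> but short of every point in the shell up to
        \<open>r + 1\<close>.\<close>
      obtain s where s: "r < s" "s \<le> r + 1" "\<And>d. d \<in> D \<Longrightarrow> s < d"
      proof (cases "D = {}")
        case True
        then show ?thesis using that[of "r + 1"] by simp
      next
        case False
        have "r < Min D" using fin False by (auto simp: D_def)
        moreover have "Min D \<le> r + 1" using Min_in[OF fin False] by (auto simp: D_def)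
        ultimately show ?thesis
          using Min_le[OF fin] by (intro that[of "(r + Min D) / 2"]) (force simp: field_simps)+
      qed
      have "Inf A < s" using le s by simp
      then obtain r' where r': "r' \<in> A" "r' < s" using cInf_lessD[OF ne] by auto
      have "S \<inter> cball p r' \<subseteq> S \<inter> cball p r"
      proof
        fix x assume x: "x \<in> S \<inter> cball p r'"
        show "x \<in> S \<inter> cball p r"
        proof (rule ccontr)
          assume "x \<notin> S \<inter> cball p r"
          with x r' s have "dist p x \<in> D" by (auto simp: D_def)
          from s(3)[OF this] x r' show False by simp
        qed
      qed
      then have "card (S \<inter> cball p r') \<le> card (S \<inter> cball p r)"
        by (intro card_mono locally_finite_setsD[OF S]) auto
      with r' neg show False by (simp add: A_def)
    qed
  }
qed

lemma nth_dist_nonneg: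
  assumes "0 \<le> r0" "j \<le> card (S \<inter> cball p r0)"
  shows "0 \<le> nth_dist p S j"
  unfolding nth_dist_def using assms by (intro cInf_greatest) auto

lemma measurable_card_config:
  fixes B :: "'a::euclidean_space set"
  assumes \<Phi>: "\<Phi> \<in> M \<rightarrow>\<^sub>M config_algebra" and B: "B \<in> sets borel" "bounded B"
  shows "(\<lambda>\<omega>. card (\<Phi> \<omega> \<inter> B)) \<in> M \<rightarrow>\<^sub>M count_space UNIV"
proof (rule measurable_compose[OF \<Phi>])
  let ?G = "{{S \<in> locally_finite_sets. card (S \<inter> B) = k} | B k. B \<in> sets borel \<and> bounded B} :: 'a set set set"
  have sub: "?G \<subseteq> Pow locally_finite_sets" by auto
  have "{S \<in> locally_finite_sets. card (S \<inter> B) = k} \<in> sets config_algebra" for k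
    unfolding config_algebra_def sets_measure_of[OF sub] using B by (intro sigma_sets.Basic) blast
  moreover have "space config_algebra = (locally_finite_sets :: 'a set set)"
    unfolding config_algebra_def by (rule space_measure_of[OF sub])
  moreover have "(\<lambda>S. card (S \<inter> B)) -` {k} \<inter> locally_finite_sets = {S \<in> locally_finite_sets. card (S \<inter> B) = k}" for k
    by auto
  ultimately show "(\<lambda>S. card (S \<inter> B)) \<in> config_algebra \<rightarrow>\<^sub>M count_space UNIV"
    by (subst measurable_count_space_eq_countable) auto
qed

lemma space_config_algebra: "space config_algebra = locally_finite_sets"
  unfolding config_algebra_def by (rule space_measure_of) auto

text \<open>Where there are fewer than \<open>j\<close> points in all, the value is the constant
  \<open>Inf {}\<close>. The sublevel sets are split along that event, and integer radii make it a
  countable combination of count events.\<close>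

lemma measurable_nth_dist:
  fixes p :: "'a::euclidean_space"
  assumes \<Phi>: "\<Phi> \<in> M \<rightarrow>\<^sub>M config_algebra"
  shows "(\<lambda>\<omega>. nth_dist p (\<Phi> \<omega>) j) \<in> borel_measurable M"
proof (subst borel_measurable_iff_le, rule allI)
  fix a :: real
  have [measurable]: "(\<lambda>\<omega>. card (\<Phi> \<omega> \<inter> cball p r)) \<in> M \<rightarrow>\<^sub>M count_space UNIV" for r
    by (rule measurable_card_config[OF \<Phi>]) auto
  have lf: "\<Phi> \<omega> \<in> locally_finite_sets" if "\<omega> \<in> space M" for \<omega>
    using measurable_space[OF \<Phi> that] by (simp add: space_config_algebra)
  have ex_iff: "(\<exists>r\<ge>0. j \<le> card (\<Phi> \<omega> \<inter> cball p r)) \<longleftrightarrow> (\<exists>k::nat. j \<le> card (\<Phi> \<omega> \<inter> cball p (real k)))"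
    if "\<omega> \<in> space M" for \<omega>
  proof
    assume "\<exists>r\<ge>0. j \<le> card (\<Phi> \<omega> \<inter> cball p r)"
    then obtain r where r: "j \<le> card (\<Phi> \<omega> \<inter> cball p r)" by blast
    obtain k :: nat where "r \<le> real k" using real_arch_simple by blast
    then have "card (\<Phi> \<omega> \<inter> cball p r) \<le> card (\<Phi> \<omega> \<inter> cball p (real k))"
      by (intro card_mono locally_finite_setsD[OF lf[OF that]]) auto
    with r show "\<exists>k::nat. j \<le> card (\<Phi> \<omega> \<inter> cball p (real k))" by (intro exI[of _ k]) simp
  qed (auto intro: exI[of _ "real _"])
  have "nth_dist p (\<Phi> \<omega>) j \<le> a \<longleftrightarrow>
      (if \<exists>k::nat. j \<le> card (\<Phi> \<omega> \<inter> cball p (real k)) then 0 \<le> a \<and> j \<le> card (\<Phi> \<omega> \<inter> cball p a) else Inf {} \<le> a)"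
    if \<omega>: "\<omega> \<in> space M" for \<omega>
  proof (cases "\<exists>k::nat. j \<le> card (\<Phi> \<omega> \<inter> cball p (real k))")
    case True
    then obtain k :: nat where k: "j \<le> card (\<Phi> \<omega> \<inter> cball p (real k))" by blast
    have "0 \<le> nth_dist p (\<Phi> \<omega>) j" using k by (intro nth_dist_nonneg[of "real k"]) auto
    then show ?thesis
      using True nth_dist_le_iff[OF lf[OF \<omega>] _ k, of a] by (cases "0 \<le> a") auto
  next
    case False
    then have "{r. 0 \<le> r \<and> j \<le> card (\<Phi> \<omega> \<inter> cball p r)} = {}" using ex_iff[OF \<omega>] by blast
    then have "nth_dist p (\<Phi> \<omega>) j = Inf {}" by (simp only: nth_dist_def)
    then show ?thesis by (simp only: False if_False)
  qed
  then have "{\<omega> \<in> space M. nth_dist p (\<Phi> \<omega>) j \<le> a} = {\<omega> \<in> space M.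
      (if \<exists>k::nat. j \<le> card (\<Phi> \<omega> \<inter> cball p (real k)) then 0 \<le> a \<and> j \<le> card (\<Phi> \<omega> \<inter> cball p a) else Inf {} \<le> a)}"
    by (simp only: cong: conj_cong)
  also have "\<dots> \<in> sets M" by measurable
  finally show "{\<omega> \<in> space M. nth_dist p (\<Phi> \<omega>) j \<le> a} \<in> sets M" .
qed

lemma (in prob_space) indep_vars_cong_space:
  assumes eq: "\<And>i \<omega>. i \<in> I \<Longrightarrow> \<omega> \<in> space M \<Longrightarrow> X i \<omega> = Y i \<omega>" and X: "indep_vars M' X I"
  shows "indep_vars M' Y I"
proof -
  have "random_variable (M' i) (Y i)" if "i \<in> I" for i
  proof -
    have "random_variable (M' i) (X i)" using X that by (simp add: indep_vars_def2)
    then show ?thesis by (subst measurable_cong[of M "Y i" "X i"]) (simp_all add: eq that)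
  qed
  moreover have "X i -` A \<inter> space M = Y i -` A \<inter> space M" if "i \<in> I" for i A
    using eq[OF that] by auto
  then have "indep_sets (\<lambda>i. {Y i -` A \<inter> space M | A. A \<in> sets (M' i)}) I"
    using X by (simp add: indep_vars_def2 cong: indep_sets_cong)
  ultimately show ?thesis
    unfolding indep_vars_def2 by blast
qed

text \<open>Indexing discs by the squared radius makes the area linear, so that the counts form a
  process of constant rate.\<close>

lemma measure_disc:
  fixes p :: "real ^ 2"
  assumes "0 \<le> t"
  shows "measure lborel (cball p (sqrt t)) = pi * t"
  using assms by (simp add: content_cball unit_ball_vol_2)

text \<open>For each \<open>i < j\<close> the Poisson weight of \<open>i\<close> is a power times a
  decaying exponential of the area and tends to 0, so the probability of fewer than \<open>j\<close>
  points in every disc is 0. This makes \<open>nth_dist\<close> meaningful almost surely.\<close>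

lemma ppp_unbounded:
  fixes \<Phi> :: "'w \<Rightarrow> (real ^ 2) set" and p :: "real ^ 2"
  assumes M: "prob_space M" and ppp: "homogeneous_ppp M lam \<Phi>" and lam: "0 < lam"
  shows "AE \<omega> in M. \<forall>j. \<exists>k::nat. j \<le> card (\<Phi> \<omega> \<inter> cball p (sqrt (real k)))"
proof -
  interpret prob_space M by (rule M)
  let ?N = "\<lambda>t \<omega>. card (\<Phi> \<omega> \<inter> cball p (sqrt t))"
  have \<Phi>: "\<Phi> \<in> M \<rightarrow>\<^sub>M config_algebra"
    and pr: "\<And>B k. B \<in> sets borel \<Longrightarrow> bounded B \<Longrightarrow> prob {\<omega> \<in> space M. card (\<Phi> \<omega> \<inter> B) = k} =
          (lam * measure lborel B) ^ k / fact k * exp (- (lam * measure lborel B))"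
    using ppp unfolding homogeneous_ppp_def by auto
  have Nm: "?N t \<in> M \<rightarrow>\<^sub>M count_space UNIV" for t
    by (rule measurable_card_config[OF \<Phi>]) auto
  have Npr: "prob {\<omega> \<in> space M. ?N t \<omega> = k} = (lam * pi * t) ^ k / fact k * exp (- (lam * pi * t))" if "0 \<le> t" for t k
    using pr[of "cball p (sqrt t)" k] that by (simp add: measure_disc mult.assoc)
  show ?thesis
  proof (subst AE_all_countable, rule allI)
    fix j
    have [measurable]: "?N t \<in> M \<rightarrow>\<^sub>M count_space UNIV" for t by (rule Nm)
    let ?E = "{\<omega> \<in> space M. \<forall>k::nat. ?N (real k) \<omega> < j}"
    have "prob ?E \<le> 0"
    proof (rule LIMSEQ_le_const)
      have "(\<lambda>k. \<Sum>i<j. (lam * pi * real k) ^ i / exp (lam * pi * real k) / fact i) \<longlonglongrightarrow> (\<Sum>i<j. 0 / fact i)"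
      proof (intro tendsto_sum tendsto_divide tendsto_const)
        fix i
        have "filterlim (\<lambda>k. lam * pi * real k) at_top sequentially"
          using lam by (intro filterlim_tendsto_pos_mult_at_top[OF tendsto_const] filterlim_real_sequentially) simp
        then show "(\<lambda>k. (lam * pi * real k) ^ i / exp (lam * pi * real k)) \<longlonglongrightarrow> 0"
          by (rule filterlim_compose[OF tendsto_power_div_exp_0])
      qed auto
      then show "(\<lambda>k. \<Sum>i<j. (lam * pi * real k) ^ i / exp (lam * pi * real k) / fact i) \<longlonglongrightarrow> 0" by simp
      have "prob ?E \<le> (\<Sum>i<j. (lam * pi * real k) ^ i / exp (lam * pi * real k) / fact i)" for k
      proof -
        have "prob ?E \<le> prob (\<Union>i<j. {\<omega> \<in> space M. ?N (real k) \<omega> = i})"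
          by (rule finite_measure_mono) auto
        also have "\<dots> \<le> (\<Sum>i<j. prob {\<omega> \<in> space M. ?N (real k) \<omega> = i})"
          by (rule finite_measure_subadditive_finite) auto
        also have "\<dots> = (\<Sum>i<j. (lam * pi * real k) ^ i / exp (lam * pi * real k) / fact i)"
          by (intro sum.cong refl, subst Npr) (auto simp: exp_minus field_simps)
        finally show ?thesis .
      qed
      then show "\<exists>K. \<forall>k\<ge>K. prob ?E \<le> (\<Sum>i<j. (lam * pi * real k) ^ i / exp (lam * pi * real k) / fact i)"
        by blast
    qed
    then have "prob ?E = 0" by (simp add: measure_le_0_iff)
    then have "?E \<in> null_sets M" by (simp add: null_sets_def emeasure_eq_measure)
    then have "AE \<omega> in M. \<omega> \<notin> ?E" by (rule AE_not_in)
    with AE_space show "AE \<omega> in M. \<exists>k::nat. j \<le> ?N (real k) \<omega>"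
      by eventually_elim (auto simp: not_less)
  qed
qed

lemma AE_nth_dist_nonneg:
  fixes \<Phi> :: "'w \<Rightarrow> (real ^ 2) set" and p :: "real ^ 2"
  assumes "prob_space M" "homogeneous_ppp M lam \<Phi>" "0 < lam"
  shows "AE \<omega> in M. \<forall>j. 0 \<le> nth_dist p (\<Phi> \<omega>) j"
  using ppp_unbounded[OF assms, of p]
proof eventually_elim
  case (elim \<omega>)
  show ?case
  proof
    fix j
    obtain k :: nat where "j \<le> card (\<Phi> \<omega> \<inter> cball p (sqrt (real k)))" using elim by blast
    then show "0 \<le> nth_dist p (\<Phi> \<omega>) j" by (rule nth_dist_nonneg[rotated]) simp
  qed
qed

text \<open>Increments of the count are counts in annuli, whose area is proportional to the
  difference of squared radii.\<close>

lemma poisson_arrivals_ppp: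
  fixes \<Phi> :: "'w \<Rightarrow> (real ^ 2) set" and p :: "real ^ 2"
  assumes M: "prob_space M" and ppp: "homogeneous_ppp M lam \<Phi>" and lam: "0 < lam"
  shows "poisson_arrivals M (lam * pi) (\<lambda>t \<omega>. card (\<Phi> \<omega> \<inter> cball p (sqrt t))) (\<lambda>j \<omega>. (nth_dist p (\<Phi> \<omega>) j)\<^sup>2)"
proof -
  interpret prob_space M by (rule M)
  let ?N = "\<lambda>t \<omega>. card (\<Phi> \<omega> \<inter> cball p (sqrt t))"
  have \<Phi>: "\<Phi> \<in> M \<rightarrow>\<^sub>M config_algebra"
    and pr: "\<And>B k. B \<in> sets borel \<Longrightarrow> bounded B \<Longrightarrow> prob {\<omega> \<in> space M. card (\<Phi> \<omega> \<inter> B) = k} =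
          (lam * measure lborel B) ^ k / fact k * exp (- (lam * measure lborel B))"
    and ind: "\<And>B :: nat \<Rightarrow> (real ^ 2) set. (\<And>i. B i \<in> sets borel) \<Longrightarrow> (\<And>i. bounded (B i)) \<Longrightarrow> disjoint_family B \<Longrightarrow>
        indep_vars (\<lambda>_. count_space UNIV) (\<lambda>i \<omega>. card (\<Phi> \<omega> \<inter> B i)) UNIV"
    using ppp unfolding homogeneous_ppp_def by auto
  have lf: "\<Phi> \<omega> \<in> locally_finite_sets" if "\<omega> \<in> space M" for \<omega>
    using measurable_space[OF \<Phi> that] by (simp add: space_config_algebra)
  have fin: "finite (\<Phi> \<omega> \<inter> cball p r)" if "\<omega> \<in> space M" for \<omega> r
    using locally_finite_setsD[OF lf[OF that] bounded_cball] .
  have Nm: "?N t \<in> M \<rightarrow>\<^sub>M count_space UNIV" for t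
    by (rule measurable_card_config[OF \<Phi>]) auto
  have Npr: "prob {\<omega> \<in> space M. ?N t \<omega> = k} = (lam * pi * t) ^ k / fact k * exp (- (lam * pi * t))" if "0 \<le> t" for t k
    using pr[of "cball p (sqrt t)" k] that by (simp add: measure_disc mult.assoc)
  have sub: "cball p (sqrt s) \<subseteq> cball p (sqrt t)" if "s \<le> t" for s t
    using that by (intro subset_cball) simp
  have inc: "?N t \<omega> - ?N s \<omega> = card (\<Phi> \<omega> \<inter> (cball p (sqrt t) - cball p (sqrt s)))"
    if "\<omega> \<in> space M" "s \<le> t" for \<omega> s t
  proof -
    have "\<Phi> \<omega> \<inter> (cball p (sqrt t) - cball p (sqrt s)) = \<Phi> \<omega> \<inter> cball p (sqrt t) - \<Phi> \<omega> \<inter> cball p (sqrt s)"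
      by auto
    then show ?thesis
      using sub[OF that(2)] by (simp only:) (intro card_Diff_subset[symmetric] fin[OF that(1)] Int_mono order_refl)
  qed
  have ann: "measure lborel (cball p (sqrt t) - cball p (sqrt s)) = pi * (t - s)" if "0 \<le> s" "s \<le> t" for s t
  proof -
    have "measure lborel (cball p (sqrt t) - cball p (sqrt s)) = measure lborel (cball p (sqrt t)) - measure lborel (cball p (sqrt s))"
      using sub[OF that(2)] by (intro measure_Diff) (use emeasure_lborel_cball_finite[of p "sqrt t"] in auto)
    then show ?thesis using that by (simp add: measure_disc right_diff_distrib)
  qed
  have unb: "AE \<omega> in M. \<forall>j. \<exists>k::nat. j \<le> ?N (real k) \<omega>"
    by (rule ppp_unbounded[OF M ppp lam])
  show ?thesis
  proof
    show "0 < lam * pi" using lam by simp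
    show "?N t \<in> M \<rightarrow>\<^sub>M count_space UNIV" for t by (rule Nm)
    show "(\<lambda>\<omega>. (nth_dist p (\<Phi> \<omega>) j)\<^sup>2) \<in> borel_measurable M" for j
      using measurable_nth_dist[OF \<Phi>, of p j] by measurable
    show "?N s \<omega> \<le> ?N t \<omega>" if "\<omega> \<in> space M" "0 \<le> s" "s \<le> t" for s t \<omega>
      using sub[OF that(3)] by (intro card_mono fin[OF that(1)]) auto
    show "AE \<omega> in M. \<forall>j\<ge>1. \<forall>t\<ge>0. (nth_dist p (\<Phi> \<omega>) j)\<^sup>2 \<le> t \<longleftrightarrow> j \<le> ?N t \<omega>"
      using unb AE_space
    proof eventually_elim
      case (elim \<omega>)
      show ?case
      proof (intro allI impI)
        fix j :: nat and t :: real assume "0 \<le> t"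
        obtain k :: nat where k: "j \<le> card (\<Phi> \<omega> \<inter> cball p (sqrt (real k)))" using elim by blast
        have nn: "0 \<le> nth_dist p (\<Phi> \<omega>) j" by (rule nth_dist_nonneg[OF _ k]) simp
        have "(nth_dist p (\<Phi> \<omega>) j)\<^sup>2 \<le> t \<longleftrightarrow> nth_dist p (\<Phi> \<omega>) j \<le> sqrt t"
          using nn sqrt_ge_absD[of "nth_dist p (\<Phi> \<omega>) j" t] real_le_rsqrt[of "nth_dist p (\<Phi> \<omega>) j" t] by auto
        also have "\<dots> \<longleftrightarrow> j \<le> ?N t \<omega>"
          by (rule nth_dist_le_iff[OF lf[OF elim(2)] _ k]) (simp_all add: \<open>0 \<le> t\<close>)
        finally show "(nth_dist p (\<Phi> \<omega>) j)\<^sup>2 \<le> t \<longleftrightarrow> j \<le> ?N t \<omega>" .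
      qed
    qed
    show "prob {\<omega> \<in> space M. ?N t \<omega> = k} = (lam * pi * t) ^ k / fact k * exp (- (lam * pi * t))" if "0 \<le> t" for t k
      by (rule Npr[OF that])
    show "prob {\<omega> \<in> space M. ?N t \<omega> - ?N s \<omega> = k} = (lam * pi * (t - s)) ^ k / fact k * exp (- (lam * pi * (t - s)))"
      if "0 \<le> s" "s \<le> t" for s t k
    proof -
      have "{\<omega> \<in> space M. ?N t \<omega> - ?N s \<omega> = k} = {\<omega> \<in> space M. card (\<Phi> \<omega> \<inter> (cball p (sqrt t) - cball p (sqrt s))) = k}"
        using inc that by auto
      also have "prob \<dots> = (lam * pi * (t - s)) ^ k / fact k * exp (- (lam * pi * (t - s)))"
        by (subst pr) (auto simp: ann[OF that] mult.assoc intro: bounded_subset[OF bounded_cball])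
      finally show ?thesis .
    qed
    fix u :: "nat \<Rightarrow> real" assume u: "mono u" "0 \<le> u 0"
    \<comment> \<open>A disc followed by successive annuli: disjoint sets whose counts are the
      required increments.\<close>
    define B where "B i = (case i of 0 \<Rightarrow> cball p (sqrt (u 0)) | Suc k \<Rightarrow> cball p (sqrt (u (Suc k))) - cball p (sqrt (u k)))" for i
    have Bsub: "B i \<subseteq> cball p (sqrt (u i))" for i by (cases i) (auto simp: B_def)
    have "indep_vars (\<lambda>_. count_space UNIV) (\<lambda>i \<omega>. card (\<Phi> \<omega> \<inter> B i)) UNIV"
    proof (rule ind)
      show "B i \<in> sets borel" for i by (cases i) (auto simp: B_def)
      show "bounded (B i)" for i by (rule bounded_subset[OF bounded_cball Bsub])
      have "B i \<inter> B j = {}" if ij: "i < j" for i j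
      proof -
        obtain k where k: "j = Suc k" "i \<le> k" using ij by (cases j) auto
        have "B i \<subseteq> cball p (sqrt (u k))"
          using Bsub[of i] sub[OF monoD[OF u(1) k(2)]] by blast
        then show ?thesis by (auto simp: B_def k)
      qed
      then show "disjoint_family B"
        unfolding disjoint_family_on_def by (metis Int_commute nat_neq_iff)
    qed
    then show "indep_vars (\<lambda>_. count_space UNIV) (\<lambda>i \<omega>. case i of 0 \<Rightarrow> ?N (u 0) \<omega> | Suc k \<Rightarrow> ?N (u (Suc k)) \<omega> - ?N (u k) \<omega>) UNIV"
      by (rule indep_vars_cong_space[rotated]) (auto simp: B_def inc monoD[OF u(1)] split: nat.split)
  qed
qed

section \<open>The receiver\<close>

lemma mat_adjoint_index:
  assumes "A \<in> carrier_mat n m" "i < m" "j < n"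
  shows "mat_adjoint A $$ (i, j) = conjugate (A $$ (j, i))"
  using assms unfolding mat_adjoint_def by (simp add: mat_of_rows_index)

lemma mat_adjoint_carrier: "A \<in> carrier_mat n m \<Longrightarrow> mat_adjoint A \<in> carrier_mat m n"
  unfolding mat_adjoint_def by auto

text \<open>Triangularity reduces the first column of \<open>Q * R\<close> to one term, and the
  first column of \<open>Q\<close> has norm 1. Multiplying the gain by the squared modulus of
  \<open>R $$ (0, 0)\<close> removes the phase and avoids a division, so the identity also covers
  \<open>h 0 = 0\<close>, where that column is undetermined.\<close>

lemma QR_first_coordinate:
  fixes h :: "nat \<Rightarrow> complex vec"
  assumes h: "\<And>j. h j \<in> carrier_vec n" and n: "0 < n"
    and QR: "is_QR (channel_matrix n L h) Q R"
  shows "(cmod (R $$ (0, 0)))\<^sup>2 = (\<Sum>i<n. (cmod (h 0 $ i))\<^sup>2)"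
    and "v \<in> carrier_vec n \<Longrightarrow>
      (cmod (R $$ (0, 0)))\<^sup>2 * effective_gain Q v = (cmod (\<Sum>i<n. cnj (h 0 $ i) * v $ i))\<^sup>2"
proof -
  let ?A = "channel_matrix n L h"
  let ?r = "R $$ (0, 0)"
  have A: "?A \<in> carrier_mat n (Suc L)" unfolding channel_matrix_def by auto
  have Q: "Q \<in> carrier_mat n n" and U: "mat_adjoint Q * Q = 1\<^sub>m n" and R: "R \<in> carrier_mat n (Suc L)"
    and tri: "\<And>i j. i < n \<Longrightarrow> j < Suc L \<Longrightarrow> j < i \<Longrightarrow> R $$ (i, j) = 0" and AQR: "?A = Q * R"
    using QR A unfolding is_QR_def unitary_mat_def by auto
  have col: "h 0 $ i = Q $$ (i, 0) * ?r" if "i < n" for i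
  proof -
    have "map h [0..<Suc L] ! 0 = h 0" by (simp del: upt_Suc)
    then have "h 0 $ i = ?A $$ (i, 0)"
      using that unfolding channel_matrix_def by (subst mat_of_cols_index) (auto simp del: upt_Suc)
    also have "\<dots> = (\<Sum>k\<in>{0..<n}. Q $$ (i, k) * R $$ (k, 0))"
      using that Q R unfolding AQR by (simp add: scalar_prod_def)
    also have "\<dots> = (\<Sum>k\<in>{0}. Q $$ (i, k) * R $$ (k, 0))"
      using n tri by (intro sum.mono_neutral_right) auto
    finally show ?thesis by simp
  qed
  have "(mat_adjoint Q * Q) $$ (0, 0) = (\<Sum>i\<in>{0..<n}. mat_adjoint Q $$ (0, i) * Q $$ (i, 0))"
    using n Q mat_adjoint_carrier[OF Q] by (simp add: scalar_prod_def)
  also have "\<dots> = (\<Sum>i<n. of_real ((cmod (Q $$ (i, 0)))\<^sup>2))"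
    unfolding lessThan_atLeast0 complex_norm_square using n Q
    by (intro sum.cong) (auto simp: mat_adjoint_index[OF Q])
  finally have "(of_real (\<Sum>i<n. (cmod (Q $$ (i, 0)))\<^sup>2) :: complex) = 1"
    using n unfolding U by simp
  then have Q1: "(\<Sum>i<n. (cmod (Q $$ (i, 0)))\<^sup>2) = 1"
    by (rule of_real_eq_1_iff[THEN iffD1])
  have "(\<Sum>i<n. (cmod (h 0 $ i))\<^sup>2) = (\<Sum>i<n. (cmod (Q $$ (i, 0)))\<^sup>2) * (cmod ?r)\<^sup>2"
    unfolding sum_distrib_right by (intro sum.cong) (auto simp: col norm_mult power_mult_distrib)
  then show "(cmod ?r)\<^sup>2 = (\<Sum>i<n. (cmod (h 0 $ i))\<^sup>2)" by (simp add: Q1)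
  assume v: "v \<in> carrier_vec n"
  have "(mat_adjoint Q *\<^sub>v v) $ 0 = (\<Sum>i\<in>{0..<n}. mat_adjoint Q $$ (0, i) * v $ i)"
    using n v mat_adjoint_carrier[OF Q] by (simp add: scalar_prod_def)
  also have "\<dots> = (\<Sum>i<n. cnj (Q $$ (i, 0)) * v $ i)"
    unfolding lessThan_atLeast0 using n Q by (intro sum.cong) (auto simp: mat_adjoint_index[OF Q])
  finally have g: "(mat_adjoint Q *\<^sub>v v) $ 0 = (\<Sum>i<n. cnj (Q $$ (i, 0)) * v $ i)" .
  have "(\<Sum>i<n. cnj (h 0 $ i) * v $ i) = cnj ?r * (mat_adjoint Q *\<^sub>v v) $ 0"
    unfolding g sum_distrib_left by (intro sum.cong) (auto simp: col mult_ac)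
  then show "(cmod ?r)\<^sup>2 * effective_gain Q v = (cmod (\<Sum>i<n. cnj (h 0 $ i) * v $ i))\<^sup>2"
    by (simp add: effective_gain_def norm_mult power_mult_distrib)
qed

text \<open>\<open>indep_vars\<close> needs a common value type, hence scalars are encoded as constant sequences.\<close>

definition source_var ::
  "nat \<Rightarrow> ('w \<Rightarrow> real) \<Rightarrow> (nat \<Rightarrow> 'w \<Rightarrow> real) \<Rightarrow> (nat \<Rightarrow> nat \<Rightarrow> 'w \<Rightarrow> complex) \<Rightarrow> source \<Rightarrow> 'w \<Rightarrow> nat \<Rightarrow> complex" where
  "source_var n d0 D h s \<omega> = (case s of
       Direct_Distance \<Rightarrow> (\<lambda>_. of_real (d0 \<omega>))
     | Interferers \<Rightarrow> (\<lambda>j. of_real (D j \<omega>))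
     | Fading k i \<Rightarrow> (\<lambda>_. if i < n then h k i \<omega> else 0))"

locale sic_link = poisson_arrivals M \<mu> N "\<lambda>j \<omega>. (D j \<omega>)\<^sup>2"
  for M :: "'w measure" and \<mu> N and D :: "nat \<Rightarrow> 'w \<Rightarrow> real" +
  fixes \<alpha> c :: real and d0 :: "'w \<Rightarrow> real" and h :: "nat \<Rightarrow> nat \<Rightarrow> 'w \<Rightarrow> complex" and n L :: nat
  assumes \<alpha>: "2 < \<alpha>" and c: "0 < c" and L: "1 \<le> L"
    and d0_meas [measurable]: "d0 \<in> borel_measurable M"
    and D_meas [measurable]: "\<And>j. D j \<in> borel_measurable M"
    and D_nonneg: "AE \<omega> in M. \<forall>j. 0 \<le> D j \<omega>"
    and fading: "\<And>k i. i < n \<Longrightarrow> distributed M lborel (h k i) (\<lambda>z. ennreal (cn01_density z))"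
    and indep: "indep_vars (\<lambda>_. PiM UNIV (\<lambda>_. borel)) (source_var n d0 D h)
      ({Direct_Distance, Interferers} \<union> {Fading k i | k i. i < n})"
begin

definition H :: "'w \<Rightarrow> real" where
  "H \<omega> = (\<Sum>i<n. (cmod (h 0 i \<omega>))\<^sup>2)"

text \<open>The effective gain written through the fading alone, hence measurable whatever choice of
  \<open>Q\<close> is made. Division by zero makes it \<open>0\<close> when the direct channel
  vanishes.\<close>

definition G :: "nat \<Rightarrow> 'w \<Rightarrow> real" where
  "G k \<omega> = (cmod (\<Sum>i<n. cnj (h 0 i \<omega>) * h k i \<omega>))\<^sup>2 / H \<omega>"

definition X :: "'w \<Rightarrow> real" where
  "X \<omega> = H \<omega> * d0 \<omega> powr (- \<alpha>)"

definition Y :: "'w \<Rightarrow> real" where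
  "Y \<omega> = (\<Sum>k. G (L + 1 + k) \<omega> * D (L + 1 + k) \<omega> powr (- \<alpha>))"

lemma h_meas [measurable]: "i < n \<Longrightarrow> h k i \<in> borel_measurable M"
  using distributed_measurable[OF fading] by simp

lemma H_meas [measurable]: "H \<in> borel_measurable M"
  unfolding H_def by measurable

lemma G_meas [measurable]: "G k \<in> borel_measurable M"
proof -
  have [measurable]: "cnj \<in> borel_measurable borel"
    by (intro borel_measurable_continuous_onI continuous_intros)
  show ?thesis unfolding G_def[abs_def] by measurable
qed

lemma X_meas [measurable]: "X \<in> borel_measurable M"
  unfolding X_def[abs_def] by measurable

lemma Y_meas [measurable]: "Y \<in> borel_measurable M"
  unfolding Y_def[abs_def] by measurable

lemma H_nonneg: "0 \<le> H \<omega>"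
  unfolding H_def by (intro sum_nonneg) auto

lemma G_nonneg: "0 \<le> G k \<omega>"
  unfolding G_def using H_nonneg by simp

lemma X_nonneg: "0 \<le> X \<omega>"
  unfolding X_def using H_nonneg by simp

lemma source_var_meas: "source_var n d0 D h s \<in> M \<rightarrow>\<^sub>M PiM UNIV (\<lambda>_. borel)"
proof (rule measurable_PiM_single')
  fix j
  show "(\<lambda>\<omega>. source_var n d0 D h s \<omega> j) \<in> borel_measurable M"
  proof (cases s)
    case (Fading k i)
    then show ?thesis by (cases "i < n") (auto simp: source_var_def)
  qed (auto simp: source_var_def)
qed auto

text \<open>With \<open>m\<close> interferers only the finite set \<open>J\<close> of sources
  occurs, and independence makes their joint law a product measure, to which the Gaussian
  computation applies; \<open>Re\<close> undoes the encoding of reals in \<open>source_var\<close>.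
  The parameters \<open>z1\<close> and \<open>z2\<close> differ when \<open>z2\<close> is sent to 0
  for fixed \<open>z1\<close>.\<close>

lemma nn_integral_gain_interference:
  assumes z: "0 \<le> z1" "0 \<le> z2"
  shows "(\<integral>\<^sup>+\<omega>. ennreal (1 - exp (- z1 * X \<omega>)) *
      (\<Prod>k\<in>{L<..L + m}. ennreal (exp (- z2 * (G k \<omega> * D k \<omega> powr (- \<alpha>))))) \<partial>M)
    = (\<integral>\<^sup>+\<omega>. ennreal (1 - 1 / (1 + z1 * d0 \<omega> powr (- \<alpha>)) ^ n) \<partial>M)
      * (\<integral>\<^sup>+\<omega>. (\<Prod>k\<in>{L<..L + m}. ennreal (1 / (1 + z2 * D k \<omega> powr (- \<alpha>)))) \<partial>M)"
proof -
  let ?V = "PiM UNIV (\<lambda>_. borel) :: (nat \<Rightarrow> complex) measure"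
  let ?X = "source_var n d0 D h"
  let ?K = "{L<..L + m}"
  define J where "J = insert Direct_Distance (insert Interferers (Fading 0 ` {..<n})) \<union> (\<Union>k\<in>?K. Fading k ` {..<n})"
  define N' where "N' s = distr M ?V (?X s)" for s
  have N': "prob_space (N' s)" for s
    unfolding N'_def by (rule prob_space_distr[OF source_var_meas])
  have comp [measurable]: "(\<lambda>v. v j) \<in> borel_measurable ?V" for j
    by (rule measurable_component_singleton) simp
  have setsN' [measurable_cong]: "sets (N' s) = sets ?V" for s by (simp add: N'_def)
  have dist: "distributed (N' (Fading k i)) lborel (\<lambda>v. v 0) (\<lambda>z. ennreal (cn01_density z))" if "i < n" for k i
  proof -
    have "distr (N' (Fading k i)) lborel (\<lambda>v. v 0) = distr M lborel (\<lambda>\<omega>. ?X (Fading k i) \<omega> 0)"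
      unfolding N'_def by (subst distr_distr[OF _ source_var_meas]) (auto simp: comp_def)
    also have "\<dots> = distr M lborel (h k i)"
      using that by (simp add: source_var_def)
    also have "\<dots> = density lborel (\<lambda>z. ennreal (cn01_density z))"
      using fading[OF that] by (rule distributed_distr_eq_density)
    finally show ?thesis
      unfolding distributed_def by (simp add: measurable_cong_sets[OF setsN' refl])
  qed
  let ?Hf = "\<lambda>x. \<Sum>i<n. (cmod (x (Fading 0 i) 0))\<^sup>2"
  let ?F = "\<lambda>x :: source \<Rightarrow> nat \<Rightarrow> complex. ennreal (1 - exp (- ?Hf x * (z1 * Re (x Direct_Distance 0) powr (- \<alpha>)))) *
        (\<Prod>k\<in>?K. ennreal (exp (- (z2 * Re (x Interferers k) powr (- \<alpha>)) *
          ((cmod (\<Sum>i<n. cnj (x (Fading 0 i) 0) * x (Fading k i) 0))\<^sup>2 / ?Hf x))))"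
  have J: "J \<subseteq> {Direct_Distance, Interferers} \<union> {Fading k i | k i. i < n}" "J \<noteq> {}" "finite J"
    by (auto simp: J_def)
  have distrJ: "distr M (PiM J (\<lambda>_. ?V)) (\<lambda>\<omega>. \<lambda>s\<in>J. ?X s \<omega>) = PiM J N'"
    using indep_vars_subset[OF indep J(1)] source_var_meas
    unfolding N'_def by (subst (asm) indep_vars_iff_distr_eq_PiM'[OF J(2)]) auto
  have comp2: "(\<lambda>x. x s j) \<in> borel_measurable (PiM J (\<lambda>_. ?V))" if "s \<in> J" for s j
    by (rule measurable_compose[OF measurable_component_singleton[OF that] comp])
  have mF: "?F \<in> borel_measurable (PiM J (\<lambda>_. ?V))"
  proof -
    have [measurable]: "cnj \<in> borel_measurable borel"
      by (intro borel_measurable_continuous_onI continuous_intros)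
    have [measurable]: "(\<lambda>x. x (Fading 0 i) 0) \<in> borel_measurable (PiM J (\<lambda>_. ?V))" if "i < n" for i
      using that by (intro comp2) (auto simp: J_def)
    have [measurable]: "(\<lambda>x. x (Fading k i) 0) \<in> borel_measurable (PiM J (\<lambda>_. ?V))" if "i < n" "k \<in> ?K" for i k
      using that by (intro comp2) (auto simp: J_def)
    have [measurable]: "(\<lambda>x. x Direct_Distance j) \<in> borel_measurable (PiM J (\<lambda>_. ?V))"
      "(\<lambda>x. x Interferers j) \<in> borel_measurable (PiM J (\<lambda>_. ?V))" for j
      by (auto intro!: comp2 simp: J_def)
    have [measurable]: "(\<lambda>x. \<Sum>i<n. cnj (x (Fading 0 i) 0) * x (Fading k i) 0) \<in> borel_measurable (PiM J (\<lambda>_. ?V))"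
      if "k \<in> ?K" for k
      using that by measurable
    show ?thesis by measurable
  qed
  have mX: "(\<lambda>\<omega>. \<lambda>s\<in>J. ?X s \<omega>) \<in> M \<rightarrow>\<^sub>M PiM J (\<lambda>_. ?V)"
    by (intro measurable_restrict source_var_meas)
  have "(\<integral>\<^sup>+\<omega>. ennreal (1 - exp (- z1 * X \<omega>)) *
      (\<Prod>k\<in>?K. ennreal (exp (- z2 * (G k \<omega> * D k \<omega> powr (- \<alpha>))))) \<partial>M)
    = (\<integral>\<^sup>+\<omega>. ?F (\<lambda>s\<in>J. ?X s \<omega>) \<partial>M)"
  proof (rule nn_integral_cong)
    fix \<omega>
    let ?x = "\<lambda>s\<in>J. ?X s \<omega>"
    have x: "?x (Fading 0 i) 0 = h 0 i \<omega>" "k \<in> ?K \<Longrightarrow> ?x (Fading k i) 0 = h k i \<omega>" if "i < n" for i k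
      using that by (auto simp: J_def source_var_def)
    have xd: "?x Direct_Distance 0 = of_real (d0 \<omega>)" "?x Interferers j = of_real (D j \<omega>)" for j
      by (auto simp: J_def source_var_def)
    have Hf: "?Hf ?x = H \<omega>" unfolding H_def by (intro sum.cong) (simp_all only: x lessThan_iff)
    have "(\<Sum>i<n. cnj (?x (Fading 0 i) 0) * ?x (Fading k i) 0) = (\<Sum>i<n. cnj (h 0 i \<omega>) * h k i \<omega>)" if "k \<in> ?K" for k
      using that by (intro sum.cong) (simp_all only: x lessThan_iff)
    then have "(\<Prod>k\<in>?K. ennreal (exp (- (z2 * Re (?x Interferers k) powr (- \<alpha>)) *
          ((cmod (\<Sum>i<n. cnj (?x (Fading 0 i) 0) * ?x (Fading k i) 0))\<^sup>2 / ?Hf ?x))))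
      = (\<Prod>k\<in>?K. ennreal (exp (- z2 * (G k \<omega> * D k \<omega> powr (- \<alpha>)))))"
      unfolding Hf xd by (intro prod.cong refl) (simp add: G_def mult_ac)
    moreover have "1 - exp (- ?Hf ?x * (z1 * Re (?x Direct_Distance 0) powr (- \<alpha>))) = 1 - exp (- z1 * X \<omega>)"
      unfolding Hf xd by (simp add: X_def mult_ac)
    ultimately show "ennreal (1 - exp (- z1 * X \<omega>)) *
      (\<Prod>k\<in>?K. ennreal (exp (- z2 * (G k \<omega> * D k \<omega> powr (- \<alpha>))))) = ?F ?x"
      by (simp only:)
  qed
  also have "\<dots> = (\<integral>\<^sup>+x. ?F x \<partial>PiM J N')"
    unfolding distrJ[symmetric] by (rule nn_integral_distr[symmetric, OF mX]) (subst measurable_distr_eq1, rule mF)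
  also have "\<dots> = (\<integral>\<^sup>+v. ennreal (1 - 1 / (1 + z1 * Re (v 0) powr (- \<alpha>)) ^ n) \<partial>N' Direct_Distance)
      * (\<integral>\<^sup>+v. (\<Prod>k\<in>?K. ennreal (1 / (1 + z2 * Re (v k) powr (- \<alpha>)))) \<partial>N' Interferers)"
    unfolding J_def
    by (rule nn_integral_PiM_sources[where N=N' and n=n and e="\<lambda>v. v 0" and g="\<lambda>v. z1 * Re (v 0) powr (- \<alpha>)"
          and c="\<lambda>k v. z2 * Re (v k) powr (- \<alpha>)", OF N' _ _ dist])
      (use z in \<open>auto simp: measurable_cong_sets[OF setsN' refl]\<close>)
  also have "(\<integral>\<^sup>+v. ennreal (1 - 1 / (1 + z1 * Re (v 0) powr (- \<alpha>)) ^ n) \<partial>N' Direct_Distance)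
      = (\<integral>\<^sup>+\<omega>. ennreal (1 - 1 / (1 + z1 * d0 \<omega> powr (- \<alpha>)) ^ n) \<partial>M)"
    unfolding N'_def by (subst nn_integral_distr[OF source_var_meas]) (auto simp: source_var_def)
  also have "(\<integral>\<^sup>+v. (\<Prod>k\<in>?K. ennreal (1 / (1 + z2 * Re (v k) powr (- \<alpha>)))) \<partial>N' Interferers)
      = (\<integral>\<^sup>+\<omega>. (\<Prod>k\<in>?K. ennreal (1 / (1 + z2 * D k \<omega> powr (- \<alpha>)))) \<partial>M)"
    unfolding N'_def by (subst nn_integral_distr[OF source_var_meas]) (auto simp: source_var_def)
  finally show ?thesis .
qed

end

section \<open>Elementary limits and bounds for infinitely many interferers\<close>

lemma prod_exp_partial_sum:
  fixes f :: "nat \<Rightarrow> real"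
  shows "(\<Prod>k\<in>{L<..L + m}. exp (- z * f k)) = exp (- z * (\<Sum>k<m. f (L + 1 + k)))"
proof (induction m)
  case (Suc m)
  have "{L<..L + Suc m} = insert (L + 1 + m) {L<..L + m}" by auto
  then have "(\<Prod>k\<in>{L<..L + Suc m}. exp (- z * f k)) = exp (- z * f (L + 1 + m)) * (\<Prod>k\<in>{L<..L + m}. exp (- z * f k))"
    by simp
  also have "\<dots> = exp (- z * (\<Sum>k<Suc m. f (L + 1 + k)))"
    unfolding Suc by (simp add: exp_add[symmetric] algebra_simps)
  finally show ?case .
qed simp

text \<open>Nonnegative terms force a divergent series to infinity, so the exponential has limit 0
  and not the value at the unspecified \<open>suminf\<close>.\<close>

lemma exp_partial_sums_tendsto:
  fixes f :: "nat \<Rightarrow> real"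
  assumes f: "\<And>k. 0 \<le> f k" and z: "0 < z"
  shows "(\<lambda>m. exp (- z * (\<Sum>k<m. f k))) \<longlonglongrightarrow> (if summable f then exp (- z * suminf f) else 0)"
proof (cases "summable f")
  case True
  then have "(\<lambda>m. exp (- z * (\<Sum>k<m. f k))) \<longlonglongrightarrow> exp (- z * suminf f)"
    by (intro tendsto_intros summable_LIMSEQ)
  then show ?thesis using True by simp
next
  case False
  have "filterlim (\<lambda>m. \<Sum>k<m. f k) at_top sequentially"
    unfolding filterlim_at_top
  proof
    fix C :: real
    obtain m where m: "C < (\<Sum>k<m. f k)"
      using summableI_nonneg_bounded[of f C] f False by (meson not_le)
    have "\<forall>m'\<ge>m. C \<le> (\<Sum>k<m'. f k)"
    proof (intro allI impI)
      fix m' assume "m \<le> m'"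
      then have "(\<Sum>k<m. f k) \<le> (\<Sum>k<m'. f k)" using f by (intro sum_mono2) auto
      with m show "C \<le> (\<Sum>k<m'. f k)" by simp
    qed
    then show "\<forall>\<^sub>F m in sequentially. C \<le> (\<Sum>k<m. f k)"
      by (auto simp: eventually_sequentially)
  qed
  then have "filterlim (\<lambda>m. - z * (\<Sum>k<m. f k)) at_bot sequentially"
    using z by (intro filterlim_tendsto_neg_mult_at_bot[OF tendsto_const]) auto
  then have "(\<lambda>m. exp (- z * (\<Sum>k<m. f k))) \<longlonglongrightarrow> 0"
    by (rule filterlim_compose[OF exp_at_bot])
  then show ?thesis using False by simp
qed

lemma norm_mult_le_1:
  fixes a b :: real
  shows "0 \<le> a \<Longrightarrow> a \<le> 1 \<Longrightarrow> 0 \<le> b \<Longrightarrow> b \<le> 1 \<Longrightarrow> norm (a * b) \<le> 1"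
  by (simp add: mult_le_one)

lemma square_powr_half:
  fixes d :: real
  assumes "0 \<le> d"
  shows "(d\<^sup>2) powr (- (\<alpha> / 2)) = d powr (- \<alpha>)"
proof (cases "d = 0")
  case False
  with assms have "d\<^sup>2 = d powr 2" by simp
  then show ?thesis by (simp only: powr_powr) simp
qed simp

text \<open>The linear bound is Bernoulli's inequality for
  \<open>1 / (1 + y) = 1 - y / (1 + y)\<close>; it later cancels the singularity
  \<open>1 / z\<close> at the origin.\<close>

lemma power_reciprocal_bounds:
  fixes y :: real
  assumes "0 \<le> y"
  shows "0 \<le> 1 - 1 / (1 + y) ^ n" "1 - 1 / (1 + y) ^ n \<le> 1" "1 - 1 / (1 + y) ^ n \<le> n * y"
proof -
  have p: "0 < 1 / (1 + y) ^ n" "1 / (1 + y) ^ n \<le> 1"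
    using assms by (auto simp: one_le_power)
  then show "0 \<le> 1 - 1 / (1 + y) ^ n" "1 - 1 / (1 + y) ^ n \<le> 1" by auto
  have "1 / (1 + y) = 1 + (- (y / (1 + y)))" "y / (1 + y) \<le> 1" "y / (1 + y) \<le> y"
    using assms by (auto simp: field_simps)
  then have "1 + real n * (- (y / (1 + y))) \<le> (1 / (1 + y)) ^ n"
    using Bernoulli_inequality[of "- (y / (1 + y))" n] by simp
  moreover have "real n * (y / (1 + y)) \<le> real n * y"
    using \<open>y / (1 + y) \<le> y\<close> by (intro mult_left_mono) auto
  ultimately show "1 - 1 / (1 + y) ^ n \<le> n * y"
    by (simp add: power_divide)
qed

section \<open>Laplace transforms of signal and interference, and convergence of the
  interference\<close>

context sic_link
begin

text \<open>The transform at \<open>z\<close> of one standard exponential gain attenuated over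
  squared distance \<open>u\<close>; the exponent is halved because \<open>u\<close> is a
  square.\<close>

definition path_gain :: "real \<Rightarrow> real \<Rightarrow> real" where
  "path_gain z u = 1 / (1 + z * u powr (- (\<alpha> / 2)))"

text \<open>The expectation of \<open>1 - exp (- z * X \<omega>)\<close> with the direct fading
  already integrated out.\<close>

definition gain_deficit :: "real \<Rightarrow> real" where
  "gain_deficit z = expectation (\<lambda>\<omega>. 1 - 1 / (1 + z * d0 \<omega> powr (- \<alpha>)) ^ n)"

text \<open>The transform of the interference after integrating out the fading and all arrivals
  beyond the \<open>L\<close>-th; only the distance of the last known interferer is left.\<close>

definition interference_laplace :: "real \<Rightarrow> real" where
  "interference_laplace z = expectation (\<lambda>\<omega>. exp (- \<mu> * (LINT u|lborel. (if (D L \<omega>)\<^sup>2 < u then 1 - path_gain z u else 0))))"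

lemma path_gain_bounds: "0 \<le> z \<Longrightarrow> 0 \<le> path_gain z u" "0 \<le> z \<Longrightarrow> path_gain z u \<le> 1"
  by (auto simp: path_gain_def divide_le_eq add_pos_nonneg)

lemma path_gain_meas [measurable]: "path_gain z \<in> borel_measurable borel"
  unfolding path_gain_def[abs_def] by measurable

lemma one_minus_path_gain: "0 \<le> z \<Longrightarrow> 1 - path_gain z u = z * u powr (- (\<alpha> / 2)) / (1 + z * u powr (- (\<alpha> / 2)))"
proof -
  assume "0 \<le> z"
  then have "0 < 1 + z * u powr (- (\<alpha> / 2))" by (intro add_pos_nonneg) auto
  then show ?thesis unfolding path_gain_def by (simp add: field_simps)
qed

text \<open>Near the origin the integrand is at most 1; beyond 1 it is at most
  \<open>z * u powr (- (\<alpha> / 2))\<close>, integrable because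
  \<open>\<alpha> > 2\<close>.\<close>

lemma integrable_one_minus_path_gain:
  assumes z: "0 < z"
  shows "integrable lborel (\<lambda>u. if 0 < u then 1 - path_gain z u else 0)"
proof -
  have tail: "integrable lborel (\<lambda>u. indicator {1..} u * u powr (- (\<alpha> / 2)))"
  proof (rule integrableI_nonneg)
    let ?e = "1 - \<alpha> / 2"
    have "(\<integral>\<^sup>+u. ennreal (u powr (- (\<alpha> / 2))) * indicator {1..} u \<partial>lborel) = ennreal (0 - 1 powr ?e / ?e)"
    proof (rule nn_integral_FTC_atLeast[where F="\<lambda>u. u powr ?e / ?e"])
      fix u :: real assume "1 \<le> u"
      then show "((\<lambda>u. u powr ?e / ?e) has_real_derivative u powr (- (\<alpha> / 2))) (at u)"
        using \<alpha> by (auto intro!: derivative_eq_intros)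
    next
      have "((\<lambda>u. u powr ?e) \<longlongrightarrow> 0) at_top"
        using \<alpha> by (intro tendsto_neg_powr filterlim_ident) auto
      then show "((\<lambda>u. u powr ?e / ?e) \<longlongrightarrow> 0) at_top"
        using tendsto_divide[OF _ tendsto_const[of ?e at_top], of "\<lambda>u. u powr ?e" 0] \<alpha> by simp
    qed auto
    moreover have "ennreal (indicator {1..} u * u powr (- (\<alpha> / 2))) = ennreal (u powr (- (\<alpha> / 2))) * indicator {1..} u" for u :: real
      by (simp add: indicator_def)
    ultimately show "(\<integral>\<^sup>+u. ennreal (indicator {1..} u * u powr (- (\<alpha> / 2))) \<partial>lborel) < \<infinity>"
      by simp
  qed auto
  show ?thesis
  proof (rule Bochner_Integration.integrable_bound)
    show "integrable lborel (\<lambda>u. indicator {0..1} u + z * (indicator {1..} u * u powr (- (\<alpha> / 2))))"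
      by (intro Bochner_Integration.integrable_add integrable_mult_right tail integrable_real_indicator) auto
    show "AE u in lborel. norm (if 0 < u then 1 - path_gain z u else 0)
        \<le> norm (indicator {0..1} u + z * (indicator {1..} u * u powr (- (\<alpha> / 2))))"
    proof (rule AE_I2)
      fix u :: real
      have b: "0 \<le> path_gain z u" "path_gain z u \<le> 1" using path_gain_bounds z by auto
      have q: "1 - path_gain z u \<le> z * u powr (- (\<alpha> / 2))"
        using z by (subst one_minus_path_gain) (auto simp: divide_le_eq add_pos_nonneg mult_nonneg_nonneg mult_le_cancel_left1)
      show "norm (if 0 < u then 1 - path_gain z u else 0)
        \<le> norm (indicator {0..1} u + z * (indicator {1..} u * u powr (- (\<alpha> / 2))))"
        using b q z by (auto simp: indicator_def)
    qed
  qed measurable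
qed

lemma expectation_gain_interference:
  assumes z: "0 \<le> w" "0 \<le> z"
  shows "expectation (\<lambda>\<omega>. (1 - exp (- w * X \<omega>)) *
      (\<Prod>k\<in>{L<..L + m}. exp (- z * (G k \<omega> * D k \<omega> powr (- \<alpha>)))))
    = gain_deficit w * expectation (\<lambda>\<omega>. \<Prod>k\<in>{L<..L + m}. 1 / (1 + z * D k \<omega> powr (- \<alpha>)))"
proof -
  have X0: "0 \<le> 1 - exp (- w * X \<omega>)" for \<omega> using z X_nonneg by simp
  have a0: "0 \<le> 1 - 1 / (1 + w * d0 \<omega> powr (- \<alpha>)) ^ n" for \<omega>
    using z by (intro power_reciprocal_bounds) auto
  have p0: "0 \<le> (\<Prod>k\<in>{L<..L + m}. 1 / (1 + z * D k \<omega> powr (- \<alpha>)))" for \<omega>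
    using z by (intro prod_nonneg) auto
  have e0: "0 \<le> (\<Prod>k\<in>{L<..L + m}. exp (- z * (G k \<omega> * D k \<omega> powr (- \<alpha>))))" for \<omega>
    by (intro prod_nonneg) auto
  have "expectation (\<lambda>\<omega>. (1 - exp (- w * X \<omega>)) *
      (\<Prod>k\<in>{L<..L + m}. exp (- z * (G k \<omega> * D k \<omega> powr (- \<alpha>)))))
    = enn2real (\<integral>\<^sup>+\<omega>. ennreal (1 - exp (- w * X \<omega>)) *
      (\<Prod>k\<in>{L<..L + m}. ennreal (exp (- z * (G k \<omega> * D k \<omega> powr (- \<alpha>))))) \<partial>M)"
    using X0 e0 by (subst integral_eq_nn_integral) (auto simp: ennreal_mult prod_ennreal intro!: AE_I2 mult_nonneg_nonneg)
  also have "\<dots> = enn2real (\<integral>\<^sup>+\<omega>. ennreal (1 - 1 / (1 + w * d0 \<omega> powr (- \<alpha>)) ^ n) \<partial>M)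
      * enn2real (\<integral>\<^sup>+\<omega>. (\<Prod>k\<in>{L<..L + m}. ennreal (1 / (1 + z * D k \<omega> powr (- \<alpha>)))) \<partial>M)"
    unfolding nn_integral_gain_interference[OF z] by (rule enn2real_mult)
  also have "enn2real (\<integral>\<^sup>+\<omega>. ennreal (1 - 1 / (1 + w * d0 \<omega> powr (- \<alpha>)) ^ n) \<partial>M) = gain_deficit w"
    unfolding gain_deficit_def using a0 by (subst integral_eq_nn_integral) (auto intro!: AE_I2)
  also have "enn2real (\<integral>\<^sup>+\<omega>. (\<Prod>k\<in>{L<..L + m}. ennreal (1 / (1 + z * D k \<omega> powr (- \<alpha>)))) \<partial>M)
      = expectation (\<lambda>\<omega>. \<Prod>k\<in>{L<..L + m}. 1 / (1 + z * D k \<omega> powr (- \<alpha>)))"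
    using p0 z by (subst integral_eq_nn_integral) (auto simp: prod_ennreal intro!: AE_I2)
  finally show ?thesis .
qed

lemma expectation_path_gains_tendsto:
  assumes z: "0 < z"
  shows "(\<lambda>m. expectation (\<lambda>\<omega>. \<Prod>k\<in>{L<..L + m}. 1 / (1 + z * D k \<omega> powr (- \<alpha>)))) \<longlonglongrightarrow> interference_laplace z"
proof -
  have "(\<lambda>m. expectation (\<lambda>\<omega>. \<Prod>k\<in>{L<..L + m}. path_gain z ((D k \<omega>)\<^sup>2))) \<longlonglongrightarrow> interference_laplace z"
    unfolding interference_laplace_def
  proof (rule renewal_limit[OF L])
    show "continuous_on {0<..} (path_gain z)"
      unfolding path_gain_def[abs_def]
    proof (intro continuous_intros ballI)
      fix u :: real
      have "0 < 1 + z * u powr (- (\<alpha> / 2))" using z by (intro add_pos_nonneg) auto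
      then show "1 + z * u powr (- (\<alpha> / 2)) \<noteq> 0" by simp
    qed auto
  qed (use z path_gain_bounds integrable_one_minus_path_gain in auto)
  moreover have "expectation (\<lambda>\<omega>. \<Prod>k\<in>{L<..L + m}. path_gain z ((D k \<omega>)\<^sup>2))
      = expectation (\<lambda>\<omega>. \<Prod>k\<in>{L<..L + m}. 1 / (1 + z * D k \<omega> powr (- \<alpha>)))" for m
  proof (rule integral_cong_AE)
    show "AE \<omega> in M. (\<Prod>k\<in>{L<..L + m}. path_gain z ((D k \<omega>)\<^sup>2)) = (\<Prod>k\<in>{L<..L + m}. 1 / (1 + z * D k \<omega> powr (- \<alpha>)))"
      using D_nonneg by eventually_elim (simp add: path_gain_def square_powr_half)
  qed measurable
  ultimately show ?thesis by simp
qed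

text \<open>The finite-interferer identity passes to the limit by dominated convergence. The
  \<open>if\<close> records the true limit of the exponentials, since \<open>Y\<close> has no
  meaning where the series diverges.\<close>

lemma expectation_limit:
  assumes w: "0 \<le> w" and z: "0 < z"
  defines "f \<equiv> \<lambda>\<omega>. (1 - exp (- w * X \<omega>)) *
    (if summable (\<lambda>k. G (L + 1 + k) \<omega> * D (L + 1 + k) \<omega> powr (- \<alpha>)) then exp (- z * Y \<omega>) else 0)"
  shows "f \<in> borel_measurable M" and "expectation f = gain_deficit w * interference_laplace z"
proof -
  let ?u = "\<lambda>m \<omega>. (1 - exp (- w * X \<omega>)) * (\<Prod>k\<in>{L<..L + m}. exp (- z * (G k \<omega> * D k \<omega> powr (- \<alpha>))))"
  have lim: "(\<lambda>m. ?u m \<omega>) \<longlonglongrightarrow> f \<omega>" for \<omega>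
    unfolding prod_exp_partial_sum[where f="\<lambda>k. G k \<omega> * D k \<omega> powr (- \<alpha>)" for \<omega>] Y_def f_def
    using exp_partial_sums_tendsto[OF _ z, of "\<lambda>k. G (L + 1 + k) \<omega> * D (L + 1 + k) \<omega> powr (- \<alpha>)"] G_nonneg
    by (intro tendsto_mult tendsto_const) auto
  have u_meas: "?u m \<in> borel_measurable M" for m by measurable
  show meas: "f \<in> borel_measurable M"
    by (rule borel_measurable_LIMSEQ_real[OF lim u_meas])
  have "(\<lambda>m. expectation (?u m)) \<longlonglongrightarrow> expectation f"
  proof (rule integral_dominated_convergence[where w="\<lambda>_. 1"])
    show "AE \<omega> in M. norm (?u m \<omega>) \<le> 1" for m
    proof (rule AE_I2)
      fix \<omega>
      have "0 \<le> 1 - exp (- w * X \<omega>)" "1 - exp (- w * X \<omega>) \<le> 1" using w X_nonneg by auto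
      moreover have "0 \<le> (\<Prod>k\<in>{L<..L + m}. exp (- z * (G k \<omega> * D k \<omega> powr (- \<alpha>))))"
        "(\<Prod>k\<in>{L<..L + m}. exp (- z * (G k \<omega> * D k \<omega> powr (- \<alpha>)))) \<le> 1"
        using z G_nonneg by (auto intro!: prod_nonneg prod_le_1)
      ultimately show "norm (?u m \<omega>) \<le> 1" by (simp add: mult_le_one)
    qed
  qed (use lim meas u_meas in auto)
  moreover have "(\<lambda>m. expectation (?u m)) \<longlonglongrightarrow> gain_deficit w * interference_laplace z"
    using z unfolding expectation_gain_interference[OF w less_imp_le[OF z]]
    by (intro tendsto_mult tendsto_const expectation_path_gains_tendsto)
  ultimately show "expectation f = gain_deficit w * interference_laplace z" by (rule LIMSEQ_unique)
qed

lemma interference_laplace_bounds: "0 \<le> z \<Longrightarrow> 0 \<le> interference_laplace z" "0 \<le> z \<Longrightarrow> interference_laplace z \<le> 1"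
proof -
  assume z: "0 \<le> z"
  have I0: "0 \<le> (LINT u|lborel. (if (D L \<omega>)\<^sup>2 < u then 1 - path_gain z u else 0))" for \<omega>
    using path_gain_bounds[OF z] by (intro Bochner_Integration.integral_nonneg) auto
  show "0 \<le> interference_laplace z" unfolding interference_laplace_def by (intro Bochner_Integration.integral_nonneg) auto
  have "interference_laplace z \<le> expectation (\<lambda>_. 1)"
    unfolding interference_laplace_def
  proof (rule integral_mono)
    show "integrable M (\<lambda>\<omega>. exp (- \<mu> * (LINT u|lborel. (if (D L \<omega>)\<^sup>2 < u then 1 - path_gain z u else 0))))"
      by (rule integrable_const_bound[where B=1]) (use I0 rate in \<open>auto intro!: AE_I2\<close>)
  qed (use I0 rate in auto)
  then show "interference_laplace z \<le> 1" by (simp add: prob_space)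
qed

text \<open>Enlarging the range of integration to all positive \<open>u\<close> bounds the transform
  below by the deterministic \<open>exp (- \<mu> * J z)\<close>. The integral \<open>J z\<close>
  tends to 0, dominated by its integrand at \<open>z = 1\<close>.\<close>

lemma interference_laplace_tendsto_1: "(\<lambda>k. interference_laplace (1 / real (Suc k))) \<longlonglongrightarrow> 1"
proof -
  let ?z = "\<lambda>k. 1 / real (Suc k)"
  define J where "J z = (LINT u|lborel. (if 0 < u then 1 - path_gain z u else 0))" for z
  have "(\<lambda>k. J (?z k)) \<longlonglongrightarrow> (LINT u|(lborel :: real measure). (0::real))"
    unfolding J_def
  proof (rule integral_dominated_convergence)
    show "integrable lborel (\<lambda>u. if 0 < u then 1 - path_gain 1 u else 0)"
      by (rule integrable_one_minus_path_gain) simp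
    have z0: "?z \<longlonglongrightarrow> 0" by (rule LIMSEQ_Suc[OF lim_1_over_n])
    show "AE u in lborel. (\<lambda>k. if 0 < u then 1 - path_gain (?z k) u else 0) \<longlonglongrightarrow> 0"
    proof (rule AE_I2)
      fix u :: real
      have "(\<lambda>k. 1 - path_gain (?z k) u) \<longlonglongrightarrow> 1 - 1 / (1 + 0 * u powr (- (\<alpha> / 2)))"
        unfolding path_gain_def by (intro tendsto_intros z0) auto
      then show "(\<lambda>k. if 0 < u then 1 - path_gain (?z k) u else 0) \<longlonglongrightarrow> 0"
        by (cases "0 < u") (simp_all del: of_nat_Suc)
    qed
    show "AE u in lborel. norm (if 0 < u then 1 - path_gain (?z k) u else 0) \<le> (if 0 < u then 1 - path_gain 1 u else 0)" for k
    proof (rule AE_I2)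
      fix u :: real
      have "?z k * u powr (- (\<alpha> / 2)) \<le> 1 * u powr (- (\<alpha> / 2))"
        by (intro mult_right_mono) auto
      then have "path_gain 1 u \<le> path_gain (?z k) u"
        unfolding path_gain_def by (intro divide_left_mono mult_pos_pos add_pos_nonneg) auto
      then show "norm (if 0 < u then 1 - path_gain (?z k) u else 0) \<le> (if 0 < u then 1 - path_gain 1 u else 0)"
        using path_gain_bounds[of "?z k" u] by auto
    qed
  qed measurable
  then have J0: "(\<lambda>k. exp (- \<mu> * J (?z k))) \<longlonglongrightarrow> 1"
    using tendsto_exp[OF tendsto_mult[OF tendsto_const[of "- \<mu>"]], of "\<lambda>k. J (?z k)" 0 sequentially] by simp
  have low: "exp (- \<mu> * J z) \<le> interference_laplace z" if z: "0 < z" for z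
  proof -
    have "J z \<ge> (LINT u|lborel. (if (D L \<omega>)\<^sup>2 < u then 1 - path_gain z u else 0))" for \<omega>
      unfolding J_def
    proof (rule integral_mono)
      have pos: "0 < u" if "(D L \<omega>)\<^sup>2 < u" for u using that by (rule le_less_trans[rotated]) simp
      show "integrable lborel (\<lambda>u. if (D L \<omega>)\<^sup>2 < u then 1 - path_gain z u else 0)"
        by (rule Bochner_Integration.integrable_bound[OF integrable_one_minus_path_gain[OF z]]) (auto simp: pos)
      show "(if (D L \<omega>)\<^sup>2 < u then 1 - path_gain z u else 0) \<le> (if 0 < u then 1 - path_gain z u else 0)" for u
        using pos[of u] path_gain_bounds[of z u] z by auto
    qed (rule integrable_one_minus_path_gain[OF z])
    then have le: "exp (- \<mu> * J z) \<le> exp (- \<mu> * (LINT u|lborel. (if (D L \<omega>)\<^sup>2 < u then 1 - path_gain z u else 0)))" for \<omega>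
      using rate by simp
    have I0: "0 \<le> (LINT u|lborel. (if (D L \<omega>)\<^sup>2 < u then 1 - path_gain z u else 0))" for \<omega>
      using path_gain_bounds[of z] z by (intro Bochner_Integration.integral_nonneg) auto
    have "expectation (\<lambda>_. exp (- \<mu> * J z)) \<le> interference_laplace z"
      unfolding interference_laplace_def
    proof (rule integral_mono)
      show "integrable M (\<lambda>\<omega>. exp (- \<mu> * (LINT u|lborel. (if (D L \<omega>)\<^sup>2 < u then 1 - path_gain z u else 0))))"
        by (rule integrable_const_bound[where B=1]) (use I0 rate in \<open>auto intro!: AE_I2\<close>)
    qed (use le in auto)
    then show ?thesis by (simp add: prob_space)
  qed
  show ?thesis
  proof (rule real_tendsto_sandwich[OF _ _ J0 tendsto_const])
    show "\<forall>\<^sub>F k in sequentially. exp (- \<mu> * J (?z k)) \<le> interference_laplace (?z k)"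
      using low by (intro always_eventually) auto
    show "\<forall>\<^sub>F k in sequentially. interference_laplace (?z k) \<le> 1"
      using interference_laplace_bounds by (intro always_eventually) auto
  qed
qed

text \<open>If the series of the interference diverged with positive probability on \<open>X > 0\<close>, its Laplace
  transform would not tend to that of a finite random variable at \<open>0\<close>.\<close>

lemma AE_summable_interference:
  "AE \<omega> in M. X \<omega> \<noteq> 0 \<longrightarrow> summable (\<lambda>k. G (L + 1 + k) \<omega> * D (L + 1 + k) \<omega> powr (- \<alpha>))"
proof -
  let ?S = "\<lambda>\<omega>. summable (\<lambda>k. G (L + 1 + k) \<omega> * D (L + 1 + k) \<omega> powr (- \<alpha>))"
  let ?z = "\<lambda>k. 1 / real (Suc k)"
  let ?u = "\<lambda>k \<omega>. (1 - exp (- 1 * X \<omega>)) * (if ?S \<omega> then exp (- ?z k * Y \<omega>) else 0)"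
  let ?f = "\<lambda>\<omega>. (1 - exp (- 1 * X \<omega>)) * (if ?S \<omega> then 1 else 0)"
  have lim: "(\<lambda>k. ?u k \<omega>) \<longlonglongrightarrow> ?f \<omega>" for \<omega>
  proof -
    have "(\<lambda>k. exp (- ?z k * Y \<omega>)) \<longlonglongrightarrow> exp (- 0 * Y \<omega>)"
      by (intro tendsto_intros LIMSEQ_Suc[OF lim_1_over_n])
    then have e: "(\<lambda>k. exp (- ?z k * Y \<omega>)) \<longlonglongrightarrow> 1" by (simp del: of_nat_Suc)
    show ?thesis
    proof (cases "?S \<omega>")
      case True
      from tendsto_mult[OF tendsto_const e] show ?thesis by (simp only: True if_True)
    next
      case False
      show ?thesis by (simp only: False if_False tendsto_const)
    qed
  qed
  have u_meas: "?u k \<in> borel_measurable M" for k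
    using expectation_limit(1)[of 1 "?z k"] by simp
  have f_meas: "?f \<in> borel_measurable M"
    by (rule borel_measurable_LIMSEQ_real[OF lim u_meas])
  have X01: "0 \<le> 1 - exp (- 1 * X \<omega>)" "1 - exp (- 1 * X \<omega>) \<le> 1" for \<omega>
    using X_nonneg[of \<omega>] by auto
  have "(\<lambda>k. expectation (?u k)) \<longlonglongrightarrow> expectation ?f"
  proof (rule integral_dominated_convergence[where w="\<lambda>_. 1"])
    show "AE \<omega> in M. norm (?u k \<omega>) \<le> 1" for k
    proof (rule AE_I2)
      fix \<omega>
      have "0 \<le> Y \<omega>" if "?S \<omega>"
        unfolding Y_def using that G_nonneg by (intro suminf_nonneg) auto
      then have "0 \<le> (if ?S \<omega> then exp (- ?z k * Y \<omega>) else 0)" "(if ?S \<omega> then exp (- ?z k * Y \<omega>) else 0) \<le> 1"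
        by (auto simp del: of_nat_Suc)
      with X01[of \<omega>] show "norm (?u k \<omega>) \<le> 1" by (rule norm_mult_le_1)
    qed
  qed (use lim f_meas u_meas in auto)
  moreover have "(\<lambda>k. expectation (?u k)) \<longlonglongrightarrow> gain_deficit 1 * 1"
  proof -
    have "expectation (?u k) = gain_deficit 1 * interference_laplace (?z k)" for k
      using expectation_limit(2)[of 1 "?z k"] by (simp del: of_nat_Suc)
    then show ?thesis
      using tendsto_mult[OF tendsto_const[of "gain_deficit 1"] interference_laplace_tendsto_1] by (simp only:)
  qed
  ultimately have 1: "expectation ?f = gain_deficit 1" using LIMSEQ_unique[of "\<lambda>k. expectation (?u k)"] by (simp only: mult_1_right)
  \<comment> \<open>With \<open>m = 0\<close> the product over interferers is empty, which yields
    the expectation of the signal factor alone.\<close>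
  have 2: "expectation (\<lambda>\<omega>. 1 - exp (- 1 * X \<omega>)) = gain_deficit 1"
    using expectation_gain_interference[of 1 0 0] by (simp add: prob_space)
  have int: "integrable M (\<lambda>\<omega>. 1 - exp (- 1 * X \<omega>))" "integrable M ?f"
    using X01 f_meas by (auto intro!: integrable_const_bound[where B=1] AE_I2)
  \<comment> \<open>The nonnegative part lost to divergence; having mean 0, it vanishes almost
    everywhere, and it is positive where \<open>X\<close> is nonzero and the series
    diverges.\<close>
  define d where "d = (\<lambda>\<omega>. (1 - exp (- 1 * X \<omega>)) - ?f \<omega>)"
  have "expectation d = 0"
    unfolding d_def Bochner_Integration.integral_diff[OF int] 1 2 by simp
  moreover have "integrable M d"
    unfolding d_def by (rule Bochner_Integration.integrable_diff[OF int])
  moreover have "0 \<le> d \<omega>" for \<omega>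
    using X01[of \<omega>] by (cases "?S \<omega>") (simp_all add: d_def)
  ultimately have "AE \<omega> in M. d \<omega> = 0"
    using integral_nonneg_eq_0_iff_AE[of M d] by simp
  then show ?thesis
  proof eventually_elim
    case (elim \<omega>)
    then show ?case by (cases "?S \<omega>") (simp_all add: d_def)
  qed
qed

lemma expectation_exp_interference:
  assumes z: "0 < z"
  shows "expectation (\<lambda>\<omega>. (1 - exp (- z * X \<omega>)) * exp (- z * Y \<omega>)) = gain_deficit z * interference_laplace z"
proof -
  let ?S = "\<lambda>\<omega>. summable (\<lambda>k. G (L + 1 + k) \<omega> * D (L + 1 + k) \<omega> powr (- \<alpha>))"
  have "expectation (\<lambda>\<omega>. (1 - exp (- z * X \<omega>)) * exp (- z * Y \<omega>))
     = expectation (\<lambda>\<omega>. (1 - exp (- z * X \<omega>)) * (if ?S \<omega> then exp (- z * Y \<omega>) else 0))"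
  proof (rule integral_cong_AE)
    show "AE \<omega> in M. (1 - exp (- z * X \<omega>)) * exp (- z * Y \<omega>)
        = (1 - exp (- z * X \<omega>)) * (if ?S \<omega> then exp (- z * Y \<omega>) else 0)"
      using AE_summable_interference by eventually_elim auto
  qed (use expectation_limit(1)[of z z] z in auto)
  then show ?thesis using expectation_limit(2)[of z z] z by simp
qed

lemma interference_laplace_meas [measurable]: "interference_laplace \<in> borel_measurable borel"
  unfolding interference_laplace_def[abs_def] path_gain_def by measurable

lemma gain_deficit_bounds: "0 \<le> z \<Longrightarrow> 0 \<le> gain_deficit z"
  unfolding gain_deficit_def by (intro Bochner_Integration.integral_nonneg power_reciprocal_bounds) auto

lemma AE_Y_nonneg: "AE \<omega> in M. X \<omega> \<noteq> 0 \<longrightarrow> 0 \<le> Y \<omega>"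
  using AE_summable_interference
proof eventually_elim
  case (elim \<omega>)
  show ?case
  proof
    assume "X \<omega> \<noteq> 0"
    with elim show "0 \<le> Y \<omega>" unfolding Y_def using G_nonneg by (intro suminf_nonneg) auto
  qed
qed

text \<open>The logarithm formula is applied pointwise with \<open>x = X \<omega>\<close> and
  \<open>y = Y \<omega> + c\<close>. If \<open>X \<omega> = 0\<close> both sides are 0 without any
  information on the sign of \<open>Y \<omega>\<close>.\<close>

lemma nn_integral_ln_sinr:
  "(\<integral>\<^sup>+\<omega>. ennreal (ln (1 + X \<omega> / (Y \<omega> + c))) \<partial>M)
    = (\<integral>\<^sup>+z. ennreal (gain_deficit z * interference_laplace z * exp (- z * c) / z) * indicator {0<..} z \<partial>lborel)"
proof -
  interpret pair_sigma_finite M "lborel :: real measure" ..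
  let ?f = "\<lambda>\<omega> z. ennreal ((1 - exp (- z * X \<omega>)) * exp (- z * (Y \<omega> + c)) / z) * indicator {0<..} z"
  have "(\<integral>\<^sup>+\<omega>. ennreal (ln (1 + X \<omega> / (Y \<omega> + c))) \<partial>M) = (\<integral>\<^sup>+\<omega>. (\<integral>\<^sup>+z. ?f \<omega> z \<partial>lborel) \<partial>M)"
  proof (rule nn_integral_cong_AE)
    show "AE \<omega> in M. ennreal (ln (1 + X \<omega> / (Y \<omega> + c))) = (\<integral>\<^sup>+z. ?f \<omega> z \<partial>lborel)"
      using AE_Y_nonneg
    proof eventually_elim
      case (elim \<omega>)
      show ?case
      proof (cases "X \<omega> = 0")
        case False
        then have "0 < Y \<omega> + c" using elim c by simp
        from nn_integral_frullani[OF X_nonneg this] show ?thesis by simp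
      qed simp
    qed
  qed
  also have "\<dots> = (\<integral>\<^sup>+z. (\<integral>\<^sup>+\<omega>. ?f \<omega> z \<partial>M) \<partial>lborel)"
    by (rule Fubini'[symmetric]) measurable
  also have "\<dots> = (\<integral>\<^sup>+z. ennreal (gain_deficit z * interference_laplace z * exp (- z * c) / z) * indicator {0<..} z \<partial>lborel)"
  proof (rule nn_integral_cong)
    fix z :: real
    show "(\<integral>\<^sup>+\<omega>. ?f \<omega> z \<partial>M) = ennreal (gain_deficit z * interference_laplace z * exp (- z * c) / z) * indicator {0<..} z"
    proof (cases "0 < z")
      case z: True
      let ?g = "\<lambda>\<omega>. (1 - exp (- z * X \<omega>)) * exp (- z * Y \<omega>)"
      have g0: "0 \<le> ?g \<omega>" for \<omega> using z X_nonneg by simp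
      have int: "integrable M ?g"
      proof (rule integrable_const_bound[where B=1])
        show "AE \<omega> in M. norm (?g \<omega>) \<le> 1"
          using AE_Y_nonneg
        proof eventually_elim
          case (elim \<omega>)
          show ?case
          proof (cases "X \<omega> = 0")
            case False
            with elim z X_nonneg[of \<omega>] show ?thesis by (intro norm_mult_le_1) auto
          qed simp
        qed
      qed measurable
      have "(\<integral>\<^sup>+\<omega>. ?f \<omega> z \<partial>M) = (\<integral>\<^sup>+\<omega>. ennreal (?g \<omega>) * ennreal (exp (- z * c) / z) \<partial>M)"
      proof (rule nn_integral_cong)
        fix \<omega>
        have "exp (- z * (Y \<omega> + c)) = exp (- z * Y \<omega>) * exp (- z * c)"
          by (simp add: exp_add[symmetric] algebra_simps)
        then have "(1 - exp (- z * X \<omega>)) * exp (- z * (Y \<omega> + c)) / z = ?g \<omega> * (exp (- z * c) / z)" by simp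
        then show "?f \<omega> z = ennreal (?g \<omega>) * ennreal (exp (- z * c) / z)"
          using z g0[of \<omega>] by (simp only: ennreal_mult[symmetric] divide_nonneg_pos exp_ge_zero) simp
      qed
      also have "\<dots> = ennreal (expectation ?g) * ennreal (exp (- z * c) / z)"
        using int g0 by (subst nn_integral_multc) (auto simp: nn_integral_eq_integral)
      also have "\<dots> = ennreal (gain_deficit z * interference_laplace z * exp (- z * c) / z)"
        using z gain_deficit_bounds[of z] interference_laplace_bounds(1)[of z]
        unfolding expectation_exp_interference[OF z] by (simp add: ennreal_mult[symmetric])
      finally show ?thesis using z by simp
    qed simp
  qed
  finally show ?thesis .
qed

text \<open>Writing \<open>gain_deficit\<close> as an integral over the density of \<open>d0\<close>
  and exchanging gives the iterated integral. The bound on \<open>f\<close> makes it finite, which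
  turns the identity of nonnegative integrals into integrability and a real value.\<close>

lemma has_bochner_integral_ln_sinr:
  assumes Rd: "1 < Rd"
    and d0: "distributed M lborel d0 (\<lambda>r. ennreal (indicator {1..Rd} r * (2 * r / (Rd\<^sup>2 - 1))))"
  shows "has_bochner_integral M (\<lambda>\<omega>. ln (1 + X \<omega> / (Y \<omega> + c)))
    (LINT x:{1..Rd}|lborel. (LINT z:{0<..}|lborel.
        (1 - 1 / (1 + z * x powr (- \<alpha>)) ^ n) * interference_laplace z / (z * exp (z * c))) * (2 * x / (Rd\<^sup>2 - 1)))"
proof -
  define w where "w r = indicator {1..Rd} r * (2 * r / (Rd\<^sup>2 - 1))" for r :: real
  define f where "f r z = (1 - 1 / (1 + z * r powr (- \<alpha>)) ^ n) * interference_laplace z / (z * exp (z * c))" for r z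
  define \<phi> where "\<phi> r = (LINT z:{0<..}|lborel. f r z)" for r
  have Rd2: "0 < Rd\<^sup>2 - 1" using Rd by (simp add: one_less_power)
  have w0: "0 \<le> w r" for r using Rd2 by (auto simp: w_def indicator_def)
  have [measurable]: "w \<in> borel_measurable borel" unfolding w_def[abs_def] by measurable
  have [measurable]: "(\<lambda>(r, z). f r z) \<in> borel_measurable (lborel \<Otimes>\<^sub>M lborel)"
    unfolding f_def by measurable
  have f0: "0 \<le> f r z" if "0 < z" for r z
    unfolding f_def using that power_reciprocal_bounds(1)[of "z * r powr (- \<alpha>)" n] interference_laplace_bounds(1)[of z] by auto
  \<comment> \<open>For \<open>r \<ge> 1\<close> the path loss is at most 1, so the linear bound
    \<open>n * z\<close> cancels the \<open>z\<close> in the denominator and the noise term supplies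
    exponential decay.\<close>
  have fle: "f r z \<le> real n * exp (- z * c)" if "0 < z" "1 \<le> r" for r z
  proof -
    have "r powr (- \<alpha>) \<le> r powr 0" using that \<alpha> by (intro powr_mono) auto
    then have p: "r powr (- \<alpha>) \<le> 1" using that by simp
    have "(1 - 1 / (1 + z * r powr (- \<alpha>)) ^ n) * interference_laplace z \<le> (real n * z) * 1"
    proof (intro mult_mono)
      have "1 - 1 / (1 + z * r powr (- \<alpha>)) ^ n \<le> real n * (z * r powr (- \<alpha>))"
        using that by (intro power_reciprocal_bounds) auto
      also have "\<dots> \<le> real n * (z * 1)"
        using that p by (intro mult_left_mono) auto
      finally show "1 - 1 / (1 + z * r powr (- \<alpha>)) ^ n \<le> real n * z" by simp
    qed (use that interference_laplace_bounds in auto)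
    then have "f r z \<le> (real n * z) / (z * exp (z * c))"
      unfolding f_def using that by (intro divide_right_mono) auto
    also have "\<dots> = real n * exp (- z * c)" using that by (simp add: exp_minus field_simps)
    finally show ?thesis .
  qed
  have exp_c: "(\<integral>\<^sup>+z. ennreal (real n * exp (- z * c)) * indicator {0<..} z \<partial>lborel) = ennreal (real n / c)"
  proof -
    have "(\<integral>\<^sup>+z. ennreal (real n * exp (- z * c)) * indicator {0<..} z \<partial>lborel)
      = (\<integral>\<^sup>+z. ennreal (real n) * (ennreal (exp (- z * c)) * indicator {0<..} z) \<partial>lborel)"
      by (intro nn_integral_cong) (simp add: ennreal_mult mult.assoc)
    also have "\<dots> = ennreal (real n) * ennreal (1 / c)"
      unfolding nn_integral_exp_Ioi[OF c, symmetric] by (rule nn_integral_cmult) measurable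
    finally show ?thesis using c by (simp add: ennreal_mult[symmetric])
  qed
  have inner: "(\<integral>\<^sup>+z. ennreal (f r z) * indicator {0<..} z \<partial>lborel) = ennreal (\<phi> r)"
    and \<phi>_le: "\<phi> r \<le> real n / c" if r: "1 \<le> r" for r
  proof -
    have ind: "ennreal (indicator {0<..} z *\<^sub>R f r z) = ennreal (f r z) * indicator {0<..} z" for z
      by (simp add: indicator_def)
    have pos: "0 \<le> indicator {0<..} z *\<^sub>R f r z" for z using f0[of z r] by (auto simp: indicator_def)
    have le: "(\<integral>\<^sup>+z. ennreal (f r z) * indicator {0<..} z \<partial>lborel) \<le> ennreal (real n / c)"
      unfolding exp_c[symmetric] using fle[OF _ r]
      by (intro nn_integral_mono) (auto simp: indicator_def intro: ennreal_leI)
    have int: "integrable lborel (\<lambda>z. indicator {0<..} z *\<^sub>R f r z)"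
    proof (rule integrableI_nonneg)
      show "(\<integral>\<^sup>+z. ennreal (indicator {0<..} z *\<^sub>R f r z) \<partial>lborel) < \<infinity>"
        unfolding ind using le by (simp add: le_less_trans)
    qed (use pos in auto)
    show eq: "(\<integral>\<^sup>+z. ennreal (f r z) * indicator {0<..} z \<partial>lborel) = ennreal (\<phi> r)"
      unfolding ind[symmetric] \<phi>_def set_lebesgue_integral_def using int pos by (intro nn_integral_eq_integral) auto
    show "\<phi> r \<le> real n / c"
      using le c unfolding eq by (subst (asm) ennreal_le_iff) auto
  qed
  have \<phi>0: "0 \<le> \<phi> r" for r
    unfolding \<phi>_def set_lebesgue_integral_def using f0 by (intro Bochner_Integration.integral_nonneg) (auto simp: indicator_def)
  have [measurable]: "\<phi> \<in> borel_measurable borel"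
    unfolding \<phi>_def[abs_def] set_lebesgue_integral_def by measurable
  have int_w: "integrable lborel (\<lambda>r. w r * \<phi> r)"
  proof (rule Bochner_Integration.integrable_bound)
    show "integrable lborel (\<lambda>r. indicator {1..Rd} r * (2 * Rd / (Rd\<^sup>2 - 1) * (real n / c)))"
      using emeasure_lborel_Icc[of 1 Rd] Rd by (intro integrable_mult_left integrable_real_indicator) auto
    show "AE r in lborel. norm (w r * \<phi> r) \<le> norm (indicator {1..Rd} r * (2 * Rd / (Rd\<^sup>2 - 1) * (real n / c)))"
    proof (rule AE_I2)
      fix r
      show "norm (w r * \<phi> r) \<le> norm (indicator {1..Rd} r * (2 * Rd / (Rd\<^sup>2 - 1) * (real n / c)))"
      proof (cases "r \<in> {1..Rd}")
        case True
        have "2 * r / (Rd\<^sup>2 - 1) * \<phi> r \<le> 2 * Rd / (Rd\<^sup>2 - 1) * (real n / c)"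
          using True Rd2 \<phi>_le[of r] \<phi>0[of r] c by (intro mult_mono divide_right_mono) auto
        then show ?thesis
          using True Rd2 \<phi>0[of r] c Rd by (simp add: w_def abs_mult)
      qed (simp add: w_def)
    qed
  qed measurable
  have gain_deficit_eq: "ennreal (gain_deficit z) = (\<integral>\<^sup>+r. ennreal (w r) * ennreal (1 - 1 / (1 + z * r powr (- \<alpha>)) ^ n) \<partial>lborel)"
    if z: "0 \<le> z" for z
  proof -
    have b: "0 \<le> 1 - 1 / (1 + z * x powr (- \<alpha>)) ^ n" "1 - 1 / (1 + z * x powr (- \<alpha>)) ^ n \<le> 1" for x
      using z by (intro power_reciprocal_bounds; simp)+
    have "ennreal (gain_deficit z) = (\<integral>\<^sup>+\<omega>. ennreal (1 - 1 / (1 + z * d0 \<omega> powr (- \<alpha>)) ^ n) \<partial>M)"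
      unfolding gain_deficit_def using b
      by (intro nn_integral_eq_integral[symmetric] integrable_const_bound[where B=1]) (auto intro!: AE_I2)
    also have "\<dots> = (\<integral>\<^sup>+r. ennreal (w r) * ennreal (1 - 1 / (1 + z * r powr (- \<alpha>)) ^ n) \<partial>lborel)"
      unfolding w_def by (rule distributed_nn_integral[OF d0, symmetric]) measurable
    finally show ?thesis .
  qed
  have "(\<integral>\<^sup>+\<omega>. ennreal (ln (1 + X \<omega> / (Y \<omega> + c))) \<partial>M)
      = (\<integral>\<^sup>+z. (\<integral>\<^sup>+r. ennreal (w r) * (ennreal (f r z) * indicator {0<..} z) \<partial>lborel) \<partial>lborel)"
    unfolding nn_integral_ln_sinr
  proof (rule nn_integral_cong)
    fix z :: real
    show "ennreal (gain_deficit z * interference_laplace z * exp (- z * c) / z) * indicator {0<..} z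
      = (\<integral>\<^sup>+r. ennreal (w r) * (ennreal (f r z) * indicator {0<..} z) \<partial>lborel)"
    proof (cases "0 < z")
      case z: True
      have q0: "0 \<le> interference_laplace z / (z * exp (z * c))" using z interference_laplace_bounds(1)[of z] by auto
      have "gain_deficit z * interference_laplace z * exp (- z * c) / z = gain_deficit z * (interference_laplace z / (z * exp (z * c)))"
        using z by (simp add: exp_minus field_simps)
      then have "ennreal (gain_deficit z * interference_laplace z * exp (- z * c) / z) = ennreal (gain_deficit z) * ennreal (interference_laplace z / (z * exp (z * c)))"
        using q0 gain_deficit_bounds[of z] z by (simp only: ennreal_mult[symmetric] less_imp_le)
      also have "\<dots> = (\<integral>\<^sup>+r. ennreal (w r) * ennreal (1 - 1 / (1 + z * r powr (- \<alpha>)) ^ n) * ennreal (interference_laplace z / (z * exp (z * c))) \<partial>lborel)"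
        unfolding gain_deficit_eq[OF less_imp_le[OF z]] by (rule nn_integral_multc[symmetric]) measurable
      also have "\<dots> = (\<integral>\<^sup>+r. ennreal (w r) * (ennreal (f r z) * indicator {0<..} z) \<partial>lborel)"
      proof (rule nn_integral_cong)
        fix r
        have "0 \<le> 1 - 1 / (1 + z * r powr (- \<alpha>)) ^ n" using z by (intro power_reciprocal_bounds) auto
        then have "ennreal (f r z) = ennreal (1 - 1 / (1 + z * r powr (- \<alpha>)) ^ n) * ennreal (interference_laplace z / (z * exp (z * c)))"
          using q0 unfolding f_def by (simp only: ennreal_mult[symmetric] times_divide_eq_right)
        then show "ennreal (w r) * ennreal (1 - 1 / (1 + z * r powr (- \<alpha>)) ^ n) * ennreal (interference_laplace z / (z * exp (z * c)))
          = ennreal (w r) * (ennreal (f r z) * indicator {0<..} z)"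
          using z by (simp add: mult.assoc)
      qed
      finally show ?thesis using z by simp
    qed simp
  qed
  also have "\<dots> = (\<integral>\<^sup>+r. (\<integral>\<^sup>+z. ennreal (w r) * (ennreal (f r z) * indicator {0<..} z) \<partial>lborel) \<partial>lborel)"
    by (rule lborel_pair.Fubini') measurable
  also have "\<dots> = (\<integral>\<^sup>+r. ennreal (w r * \<phi> r) \<partial>lborel)"
  proof (rule nn_integral_cong)
    fix r
    have "(\<integral>\<^sup>+z. ennreal (w r) * (ennreal (f r z) * indicator {0<..} z) \<partial>lborel)
      = ennreal (w r) * (\<integral>\<^sup>+z. ennreal (f r z) * indicator {0<..} z \<partial>lborel)"
      by (rule nn_integral_cmult) measurable
    also have "\<dots> = ennreal (w r * \<phi> r)"
    proof (cases "1 \<le> r")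
      case True
      then show ?thesis using w0 \<phi>0 by (simp add: inner ennreal_mult)
    qed (simp add: w_def)
    finally show "(\<integral>\<^sup>+z. ennreal (w r) * (ennreal (f r z) * indicator {0<..} z) \<partial>lborel) = ennreal (w r * \<phi> r)" .
  qed
  also have "\<dots> = ennreal (LINT r|lborel. w r * \<phi> r)"
    using w0 \<phi>0 by (intro nn_integral_eq_integral[OF int_w]) (auto intro!: AE_I2)
  finally have nn: "(\<integral>\<^sup>+\<omega>. ennreal (ln (1 + X \<omega> / (Y \<omega> + c))) \<partial>M) = ennreal (LINT r|lborel. w r * \<phi> r)" .
  have "has_bochner_integral M (\<lambda>\<omega>. ln (1 + X \<omega> / (Y \<omega> + c))) (LINT r|lborel. w r * \<phi> r)"
  proof (rule has_bochner_integral_nn_integral[OF _ _ _ nn])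
    show "AE \<omega> in M. 0 \<le> ln (1 + X \<omega> / (Y \<omega> + c))"
      using AE_Y_nonneg
    proof eventually_elim
      case (elim \<omega>)
      then show ?case
        using c X_nonneg[of \<omega>] by (cases "X \<omega> = 0") (auto intro!: ln_ge_zero divide_nonneg_pos add_nonneg_pos)
    qed
    show "0 \<le> (LINT r|lborel. w r * \<phi> r)"
      using w0 \<phi>0 by (intro Bochner_Integration.integral_nonneg) auto
  qed measurable
  also have "(LINT r|lborel. w r * \<phi> r) = (LINT x:{1..Rd}|lborel. \<phi> x * (2 * x / (Rd\<^sup>2 - 1)))"
    unfolding set_lebesgue_integral_def w_def by (intro Bochner_Integration.integral_cong) auto
  finally show ?thesis unfolding \<phi>_def f_def .
qed

text \<open>\<open>interference_laplace\<close> depends on \<open>D L\<close> only through its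
  square, so it can be integrated against the density of the square root of the arrival time. The
  integrand is rewritten by multiplying numerator and denominator by
  \<open>u powr (\<alpha> / 2) / z\<close>.\<close>

lemma interference_laplace_eq_laplace_interference:
  assumes \<mu>: "\<mu> = lam * pi" and z: "0 < z"
  shows "interference_laplace z = laplace_interference lam \<alpha> L z"
proof -
  define \<psi> where "\<psi> r = exp (- \<mu> * (LINT u|lborel. (if r\<^sup>2 < u then 1 - path_gain z u else 0)))" for r
  define \<rho> where "\<rho> r = (if 0 < r then 2 * (\<mu> * r\<^sup>2) ^ L / (r * Gamma (real L)) * exp (- \<mu> * r\<^sup>2) else 0)" for r
  have dist: "distributed M lborel (\<lambda>\<omega>. sqrt ((D L \<omega>)\<^sup>2)) (\<lambda>r. ennreal (\<rho> r))"
    unfolding \<rho>_def by (rule distributed_sqrt_arrival[OF L])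
  have \<rho>0: "0 \<le> \<rho> r" for r
    using rate L by (auto simp: \<rho>_def intro!: mult_nonneg_nonneg divide_nonneg_nonneg Gamma_real_nonneg)
  have "interference_laplace z = expectation (\<lambda>\<omega>. \<psi> (sqrt ((D L \<omega>)\<^sup>2)))"
    by (simp add: interference_laplace_def \<psi>_def)
  also have "\<dots> = (LINT r|lborel. \<rho> r * \<psi> r)"
  proof (rule distributed_integral[OF dist, symmetric])
    show "\<psi> \<in> borel_measurable lborel" unfolding \<psi>_def[abs_def] by measurable
  qed (use \<rho>0 in auto)
  also have "\<dots> = laplace_interference lam \<alpha> L z"
    unfolding laplace_interference_def set_lebesgue_integral_def
  proof (intro Bochner_Integration.integral_cong refl)
    fix r :: real
    have "(if r\<^sup>2 < u then 1 - path_gain z u else 0) = indicator {r\<^sup>2<..} u *\<^sub>R (1 / (1 + inverse z * u powr (\<alpha> / 2)))" for u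
    proof (cases "r\<^sup>2 < u")
      case True
      then have u: "0 < u" by (rule le_less_trans[rotated]) simp
      define p where "p = u powr (\<alpha> / 2)"
      have p: "0 < p" using u by (simp add: p_def)
      have "1 - path_gain z u = z * inverse p / (1 + z * inverse p)"
        using z by (simp add: one_minus_path_gain powr_minus p_def)
      also have "\<dots> = 1 / (1 + inverse z * p)"
        using z p by (simp add: field_simps)
      finally show ?thesis using True by (simp add: p_def)
    qed simp
    then show "\<rho> r * \<psi> r = indicator {0<..} r *\<^sub>R (exp (- pi * lam * (LINT u|lborel. indicator {r\<^sup>2<..} u *\<^sub>R (1 / (1 + inverse z * u powr (\<alpha> / 2))))) *
        (2 * (lam * pi * r\<^sup>2) ^ L / (r * Gamma (real L))) * exp (- lam * pi * r\<^sup>2))"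
      by (simp add: \<rho>_def \<psi>_def \<mu> mult_ac)
  qed
  finally show ?thesis .
qed

end

text \<open>Each encoded variable is measurable for the algebra generated by its own source; for the
  distances this is measurability of \<open>nth_dist\<close> as a function of the configuration. Its
  events therefore lie in the given independent families.\<close>

lemma (in prob_space) indep_vars_source_var:
  fixes \<Phi> :: "'a \<Rightarrow> 'b::euclidean_space set" and d0 :: "'a \<Rightarrow> real" and h :: "nat \<Rightarrow> 'a \<Rightarrow> complex Matrix.vec"
  assumes \<Phi>: "\<Phi> \<in> M \<rightarrow>\<^sub>M config_algebra"
    and indep: "indep_sets (source_events M d0 \<Phi> h) ({Direct_Distance, Interferers} \<union> {Fading j i | j i. i < n})"
  shows "indep_vars (\<lambda>_. PiM UNIV (\<lambda>_. borel))
    (source_var n d0 (\<lambda>j \<omega>. nth_dist p (\<Phi> \<omega>) j) (\<lambda>k i \<omega>. h k \<omega> $ i))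
    ({Direct_Distance, Interferers} \<union> {Fading j i | j i. i < n})"
    (is "indep_vars (\<lambda>_. ?V) ?X ?I")
proof -
  have pre: "?X s -` A \<inter> space M \<in> source_events M d0 \<Phi> h s" if s: "s \<in> ?I" and A: "A \<in> sets ?V" for s A
  proof (cases s)
    case Direct_Distance
    let ?S = "vimage_algebra (space M) d0 borel"
    have [measurable]: "d0 \<in> borel_measurable ?S" by (rule measurable_vimage_algebra1) auto
    have "?X s \<in> ?S \<rightarrow>\<^sub>M ?V"
      by (rule measurable_PiM_single') (auto simp: source_var_def Direct_Distance)
    from measurable_sets[OF this A] show ?thesis by (simp add: source_events_def Direct_Distance)
  next
    case Interferers
    let ?S = "vimage_algebra (space M) \<Phi> config_algebra"
    have "\<Phi> \<in> ?S \<rightarrow>\<^sub>M config_algebra"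
      using measurable_space[OF \<Phi>] by (intro measurable_vimage_algebra1) auto
    then have [measurable]: "(\<lambda>\<omega>. nth_dist p (\<Phi> \<omega>) j) \<in> borel_measurable ?S" for j
      by (rule measurable_nth_dist)
    have "?X s \<in> ?S \<rightarrow>\<^sub>M ?V"
      by (rule measurable_PiM_single') (auto simp: source_var_def Interferers)
    from measurable_sets[OF this A] show ?thesis by (simp add: source_events_def Interferers)
  next
    case (Fading k i)
    then have i: "i < n" using s by auto
    let ?S = "vimage_algebra (space M) (\<lambda>\<omega>. h k \<omega> $ i) borel"
    have [measurable]: "(\<lambda>\<omega>. h k \<omega> $ i) \<in> borel_measurable ?S" by (rule measurable_vimage_algebra1) auto
    have "?X s \<in> ?S \<rightarrow>\<^sub>M ?V"
      using i by (intro measurable_PiM_single') (auto simp: source_var_def Fading)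
    from measurable_sets[OF this A] show ?thesis by (simp add: source_events_def Fading)
  qed
  have ev: "source_events M d0 \<Phi> h s \<subseteq> events" if "s \<in> ?I" for s
    using indep[unfolded indep_sets_def, THEN conjunct1] that by (rule bspec)
  have "random_variable ?V (?X s)" if "s \<in> ?I" for s
  proof (rule measurableI)
    show "?X s \<omega> \<in> space ?V" for \<omega> by (simp add: space_PiM)
    show "?X s -` A \<inter> space M \<in> events" if "A \<in> sets ?V" for A
      using pre[OF \<open>s \<in> ?I\<close> that] ev[OF \<open>s \<in> ?I\<close>] by auto
  qed
  moreover have "indep_sets (\<lambda>s. {?X s -` A \<inter> space M | A. A \<in> sets ?V}) ?I"
    by (rule indep_sets_mono_sets[OF indep]) (use pre in auto)
  ultimately show ?thesis unfolding indep_vars_def2 by blast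
qed

theorem theorem3:
  fixes M :: "'w measure"
    and lam \<alpha> Rd SNR :: real
    and Nr L :: nat
    and rx :: "real ^ 2"
    and \<Phi> :: "'w \<Rightarrow> (real ^ 2) set"
    and d0 :: "'w \<Rightarrow> real"
    and h :: "nat \<Rightarrow> 'w \<Rightarrow> complex vec"
    and Q R :: "'w \<Rightarrow> complex mat"
  defines "sinr \<equiv> \<lambda>\<omega>. sinr_sic \<alpha> SNR L (Q \<omega>) (R \<omega>) (d0 \<omega>) (\<lambda>j. h j \<omega>) (nth_dist rx (\<Phi> \<omega>))"
  assumes "lam > 0" and "\<alpha> > 2" and "Rd > 1" and "SNR > 0"
    and "1 \<le> L" and "L + 1 \<le> Nr"
    and "prob_space M"
    and direct_distance:
      "distributed M lborel d0 (\<lambda>r. ennreal (indicator {1..Rd} r * (2 * r / (Rd\<^sup>2 - 1))))"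
    and interferers: "homogeneous_ppp M lam \<Phi>"
    and fading_dim: "\<And>j \<omega>. \<omega> \<in> space M \<Longrightarrow> h j \<omega> \<in> carrier_vec Nr"
    and fading: "\<And>j i. i < Nr \<Longrightarrow>
      distributed M lborel (\<lambda>\<omega>. h j \<omega> $ i) (\<lambda>z. ennreal (cn01_density z))"
    and indep: "prob_space.indep_sets M (source_events M d0 \<Phi> h)
      ({Direct_Distance, Interferers} \<union> {Fading j i | j i. i < Nr})"
    and qr: "\<And>\<omega>. \<omega> \<in> space M \<Longrightarrow> is_QR (channel_matrix Nr L (\<lambda>j. h j \<omega>)) (Q \<omega>) (R \<omega>)"
  shows "integrable M (\<lambda>\<omega>. log 2 (1 + sinr \<omega>)) \<and>
    sum_spectral_efficiency lam M sinr =
      lam / ln 2 * (LINT x:{1..Rd}|lborel.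
        (LINT z:{0<..}|lborel.
          (1 - 1 / (1 + z * x powr (- \<alpha>)) ^ Nr) * laplace_interference lam \<alpha> L z /
          (z * exp (z / SNR))) * (2 * x / (Rd\<^sup>2 - 1)))"
proof -
  interpret prob_space M by fact
  have \<Phi>: "\<Phi> \<in> M \<rightarrow>\<^sub>M config_algebra" using interferers by (simp add: homogeneous_ppp_def)
  interpret sic: sic_link M "lam * pi" "\<lambda>t \<omega>. card (\<Phi> \<omega> \<inter> cball rx (sqrt t))" "\<lambda>j \<omega>. nth_dist rx (\<Phi> \<omega>) j"
    \<alpha> "1 / SNR" d0 "\<lambda>k i \<omega>. h k \<omega> $ i" Nr L
  proof (rule sic_link.intro)
    show "poisson_arrivals M (lam * pi) (\<lambda>t \<omega>. card (\<Phi> \<omega> \<inter> cball rx (sqrt t))) (\<lambda>j \<omega>. (nth_dist rx (\<Phi> \<omega>) j)\<^sup>2)"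
      by (rule poisson_arrivals_ppp) fact+
    show "sic_link_axioms M (\<lambda>j \<omega>. nth_dist rx (\<Phi> \<omega>) j) \<alpha> (1 / SNR) d0 (\<lambda>k i \<omega>. h k \<omega> $ i) Nr L"
    proof
      show "d0 \<in> borel_measurable M" using distributed_measurable[OF direct_distance] by simp
      show "(\<lambda>\<omega>. nth_dist rx (\<Phi> \<omega>) j) \<in> borel_measurable M" for j by (rule measurable_nth_dist[OF \<Phi>])
      show "AE \<omega> in M. \<forall>j. 0 \<le> nth_dist rx (\<Phi> \<omega>) j" by (rule AE_nth_dist_nonneg) fact+
      show "indep_vars (\<lambda>_. PiM UNIV (\<lambda>_. borel))
        (source_var Nr d0 (\<lambda>j \<omega>. nth_dist rx (\<Phi> \<omega>) j) (\<lambda>k i \<omega>. h k \<omega> $ i))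
        ({Direct_Distance, Interferers} \<union> {Fading j i | j i. i < Nr})"
        by (rule indep_vars_source_var[OF \<Phi> indep])
    qed (use assms in auto)
  qed
  \<comment> \<open>Here \<open>Q\<close> and \<open>R\<close> are eliminated pointwise. If the
    direct channel vanishes, \<open>G\<close> need not agree with the effective gain, but both
    numerators are 0.\<close>
  have eq: "log 2 (1 + sinr \<omega>) = ln (1 + sic.X \<omega> / (sic.Y \<omega> + 1 / SNR)) / ln 2" if \<omega>: "\<omega> \<in> space M" for \<omega>
  proof -
    have Nr: "0 < Nr" using \<open>L + 1 \<le> Nr\<close> by simp
    note QR = QR_first_coordinate[where h="\<lambda>j. h j \<omega>", OF fading_dim[OF \<omega>] Nr qr[OF \<omega>]]
    have H: "(cmod (R \<omega> $$ (0, 0)))\<^sup>2 = sic.H \<omega>" using QR(1) by (simp add: sic.H_def)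
    have "sinr \<omega> = sic.X \<omega> / (sic.Y \<omega> + 1 / SNR)"
    proof (cases "sic.H \<omega> = 0")
      case True
      then show ?thesis unfolding sinr_def sinr_sic_def H by (simp add: sic.X_def)
    next
      case False
      have "effective_gain (Q \<omega>) (h k \<omega>) = sic.G k \<omega>" for k
        using QR(2)[OF fading_dim[OF \<omega>], of k] False unfolding H sic.G_def by (simp add: field_simps)
      then show ?thesis
        unfolding sinr_def sinr_sic_def H sic_interference_def sic.X_def sic.Y_def by simp
    qed
    then show ?thesis by (simp add: log_def)
  qed
  let ?I = "LINT x:{1..Rd}|lborel. (LINT z:{0<..}|lborel.
        (1 - 1 / (1 + z * x powr (- \<alpha>)) ^ Nr) * sic.interference_laplace z / (z * exp (z * (1 / SNR)))) * (2 * x / (Rd\<^sup>2 - 1))"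
  have "has_bochner_integral M (\<lambda>\<omega>. ln (1 + sic.X \<omega> / (sic.Y \<omega> + 1 / SNR)) / ln 2) (?I / ln 2)"
    by (intro has_bochner_integral_divide sic.has_bochner_integral_ln_sinr direct_distance \<open>Rd > 1\<close>)
  then have int: "has_bochner_integral M (\<lambda>\<omega>. log 2 (1 + sinr \<omega>)) (?I / ln 2)"
    by (subst has_bochner_integral_cong[OF refl eq refl])
  \<comment> \<open>The two forms of the interference transform have been identified for
    \<open>z > 0\<close> only, which is the range of integration.\<close>
  have "(LINT z:{0<..}|lborel. (1 - 1 / (1 + z * x powr (- \<alpha>)) ^ Nr) * sic.interference_laplace z / (z * exp (z * (1 / SNR))))
    = (LINT z:{0<..}|lborel. (1 - 1 / (1 + z * x powr (- \<alpha>)) ^ Nr) * laplace_interference lam \<alpha> L z / (z * exp (z / SNR)))" for x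
    by (rule set_lebesgue_integral_cong) (auto simp: sic.interference_laplace_eq_laplace_interference)
  then show ?thesis
    using int unfolding sum_spectral_efficiency_def
    by (auto simp: has_bochner_integral_integral_eq intro: integrable.intros)
qed

end
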